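(* Let $X$ be a compact degenerate balanced manifold with $\dim_{\mathbb{C}}X=n\geq 2$. (i) The Bott-Chern cohomology groups of types $(1,0)$ and $(0,1)$ of $X$ vanish: $H^{1,0}_{BC}(X,\mathbb{C})=0$ and $H^{0,1}_{BC}(X,\mathbb{C})=0$. (ii) If, moreover, for every smooth $\mathbb{C}$-valued $(1,1)$-form $v$ on $X$ such that $dv=0$ the implication $v\in\operatorname{Im}\partial\Longrightarrow v\in\operatorname{Im}(\partial\bar\partial)$ holds, then the De Rham cohomology group of degree $1$ of $X$ vanishes: $H^1_{DR}(X,\mathbb{C})=0$.
   Context: A Hermitian metric on a complex manifold is identified with its associated smooth positive definite $(1,1)$-form $\omega$. A Hermitian metric $\omega$ on an $n$-dimensional complex manifold is degenerate balanced if $\omega^{n-1}$ is $d$-exact; a compact complex manifold is degenerate balanced if it carries such a metric. The Bott-Chern cohomology group $H^{p,q}_{BC}(X,\mathbb{C})$ is the quotient of the space of smooth $(p,q)$-forms lying in $\ker\partial\cap\ker\bar\partial$ by the image under $\partial\bar\partial$ of the space of smooth $(p-1,q-1)$-forms (the latter space being $0$ if $p=0$ or $q=0$). *)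

theory Defs
  imports
    "HOL-Analysis.Analysis"
    "HOL-Algebra.Elementary_Groups"
    "HOL-Library.Function_Algebras"
begin

section \<open>Smooth and holomorphic maps between open subsets of vector spaces\<close>

fun Ck_on :: "nat \<Rightarrow> ('v::real_normed_vector \<Rightarrow> 'w::real_normed_vector) \<Rightarrow> 'v set \<Rightarrow> bool" where
  "Ck_on 0 f S \<longleftrightarrow> continuous_on S f"
| "Ck_on (Suc k) f S \<longleftrightarrow>
     (\<forall>x\<in>S. f differentiable (at x)) \<and>
     (\<forall>v. Ck_on k (\<lambda>x. frechet_derivative f (at x) v) S)"

definition smooth_on :: "('v::real_normed_vector \<Rightarrow> 'w::real_normed_vector) \<Rightarrow> 'v set \<Rightarrow> bool" where
  "smooth_on f S \<longleftrightarrow> (\<forall>k. Ck_on k f S)"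

definition holomorphic_map_on :: "(complex^'n \<Rightarrow> complex^'m) \<Rightarrow> (complex^'n) set \<Rightarrow> bool" where
  "holomorphic_map_on F S \<longleftrightarrow>
     (\<forall>x\<in>S. \<exists>L. (F has_derivative L) (at x) \<and> (\<forall>c v. L (c *s v) = c *s L v))"

section \<open>Complex manifolds\<close>

text \<open>A chart is a pair of its domain and its coordinate map; the values of the coordinate map
  outside the domain are irrelevant. The underlying space of the manifold is a whole type.
  Manifolds are not required to be connected.\<close>

type_synonym ('a, 'n) chart = "'a set \<times> ('a \<Rightarrow> complex^'n)"

definition chart_image :: "('a, 'n) chart \<Rightarrow> (complex^'n) set" where
  "chart_image c = snd c ` fst c"

definition is_chart :: "('a::topological_space, 'n::finite) chart \<Rightarrow> bool" where
  "is_chart c \<longleftrightarrow> open (fst c) \<and> open (chart_image c) \<and>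
     (\<exists>g. homeomorphism (fst c) (chart_image c) (snd c) g)"

definition transition :: "('a, 'n) chart \<Rightarrow> ('a, 'n) chart \<Rightarrow> complex^'n \<Rightarrow> complex^'n" where
  "transition c c' = snd c' \<circ> inv_into (fst c) (snd c)"

definition complex_manifold ::
    "('a::{t2_space, second_countable_topology}, 'n::finite) chart set \<Rightarrow> bool" where
  "complex_manifold A \<longleftrightarrow>
     (\<forall>c\<in>A. is_chart c) \<and> (\<Union>c\<in>A. fst c) = UNIV \<and>
     (\<forall>c\<in>A. \<forall>c'\<in>A. holomorphic_map_on (transition c c') (snd c ` (fst c \<inter> fst c')))"

section \<open>Alternating multilinear forms on a vector space\<close>

text \<open>A \<open>k\<close>-form is a function on lists of vectors that vanishes on lists whose length is
  not \<open>k\<close>.\<close>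

type_synonym 'v altform = "'v list \<Rightarrow> complex"

definition alternating :: "nat \<Rightarrow> ('v::real_vector) altform \<Rightarrow> bool" where
  "alternating k \<alpha> \<longleftrightarrow>
     (\<forall>vs. length vs \<noteq> k \<longrightarrow> \<alpha> vs = 0) \<and>
     (\<forall>vs i. length vs = k \<and> i < k \<longrightarrow> linear (\<lambda>w. \<alpha> (vs[i := w]))) \<and>
     (\<forall>vs i j. length vs = k \<and> i < j \<and> j < k \<and> vs ! i = vs ! j \<longrightarrow> \<alpha> vs = 0)"

text \<open>The exterior product as a sum over shuffles: \<open>S\<close> is the set of positions of the vectors
  passed to \<open>\<alpha>\<close>, and the sign is that of the corresponding shuffle, counted by its inversions.
  No factorials occur, so that \<open>(\<theta> \<and> \<eta>)(v, w) = \<theta>(v) \<eta>(w) - \<theta>(w) \<eta>(v)\<close> for 1-forms.\<close>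

definition alt_wedge :: "'v altform \<Rightarrow> 'v altform \<Rightarrow> 'v altform" where
  "alt_wedge \<alpha> \<beta> vs =
     (\<Sum>S\<in>Pow {..<length vs}.
        (- 1) ^ card {(i, j). i \<in> S \<and> j \<in> {..<length vs} - S \<and> j < i}
        * \<alpha> (nths vs S) * \<beta> (nths vs (- S)))"

definition alt_one :: "'v altform" where
  "alt_one vs = (if vs = [] then 1 else 0)"

fun alt_power :: "'v altform \<Rightarrow> nat \<Rightarrow> 'v altform" where
  "alt_power \<alpha> 0 = alt_one"
| "alt_power \<alpha> (Suc k) = alt_wedge \<alpha> (alt_power \<alpha> k)"

definition alt_covector :: "('v \<Rightarrow> complex) \<Rightarrow> 'v altform" where
  "alt_covector \<theta> vs = (if length vs = 1 then \<theta> (hd vs) else 0)"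

definition dz :: "'n \<Rightarrow> (complex^'n) altform" where
  "dz i = alt_covector (\<lambda>v. v $ i)"

definition dzbar :: "'n \<Rightarrow> (complex^'n) altform" where
  "dzbar j = alt_covector (\<lambda>v. cnj (v $ j))"

definition dz_dzbar :: "'n list \<Rightarrow> 'n list \<Rightarrow> (complex^'n) altform" where
  "dz_dzbar I J = foldr alt_wedge (map dz I @ map dzbar J) alt_one"

text \<open>Type \<open>(p,q)\<close>: a complex combination of the \<open>dz\<^sub>I \<and> dzbar\<^sub>J\<close> with \<open>|I| = p\<close>, \<open>|J| = q\<close>.
  The multi-indices are not required to be increasing; the span is the same.\<close>

definition alt_type :: "nat \<Rightarrow> nat \<Rightarrow> (complex^'n::finite) altform \<Rightarrow> bool" where
  "alt_type p q \<alpha> \<longleftrightarrow>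
     (\<exists>a. \<forall>vs. \<alpha> vs = (\<Sum>I\<in>{I. length I = p}. \<Sum>J\<in>{J. length J = q}. a I J * dz_dzbar I J vs))"

section \<open>Differential forms\<close>

text \<open>A complex-valued differential form on a manifold is the family of its expressions in the
  charts of the atlas, compatible under pullback by the transition maps. The expressions are
  extended by 0 off the chart images (and off the atlas), so that two forms are equal
  as forms iff they are equal as functions.\<close>

type_synonym ('a, 'n) dform = "('a, 'n) chart \<Rightarrow> complex^'n \<Rightarrow> (complex^'n) altform"

definition dforms ::
    "('a::{t2_space, second_countable_topology}, 'n::finite) chart set \<Rightarrow> nat \<Rightarrow> ('a, 'n) dform set" where
  "dforms A k = {\<alpha>.
     (\<forall>c x. \<not> (c \<in> A \<and> x \<in> chart_image c) \<longrightarrow> \<alpha> c x = 0) \<and>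
     (\<forall>c\<in>A. \<forall>x\<in>chart_image c. alternating k (\<alpha> c x)) \<and>
     (\<forall>c\<in>A. \<forall>vs. smooth_on (\<lambda>x. \<alpha> c x vs) (chart_image c)) \<and>
     (\<forall>c\<in>A. \<forall>c'\<in>A. \<forall>p\<in>fst c \<inter> fst c'. \<forall>vs.
        \<alpha> c (snd c p) vs =
        \<alpha> c' (snd c' p) (map (frechet_derivative (transition c c') (at (snd c p))) vs))}"

definition pq_forms ::
    "('a::{t2_space, second_countable_topology}, 'n::finite) chart set \<Rightarrow> nat \<Rightarrow> nat \<Rightarrow> ('a, 'n) dform set" where
  "pq_forms A p q = {\<alpha> \<in> dforms A (p + q). \<forall>c\<in>A. \<forall>x\<in>chart_image c. alt_type p q (\<alpha> c x)}"

definition wedge_power :: "('a, 'n) dform \<Rightarrow> nat \<Rightarrow> ('a, 'n) dform" where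
  "wedge_power \<alpha> k = (\<lambda>c x. alt_power (\<alpha> c x) k)"

subsection \<open>The operators \<open>d\<close>, \<open>\<partial>\<close> and \<open>dbar\<close>\<close>

text \<open>The differential \<open>df\<close> of a function and its complex-linear and complex-antilinear parts,
  i.e. the sums over \<open>j\<close> of \<open>(\<partial>f/\<partial>z\<^sub>j) dz\<^sub>j\<close> and \<open>(\<partial>f/\<partial>zbar\<^sub>j) dzbar\<^sub>j\<close>, at \<open>x\<close> applied
  to \<open>v\<close>.\<close>

definition fun_d :: "(complex^'n::finite \<Rightarrow> complex) \<Rightarrow> complex^'n \<Rightarrow> complex^'n \<Rightarrow> complex" where
  "fun_d f x v = frechet_derivative f (at x) v"

definition fun_del :: "(complex^'n::finite \<Rightarrow> complex) \<Rightarrow> complex^'n \<Rightarrow> complex^'n \<Rightarrow> complex" where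
  "fun_del f x v = (fun_d f x v - \<i> * fun_d f x (\<i> *s v)) / 2"

definition fun_delbar :: "(complex^'n::finite \<Rightarrow> complex) \<Rightarrow> complex^'n \<Rightarrow> complex^'n \<Rightarrow> complex" where
  "fun_delbar f x v = (fun_d f x v + \<i> * fun_d f x (\<i> *s v)) / 2"

text \<open>For a derivation \<open>D\<close> on functions, with \<open>(D f) x\<close> a covector, this is the operator that in
  each chart maps \<open>f dx\<^sub>K\<close> (\<open>dx\<^sub>K\<close> a constant form, e.g. \<open>dz\<^sub>I \<and> dzbar\<^sub>J\<close>) to \<open>D f \<and> dx\<^sub>K\<close>:
  its value on \<open>v\<^sub>0, ..., v\<^sub>k\<close> is the sum over \<open>i\<close> of \<open>(-1)^i\<close> times the \<open>D\<close>-derivative in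
  the direction \<open>v\<^sub>i\<close> of \<open>\<alpha>\<close> evaluated on the remaining vectors.\<close>

definition ext_op ::
    "((complex^'n::finite \<Rightarrow> complex) \<Rightarrow> complex^'n \<Rightarrow> complex^'n \<Rightarrow> complex) \<Rightarrow>
     ('a, 'n) chart set \<Rightarrow> ('a, 'n) dform \<Rightarrow> ('a, 'n) dform" where
  "ext_op D A \<alpha> = (\<lambda>c x vs.
     if c \<in> A \<and> x \<in> chart_image c
     then \<Sum>i<length vs. (- 1) ^ i * D (\<lambda>y. \<alpha> c y (take i vs @ drop (Suc i) vs)) x (vs ! i)
     else 0)"

definition ext_d :: "('a, 'n::finite) chart set \<Rightarrow> ('a, 'n) dform \<Rightarrow> ('a, 'n) dform" where
  "ext_d = ext_op fun_d"

definition del :: "('a, 'n::finite) chart set \<Rightarrow> ('a, 'n) dform \<Rightarrow> ('a, 'n) dform" where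
  "del = ext_op fun_del"

definition delbar :: "('a, 'n::finite) chart set \<Rightarrow> ('a, 'n) dform \<Rightarrow> ('a, 'n) dform" where
  "delbar = ext_op fun_delbar"

section \<open>Cohomology groups\<close>

definition quotient_group :: "'f::{plus, zero} set \<Rightarrow> 'f set \<Rightarrow> 'f set monoid" where
  "quotient_group Z B = \<lparr>carrier = Z, mult = (+), one = 0\<rparr> Mod B"

definition deRham_cocycles ::
    "('a::{t2_space, second_countable_topology}, 'n::finite) chart set \<Rightarrow> nat \<Rightarrow> ('a, 'n) dform set" where
  "deRham_cocycles A k = {\<alpha> \<in> dforms A k. ext_d A \<alpha> = 0}"

definition d_exact_forms ::
    "('a::{t2_space, second_countable_topology}, 'n::finite) chart set \<Rightarrow> nat \<Rightarrow> ('a, 'n) dform set" where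
  "d_exact_forms A k = (if k = 0 then {0} else ext_d A ` dforms A (k - 1))"

definition deRham_cohomology ::
    "('a::{t2_space, second_countable_topology}, 'n::finite) chart set \<Rightarrow> nat \<Rightarrow> ('a, 'n) dform set monoid" where
  "deRham_cohomology A k = quotient_group (deRham_cocycles A k) (d_exact_forms A k)"

definition BC_cocycles ::
    "('a::{t2_space, second_countable_topology}, 'n::finite) chart set \<Rightarrow> nat \<Rightarrow> nat \<Rightarrow> ('a, 'n) dform set" where
  "BC_cocycles A p q = {\<alpha> \<in> pq_forms A p q. del A \<alpha> = 0 \<and> delbar A \<alpha> = 0}"

definition del_delbar_image ::
    "('a::{t2_space, second_countable_topology}, 'n::finite) chart set \<Rightarrow> nat \<Rightarrow> nat \<Rightarrow> ('a, 'n) dform set" where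
  "del_delbar_image A p q =
     (if p = 0 \<or> q = 0 then {0} else (\<lambda>\<alpha>. del A (delbar A \<alpha>)) ` pq_forms A (p - 1) (q - 1))"

definition BC_cohomology ::
    "('a::{t2_space, second_countable_topology}, 'n::finite) chart set \<Rightarrow> nat \<Rightarrow> nat \<Rightarrow> ('a, 'n) dform set monoid" where
  "BC_cohomology A p q = quotient_group (BC_cocycles A p q) (del_delbar_image A p q)"

section \<open>Degenerate balanced metrics\<close>

text \<open>Positivity of a real \<open>(1,1)\<close>-form is \<open>\<omega>(v, i v) > 0\<close>; e.g. \<open>i dz \<and> dzbar\<close> is positive,
  its value on \<open>v, i v\<close> being \<open>2 |v|\<^sup>2\<close>.\<close>

definition hermitian_metric ::
    "('a::{t2_space, second_countable_topology}, 'n::finite) chart set \<Rightarrow> ('a, 'n) dform \<Rightarrow> bool" where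
  "hermitian_metric A \<omega> \<longleftrightarrow> \<omega> \<in> pq_forms A 1 1 \<and>
     (\<forall>c\<in>A. \<forall>x\<in>chart_image c.
        (\<forall>vs. \<omega> c x vs \<in> \<real>) \<and> (\<forall>v. v \<noteq> 0 \<longrightarrow> Re (\<omega> c x [v, \<i> *s v]) > 0))"

definition degenerate_balanced_metric ::
    "('a::{t2_space, second_countable_topology}, 'n::finite) chart set \<Rightarrow> ('a, 'n) dform \<Rightarrow> bool" where
  "degenerate_balanced_metric A \<omega> \<longleftrightarrow> hermitian_metric A \<omega> \<and>
     wedge_power \<omega> (CARD('n) - 1) \<in> d_exact_forms A (2 * (CARD('n) - 1))"

definition degenerate_balanced ::
    "('a::{t2_space, second_countable_topology}, 'n::finite) chart set \<Rightarrow> bool" where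
  "degenerate_balanced A \<longleftrightarrow> (\<exists>\<omega>. degenerate_balanced_metric A \<omega>)"

end

theory Submission
  imports Defs "HOL-Complex_Analysis.Complex_Analysis"
begin

text \<open>Let \<open>\<theta>\<close> be a closed form of type (1,0) or (0,1) and \<open>\<omega>^(n - 1) = d \<Gamma>\<close>. As \<open>\<theta>\<close> and its
  conjugate are closed, \<open>\<theta> \<and> cnj \<theta> \<and> \<omega>^(n - 1)\<close> is the differential of \<open>\<theta> \<and> cnj \<theta> \<and> \<Gamma>\<close>,
  so that its integral vanishes. Up to a constant factor it is also a nonnegative multiple of the
  volume form that is positive wherever \<open>\<theta> \<noteq> 0\<close>, hence \<open>\<theta> = 0\<close>.

  Integrals of top forms are sums of Lebesgue integrals in charts, weighted by a partition of
  unity \<open>\<rho>\<^sub>i\<close>. For Stokes' theorem the integrals of \<open>d(\<rho>\<^sub>i G)\<close> in the \<open>i\<close>-th charts vanish by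
  translation invariance, and the forms \<open>\<rho>\<^sub>j d\<rho>\<^sub>i \<and> G\<close> may be moved from the \<open>i\<close>-th to the \<open>j\<close>-th
  chart, where they cancel because \<open>\<Sum>\<^sub>i d\<rho>\<^sub>i = 0\<close>. In (ii) both parts of a closed 1-form become
  closed after subtracting \<open>\<partial> f\<close> and \<open>dbar f\<close> for a suitable \<open>f\<close>, so that (i) applies to them.\<close>

section \<open>Alternating forms\<close>

text \<open>Positivity has a pointwise reason: on a real frame b, i b, u_1, i u_1, ... with all u_k
  in the kernel of \<theta>, the product reduces to |\<theta>(b)|^2 times the value of \<omega>^(n -
  1) on the remaining vectors, and this value is positive if the u_k are \<omega>-orthogonal. Such
  frames vary with the point. Complex-linear maps carry the sign to one fixed frame because their
  real determinant is nonnegative; the same fact orients the charts, so that integrals over overlaps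
  agree.

  Little regularity is spent. Stokes' theorem differentiates the weights once, so they need only be
  C1. The transition maps are merely known to be complex differentiable; that their Jacobians are
  continuous, and even holomorphic, comes from Cauchy's formula.

  In degrees 1 and 2 the type of a form is read off from multiplication of its arguments by i. The
  two types of 1-forms, and likewise \<partial> and dbar, thus become the cases t = i and t = -i of
  one statement.\<close>

definition remove_nth :: "nat \<Rightarrow> 'v list \<Rightarrow> 'v list" where
  "remove_nth i vs = take i vs @ drop (Suc i) vs"

lemma remove_nth_Cons_0 [simp]: "remove_nth 0 (v # vs) = vs"
  and remove_nth_Cons_Suc [simp]: "remove_nth (Suc i) (v # vs) = v # remove_nth i vs"
  by (simp_all add: remove_nth_def)

lemma length_remove_nth [simp]: "i < length vs \<Longrightarrow> length (remove_nth i vs) = length vs - 1"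
  by (simp add: remove_nth_def)

lemma map_remove_nth: "map f (remove_nth i vs) = remove_nth i (map f vs)"
  by (simp add: remove_nth_def take_map drop_map)

text \<open>Exterior derivatives in a chart and products with a covector are both sums of this
  shape, so that their algebra is done once. \<open>F\<close> receives the removed vector and the
  remaining list.\<close>

definition asum :: "('v \<Rightarrow> 'v list \<Rightarrow> complex) \<Rightarrow> 'v list \<Rightarrow> complex" where
  "asum F vs = (\<Sum>i<length vs. (- 1) ^ i * F (vs ! i) (remove_nth i vs))"

lemma asum_Nil [simp]: "asum F [] = 0"
  by (simp add: asum_def)

lemma asum_Cons: "asum F (v # vs) = F v vs - asum (\<lambda>w l. F w (v # l)) vs"
  by (simp add: asum_def sum.lessThan_Suc_shift sum_negf del: sum.lessThan_Suc)

lemma asum_cong: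
  assumes "\<And>v l. v \<in> set vs \<Longrightarrow> set l \<subseteq> set vs \<Longrightarrow> Suc (length l) = length vs \<Longrightarrow> F v l = G v l"
  shows "asum F vs = asum G vs"
proof -
  have "set (remove_nth i vs) \<subseteq> set vs" for i
    unfolding remove_nth_def using set_take_subset set_drop_subset by (metis Un_subset_iff set_append)
  then show ?thesis
    unfolding asum_def by (intro sum.cong refl arg_cong2[where f = "(*)"] assms) auto
qed

lemma asum_add: "asum (\<lambda>v l. F v l + G v l) vs = asum F vs + asum G vs"
  and asum_diff: "asum (\<lambda>v l. F v l - G v l) vs = asum F vs - asum G vs"
  and asum_mult: "asum (\<lambda>v l. c * F v l) vs = c * asum F vs"
  and asum_neg: "asum (\<lambda>v l. - F v l) vs = - asum F vs"
  and asum_0 [simp]: "asum (\<lambda>v l. 0) vs = 0"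
  by (simp_all add: asum_def sum.distrib sum_subtractf sum_distrib_left sum_negf algebra_simps)

lemma asum_map: "asum F (map f vs) = asum (\<lambda>v l. F (f v) (map f l)) vs"
  by (simp add: asum_def map_remove_nth)

lemma asum_append:
  "asum F (xs @ ys) = asum (\<lambda>w l. F w (l @ ys)) xs + (- 1) ^ length xs * asum (\<lambda>w l. F w (xs @ l)) ys"
proof (induction xs arbitrary: F)
  case (Cons x xs)
  show ?case
    by (simp add: asum_Cons Cons.IH[of "\<lambda>w l. F w (x # l)"])
qed simp

definition asum2 :: "('v \<Rightarrow> 'v \<Rightarrow> 'v list \<Rightarrow> complex) \<Rightarrow> 'v list \<Rightarrow> complex" where
  "asum2 F = asum (\<lambda>v. asum (F v))"

text \<open>Removing two entries in either order leaves the same list, but with opposite signs: the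
  index of the later entry drops by one once the earlier entry is gone.\<close>

lemma asum2_swap: "asum2 F vs = - asum2 (\<lambda>v w. F w v) vs"
proof (induction vs arbitrary: F)
  case (Cons v vs)
  have *: "asum2 F (v # vs) = asum (F v) vs - asum (\<lambda>w. F w v) vs
      + asum2 (\<lambda>w u m. F w u (v # m)) vs" for F
    by (simp add: asum2_def asum_Cons asum_diff)
  show ?case
    unfolding * by (subst Cons.IH) simp
qed (simp add: asum2_def)

text \<open>For a closed covector field \<theta> the derivative of \<theta> is symmetric in its two
  vectors; this removes the term with d\<theta> from the product rule.\<close>

lemma asum2_sym_eq_0:
  assumes "\<And>v w l. v \<in> set vs \<Longrightarrow> w \<in> set vs \<Longrightarrow> F v w l = F w v l"
  shows "asum2 F vs = 0"
proof -
  have "asum2 F vs = asum2 (\<lambda>v w. F w v) vs"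
    unfolding asum2_def by (intro asum_cong assms) auto
  with asum2_swap[of F vs] show ?thesis by simp
qed

section \<open>Alternating forms on lists of vectors\<close>

lemma alternatingD:
  assumes "alternating k \<alpha>"
  shows alternating_length: "length vs \<noteq> k \<Longrightarrow> \<alpha> vs = 0"
    and alternating_linear: "length xs + Suc (length ys) = k \<Longrightarrow> linear (\<lambda>w. \<alpha> (xs @ w # ys))"
    and alternating_eq: "i < j \<Longrightarrow> j < length vs \<Longrightarrow> vs ! i = vs ! j \<Longrightarrow> \<alpha> vs = 0"
proof -
  show *: "length vs \<noteq> k \<Longrightarrow> \<alpha> vs = 0" for vs
    using assms by (auto simp: alternating_def)
  show "linear (\<lambda>w. \<alpha> (xs @ w # ys))" if "length xs + Suc (length ys) = k"
  proof -
    have "linear (\<lambda>w. \<alpha> ((xs @ 0 # ys)[length xs := w]))"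
      using assms that unfolding alternating_def
      by (metis length_append length_Cons less_add_Suc1 add_Suc_right)
    then show ?thesis by simp
  qed
  show "i < j \<Longrightarrow> j < length vs \<Longrightarrow> vs ! i = vs ! j \<Longrightarrow> \<alpha> vs = 0"
    using assms * unfolding alternating_def by metis
qed

lemma alternating_linear_update:
  "alternating k \<alpha> \<Longrightarrow> i < length vs \<Longrightarrow> linear (\<lambda>w. \<alpha> (vs[i := w]))"
  by (cases "length vs = k") (auto simp: alternating_def module_hom_zero)

text \<open>Polarisation: the form vanishes on the list with \<open>a + b\<close> in both
  places.\<close>

lemma alternating_swap:
  assumes "alternating k \<alpha>"
  shows "\<alpha> (xs @ a # ms @ b # ys) = - \<alpha> (xs @ b # ms @ a # ys)"
proof (cases "length xs + length ms + length ys + 2 = k")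
  case True
  have eq0: "\<alpha> (xs @ c # ms @ c # ys) = 0" for c
    by (rule alternating_eq[OF assms, of "length xs" "length xs + Suc (length ms)"])
      (simp_all add: nth_append)
  have l1: "linear (\<lambda>w. \<alpha> (xs @ w # ms @ c # ys))" for c
    using alternating_linear[OF assms, of xs "ms @ c # ys"] True by simp
  have l2: "linear (\<lambda>w. \<alpha> (xs @ c # ms @ w # ys))" for c
    using alternating_linear[OF assms, of "xs @ c # ms" ys] True by simp
  have "0 = \<alpha> (xs @ (a + b) # ms @ (a + b) # ys)" by (simp add: eq0)
  also have "\<dots> = \<alpha> (xs @ a # ms @ b # ys) + \<alpha> (xs @ b # ms @ a # ys)"
    unfolding linear_add[OF l1] linear_add[OF l2] by (simp add: eq0)
  finally show ?thesis by (metis eq_neg_iff_add_eq_0)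
qed (simp add: alternating_length[OF assms])

lemma alternating_rotate:
  assumes "alternating k \<alpha>"
  shows "\<alpha> (xs @ v # ms @ ys) = (- 1) ^ length ms * \<alpha> (xs @ ms @ v # ys)"
proof (induction ms arbitrary: xs)
  case (Cons m ms)
  have "\<alpha> (xs @ v # (m # ms) @ ys) = - \<alpha> (xs @ m # v # ms @ ys)"
    using alternating_swap[OF assms, of xs v "[]" m "ms @ ys"] by simp
  also have "\<alpha> (xs @ m # v # ms @ ys) = (- 1) ^ length ms * \<alpha> ((xs @ [m]) @ ms @ v # ys)"
    using Cons.IH[of "xs @ [m]"] by simp
  finally show ?case by simp
qed simp

lemma alternatingI:
  assumes "\<And>vs. length vs \<noteq> k \<Longrightarrow> \<alpha> vs = 0"
    and "\<And>xs ys. length xs + Suc (length ys) = k \<Longrightarrow> linear (\<lambda>w. \<alpha> (xs @ w # ys))"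
    and "\<And>xs v ms ys. length xs + length ms + length ys + 2 = k \<Longrightarrow> \<alpha> (xs @ v # ms @ v # ys) = 0"
  shows "alternating k \<alpha>"
  unfolding alternating_def
proof (intro conjI allI impI; (elim conjE)?)
  fix vs :: "'a list" and i assume "length vs = k" "i < k"
  then show "linear (\<lambda>w. \<alpha> (vs[i := w]))"
    using assms(2)[of "take i vs" "drop (Suc i) vs"] by (simp add: upd_conv_take_nth_drop)
next
  fix vs :: "'a list" and i j assume *: "length vs = k" "i < j" "j < k" "vs ! i = vs ! j"
  have "vs = take i vs @ vs ! i # drop (Suc i) vs"
    using * by (intro id_take_nth_drop) simp
  moreover have "drop (Suc i) vs = take (j - Suc i) (drop (Suc i) vs) @ drop (Suc i) vs ! (j - Suc i)
      # drop (Suc (j - Suc i)) (drop (Suc i) vs)"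
    using * by (intro id_take_nth_drop) simp
  ultimately have "vs = take i vs @ vs ! i # take (j - Suc i) (drop (Suc i) vs) @ vs ! i # drop (Suc j) vs"
    using * by simp
  then show "\<alpha> vs = 0"
    using assms(3)[of "take i vs" "take (j - Suc i) (drop (Suc i) vs)" "drop (Suc j) vs" "vs ! i"] *
    by simp
qed (use assms(1) in auto)

lemma linear_mult:
  fixes f :: "'v::real_vector \<Rightarrow> complex"
  assumes "linear f"
  shows linear_const_mult: "linear (\<lambda>x. c * f x)"
    and linear_mult_const: "linear (\<lambda>x. f x * c)"
  using linear_compose[OF assms bounded_linear.linear[OF bounded_linear_mult_right[of c]]]
    linear_compose[OF assms bounded_linear.linear[OF bounded_linear_mult_left[of c]]]
  by (simp_all add: o_def)

lemma linear_asum: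
  assumes "\<And>v l. Suc (length l) = length vs \<Longrightarrow> linear (\<lambda>w. F w v l)"
  shows "linear (\<lambda>w. asum (F w) vs)"
  unfolding asum_def
  by (intro linear_compose_sum ballI linear_const_mult assms) auto

text \<open>At a repeated vector \<open>v\<close>, the terms that remove another entry still see the
  repetition and vanish. The two terms that remove a copy of \<open>v\<close> differ by moving
  \<open>v\<close> across \<open>ms\<close>; once this sign is taken into account, they are
  opposite.\<close>

lemma alternating_asum:
  assumes lin: "\<And>l. linear (\<lambda>v. F v l)" and alt: "\<And>v. alternating k (F v)"
  shows "alternating (Suc k) (asum F)"
proof (rule alternatingI)
  fix vs :: "'a list" assume "length vs \<noteq> Suc k"
  then show "asum F vs = 0"
    unfolding asum_def by (intro sum.neutral) (auto intro!: alternating_length[OF alt])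
next
  fix xs ys :: "'a list" assume *: "length xs + Suc (length ys) = Suc k"
  have "linear (\<lambda>w. asum (\<lambda>v l. F v (l @ w # ys)) xs)"
    using * by (intro linear_asum alternating_linear[OF alt]) simp
  moreover have "linear (\<lambda>w. asum (\<lambda>v l. F v (xs @ w # l)) ys)"
    using * by (intro linear_asum alternating_linear[OF alt]) simp
  ultimately show "linear (\<lambda>w. asum F (xs @ w # ys))"
    unfolding asum_append asum_Cons
    by (intro linear_compose_add linear_compose_sub lin linear_const_mult)
next
  fix xs ms ys :: "'a list" and v assume *: "length xs + length ms + length ys + 2 = Suc k"
  have eq0: "F w (as @ v # bs @ v # cs) = 0" for w as bs cs
    by (rule alternating_eq[OF alt, of "length as" "length as + Suc (length bs)"])
      (simp_all add: nth_append)
  have "F v (xs @ v # ms @ ys) = (- 1) ^ length ms * F v (xs @ ms @ v # ys)"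
    by (rule alternating_rotate[OF alt])
  then show "asum F (xs @ v # ms @ v # ys) = 0"
    using eq0[of _ _ ms ys] eq0[of _ xs ms] eq0[of _ xs _ ys]
    by (simp add: asum_append asum_Cons algebra_simps flip: power_add)
qed

text \<open>The covector is kept as a function of one vector rather than as a 1-form;
  \<open>alt_wedge_alt_covector\<close> identifies the result with the shuffle product.\<close>

definition covector_wedge :: "('v \<Rightarrow> complex) \<Rightarrow> 'v altform \<Rightarrow> 'v altform" where
  "covector_wedge \<theta> \<gamma> = asum (\<lambda>v l. \<theta> v * \<gamma> l)"

lemma alternating_covector_wedge:
  assumes "linear \<theta>" "alternating k \<gamma>"
  shows "alternating (Suc k) (covector_wedge \<theta> \<gamma>)"
  unfolding covector_wedge_def
proof (rule alternating_asum)
  show "linear (\<lambda>v. \<theta> v * \<gamma> l)" for l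
    by (rule linear_mult_const[OF assms(1)])
  show "alternating k (\<lambda>l. \<theta> v * \<gamma> l)" for v
    using assms(2) unfolding alternating_def
    by (auto intro!: linear_const_mult)
qed

lemma covector_wedge_map:
  "covector_wedge \<theta> \<gamma> (map f vs) = covector_wedge (\<theta> \<circ> f) (\<gamma> \<circ> map f) vs"
  by (simp add: covector_wedge_def asum_map)

section \<open>Alternating functions of indexed families and determinants\<close>

definition alternating_family :: "(('i \<Rightarrow> 'v::real_vector) \<Rightarrow> complex) \<Rightarrow> bool" where
  "alternating_family h \<longleftrightarrow> (\<forall>f i. linear (\<lambda>w. h (f(i := w)))) \<and>
     (\<forall>f i j. i \<noteq> j \<longrightarrow> f i = f j \<longrightarrow> h f = 0)"

lemma alternating_family_linear: "alternating_family h \<Longrightarrow> linear (\<lambda>w. h (f(i := w)))"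
  and alternating_family_eq: "alternating_family h \<Longrightarrow> i \<noteq> j \<Longrightarrow> f i = f j \<Longrightarrow> h f = 0"
  by (auto simp: alternating_family_def)

lemma alternating_family_compose:
  assumes "alternating_family h" "linear g"
  shows "alternating_family (\<lambda>f. h (g \<circ> f))"
  unfolding alternating_family_def
proof (intro conjI allI impI)
  fix f :: "'a \<Rightarrow> 'c" and i
  have "linear (\<lambda>w. h ((g \<circ> f)(i := g w)))"
    using linear_compose[OF assms(2) alternating_family_linear[OF assms(1)]] by (simp add: o_def)
  then show "linear (\<lambda>w. h (g \<circ> f(i := w)))" by (simp add: fun_upd_comp)
qed (auto intro: alternating_family_eq[OF assms(1)])

text \<open>The vectors \<open>w\<close> that give the value 0 when put in place of the
  \<open>i\<close>-th entry form a subspace, and it contains every other \<open>f j\<close>.\<close>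

lemma alternating_family_span:
  assumes alt: "alternating_family h" and "f i \<in> span (f ` (- {i}))"
  shows "h f = 0"
proof -
  have "h (f(i := w)) = 0" if "w \<in> span (f ` (- {i}))" for w
    using that
  proof (induction rule: span_induct)
    case base
    show ?case
      using linear_0[OF alternating_family_linear[OF alt]] linear_add[OF alternating_family_linear[OF alt]]
        linear_scale[OF alternating_family_linear[OF alt]]
      by (intro subspaceI) (auto simp del: fun_upd_apply simp: mem_Collect_eq)
  next
    case (step x)
    then obtain j where "j \<noteq> i" "x = f j" by auto
    then show ?case
      by (intro alternating_family_eq[OF alt, of i j]) auto
  qed
  from this[OF assms(2)] show ?thesis by simp
qed

lemma alternating_family_scale:
  fixes f :: "'i::finite \<Rightarrow> 'v::real_vector"
  assumes alt: "alternating_family h"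
  shows "h (\<lambda>i. c i *\<^sub>R f i) = of_real (\<Prod>i\<in>UNIV. c i) * h f"
proof -
  have "h (\<lambda>i. if i \<in> I then c i *\<^sub>R f i else f i) = of_real (\<Prod>i\<in>I. c i) * h f" if "finite I" for I
    using that
  proof (induction I)
    case (insert j I)
    let ?g = "\<lambda>i. if i \<in> I then c i *\<^sub>R f i else f i"
    have "(\<lambda>i. if i \<in> insert j I then c i *\<^sub>R f i else f i) = ?g(j := c j *\<^sub>R f j)"
      by auto
    moreover have "h (?g(j := c j *\<^sub>R f j)) = c j *\<^sub>R h (?g(j := f j))"
      by (rule linear_scale[OF alternating_family_linear[OF alt]])
    moreover have "?g(j := f j) = ?g" using insert.hyps by auto
    ultimately show ?case
      using insert by (simp add: scaleR_conv_of_real)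
  qed simp
  from this[of UNIV] show ?thesis by simp
qed

lemma alternating_family_transpose:
  assumes alt: "alternating_family h" and "m \<noteq> n"
  shows "h (f \<circ> Transposition.transpose m n) = - h f"
proof -
  note lin = alternating_family_linear[OF alt]
  let ?g = "\<lambda>a b. f(m := a, n := b)"
  have l1: "linear (\<lambda>a. h (?g a b))" for b
    using lin[of "f(n := b)" m] by (simp add: fun_upd_twist[OF \<open>m \<noteq> n\<close>])
  have l2: "linear (\<lambda>b. h (?g a b))" for a
    by (rule lin)
  have eq0: "h (?g a a) = 0" for a
    using \<open>m \<noteq> n\<close> by (intro alternating_family_eq[OF alt, of m n]) auto
  have "0 = h (?g (f m + f n) (f m + f n))" by (simp only: eq0)
  also have "\<dots> = h (?g (f m) (f n)) + h (?g (f n) (f m))"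
    unfolding linear_add[OF l1] linear_add[OF l2]
    by (simp only: eq0 add_0_left add_0_right add.commute)
  also have "?g (f n) (f m) = f \<circ> Transposition.transpose m n"
    by (auto simp: Transposition.transpose_def fun_eq_iff)
  finally have "h (f \<circ> Transposition.transpose m n) + h f = 0"
    by (simp only: fun_upd_triv add.commute)
  then show ?thesis by (simp only: eq_neg_iff_add_eq_0)
qed

text \<open>The factor is multiplicative in \<open>f\<close>, so it suffices to treat the elementary
  maps of which a linear map is composed: maps annihilating a coordinate, diagonal maps,
  transpositions and shears.\<close>

lemma alternating_family_linear_image:
  fixes f :: "real^'n \<Rightarrow> real^'n"
  assumes "linear f" "alternating_family h"
  shows "h (\<lambda>i. f (axis i 1)) = of_real (det (matrix f)) * h (\<lambda>i. axis i 1)"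
proof -
  \<comment> \<open>\<open>h\<close> is quantified inside \<open>P\<close> because the step for
    \<open>f \<circ> g\<close> applies the hypothesis on \<open>g\<close> to \<open>h\<close>
    composed with \<open>f\<close>.\<close>
  define P where "P = (\<lambda>f::real^'n \<Rightarrow> real^'n. \<forall>h. alternating_family h \<longrightarrow>
    h (\<lambda>i. f (axis i 1)) = of_real (det (matrix f)) * h (\<lambda>i. axis i 1))"
  have "P f"
  proof (rule induct_linear_elementary[OF assms(1), of P])
    fix f g :: "real^'n \<Rightarrow> real^'n" assume 2: "linear f" "linear g" "P f" "P g"
    show "P (f \<circ> g)"
      unfolding P_def
    proof (intro allI impI)
      fix h :: "('n \<Rightarrow> real^'n) \<Rightarrow> complex" assume h: "alternating_family h"
      have "h (\<lambda>i. (f \<circ> g) (axis i 1)) = h (f \<circ> (\<lambda>i. g (axis i 1)))" by (simp add: o_def)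
      also have "\<dots> = of_real (det (matrix g)) * h (f \<circ> (\<lambda>i. axis i 1))"
        by (rule 2(4)[unfolded P_def, rule_format, OF alternating_family_compose[OF h 2(1)]])
      also have "h (f \<circ> (\<lambda>i. axis i 1)) = of_real (det (matrix f)) * h (\<lambda>i. axis i 1)"
        using 2 h by (simp add: o_def P_def)
      finally show "h (\<lambda>i. (f \<circ> g) (axis i 1)) = of_real (det (matrix (f \<circ> g))) * h (\<lambda>i. axis i 1)"
        using 2 by (simp add: matrix_compose det_mul)
    qed
  next
    fix f :: "real^'n \<Rightarrow> real^'n" and i assume 3: "linear f" "\<And>x. f x $ i = 0"
    \<comment> \<open>The map is singular, so both sides are 0: a kernel vector \<open>x\<close>
      with \<open>x $ k \<noteq> 0\<close> expresses \<open>f (axis k 1)\<close> by the images of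
      the other axes.\<close>
    have "\<not> surj f"
      using 3(2) by (metis axis_nth surjD zero_neq_one)
    then have "\<not> inj f" using linear_injective_imp_surjective[OF 3(1)] by blast
    then obtain x where x: "x \<noteq> 0" "f x = 0"
      using linear_injective_0[OF 3(1)] by auto
    then obtain k where k: "x $ k \<noteq> 0" by (auto simp: vec_eq_iff)
    have "f x = (\<Sum>i\<in>UNIV. x $ i *\<^sub>R f (axis i 1))"
      by (subst basis_expansion[of x, symmetric])
        (simp add: linear_sum[OF 3(1)] linear_scale[OF 3(1)] scalar_mult_eq_scaleR)
    also have "\<dots> = x $ k *\<^sub>R f (axis k 1) + (\<Sum>i\<in>-{k}. x $ i *\<^sub>R f (axis i 1))"
      by (subst sum.remove[of _ k]) (auto simp: Compl_eq_Diff_UNIV)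
    finally have "x $ k *\<^sub>R f (axis k 1) = - (\<Sum>i\<in>-{k}. x $ i *\<^sub>R f (axis i 1))"
      using x by (simp add: eq_neg_iff_add_eq_0)
    then have "f (axis k 1) = - (1 / x $ k) *\<^sub>R (\<Sum>i\<in>-{k}. x $ i *\<^sub>R f (axis i 1))"
      using k by (metis (no_types, lifting) divideR_right inverse_eq_divide scaleR_minus_left scaleR_minus_right)
    also have "\<dots> \<in> span ((\<lambda>i. f (axis i 1)) ` (- {k}))"
      by (intro span_scale span_sum) (auto intro!: span_base)
    finally have "h (\<lambda>i. f (axis i 1)) = 0" if "alternating_family h" for h :: "('n \<Rightarrow> real^'n) \<Rightarrow> complex"
      by (intro alternating_family_span[OF that]) 
    moreover have "det (matrix f) = 0"
      using 3(1) \<open>\<not> inj f\<close> by (simp add: det_nz_iff_inj[symmetric])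
    ultimately show "P f" by (simp add: P_def)
  next
    fix c
    have "matrix (\<lambda>x::real^'n. \<chi> i. c i * x $ i) = (\<chi> i j. if i = j then c i else 0)"
      by (simp add: matrix_def axis_def vec_eq_iff)
    then have "det (matrix (\<lambda>x::real^'n. \<chi> i. c i * x $ i)) = (\<Prod>i\<in>UNIV. c i)"
      by (simp add: det_diagonal)
    moreover have "(\<chi> j. c j * axis i 1 $ j) = c i *\<^sub>R axis i 1" for i
      by (simp add: vec_eq_iff axis_def)
    ultimately show "P (\<lambda>x. \<chi> i. c i * x $ i)"
      unfolding P_def by (auto simp only: intro!: alternating_family_scale)
  next
    fix m n :: 'n assume 5: "m \<noteq> n"
    have "matrix (\<lambda>x::real^'n. \<chi> i. x $ Transposition.transpose m n i)
        = (\<chi> i. mat 1 $ Transposition.transpose m n i)"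
      by (simp add: matrix_def axis_def mat_def vec_eq_iff)
    then have "det (matrix (\<lambda>x::real^'n. \<chi> i. x $ Transposition.transpose m n i)) = -1"
      using 5 by (simp add: det_permute_rows permutes_swap_id sign_swap_id)
    moreover have "(\<lambda>i. \<chi> j. axis i (1::real) $ Transposition.transpose m n j)
        = (\<lambda>i. axis i 1) \<circ> Transposition.transpose m n"
      by (auto simp: vec_eq_iff axis_def fun_eq_iff Transposition.transpose_def)
    ultimately show "P (\<lambda>x. \<chi> i. x $ Transposition.transpose m n i)"
      using 5 by (simp add: alternating_family_transpose P_def)
  next
    fix m n :: 'n assume 6: "m \<noteq> n"
    have "matrix (\<lambda>x::real^'n. \<chi> i. if i = m then x $ m + x $ n else x $ i)
        = (\<chi> k. if k = m then row m (mat 1) + 1 *s row n (mat 1) else row k (mat 1))"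
      by (simp add: matrix_def axis_def mat_def row_def vec_eq_iff)
    then have det1: "det (matrix (\<lambda>x::real^'n. \<chi> i. if i = m then x $ m + x $ n else x $ i)) = 1"
      using det_row_operation[OF 6, of "mat 1" "1::real"] by simp
    let ?e = "\<lambda>i. axis i 1 :: real^'n"
    have eq: "(\<lambda>i. \<chi> j. if j = m then axis i (1::real) $ m + axis i 1 $ n else axis i 1 $ j)
        = ?e(n := ?e n + ?e m)"
      using 6 by (auto simp: vec_eq_iff axis_def fun_eq_iff)
    have "h (?e(n := ?e n + ?e m)) = h ?e" if h: "alternating_family h" for h
    proof -
      have "h (?e(n := ?e n + ?e m)) = h (?e(n := ?e n)) + h (?e(n := ?e m))"
        by (rule linear_add[OF alternating_family_linear[OF h]])
      moreover have "h (?e(n := ?e m)) = 0"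
        using 6 by (intro alternating_family_eq[OF h, of m n]) auto
      moreover have "?e(n := ?e n) = ?e" by (rule fun_upd_triv)
      ultimately show ?thesis by (simp only: add_0_right)
    qed
    then show "P (\<lambda>x. \<chi> i. if i = m then x $ m + x $ n else x $ i)"
      unfolding P_def eq det1 by simp
  qed
  with assms(2) show ?thesis by (simp add: P_def)
qed

lemma map_fun_upd_nth:
  assumes "distinct xs" "i < length xs"
  shows "map (f(xs ! i := w)) xs = (map f xs)[i := w]"
  using assms by (intro nth_equalityI) (auto simp: nth_list_update nth_eq_iff_index_eq)

lemma alternating_family_map:
  fixes xs :: "'i list" and \<alpha> :: "'v::real_vector altform"
  assumes "alternating k \<alpha>" "distinct xs" "set xs = UNIV"
  shows "alternating_family (\<lambda>f. \<alpha> (map f xs))"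
  unfolding alternating_family_def
proof (intro conjI allI impI)
  fix f :: "'i \<Rightarrow> 'v" and i :: 'i
  obtain m where m: "m < length xs" "i = xs ! m"
    using assms(3) by (metis UNIV_I in_set_conv_nth)
  show "linear (\<lambda>w. \<alpha> (map (f(i := w)) xs))"
    using m alternating_linear_update[OF assms(1), of m "map f xs"]
    by (simp add: map_fun_upd_nth[OF assms(2)])
next
  fix f :: "'i \<Rightarrow> 'v" and i j :: 'i
  assume *: "i \<noteq> j" "f i = f j"
  obtain m n where m: "m < length xs" "i = xs ! m" and n: "n < length xs" "j = xs ! n"
    using assms(3) by (metis UNIV_I in_set_conv_nth)
  then have "m < n \<or> n < m" using * by (metis nat_neq_iff)
  then show "\<alpha> (map f xs) = 0"
    using alternating_eq[OF assms(1), of m n "map f xs"] alternating_eq[OF assms(1), of n m "map f xs"] m n *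
    by auto
qed

lemma alternating_map_linear:
  assumes "alternating k \<alpha>" "linear f"
  shows "alternating k (\<lambda>vs. \<alpha> (map f vs))"
proof (rule alternatingI)
  fix xs ys :: "'b list" assume "length xs + Suc (length ys) = k"
  then show "linear (\<lambda>w. \<alpha> (map f (xs @ w # ys)))"
    using linear_compose[OF assms(2) alternating_linear[OF assms(1), of "map f xs" "map f ys"]]
    by (simp add: o_def)
next
  fix xs ms ys :: "'b list" and v
  show "\<alpha> (map f (xs @ v # ms @ v # ys)) = 0"
    by (rule alternating_eq[OF assms(1), of "length xs" "length xs + Suc (length ms)"])
      (simp_all add: nth_append)
qed (simp add: alternating_length[OF assms(1)])

text \<open>The coordinate system \<open>g\<close> (with inverse \<open>g'\<close>) is needed because the determinant is only
  available for maps of \<open>real^'n\<close>.\<close>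

lemma alternating_top_det:
  fixes g :: "real^'n \<Rightarrow> 'v::real_vector"
  assumes alt: "alternating CARD('n) \<alpha>" and L: "linear L"
    and g: "linear g" and g': "linear g'" and gg': "\<And>v. g (g' v) = v" and g'g: "\<And>x. g' (g x) = x"
    and len: "length vs = CARD('n)"
  shows "\<alpha> (map L vs) = of_real (det (matrix (g' \<circ> L \<circ> g))) * \<alpha> vs"
proof -
  obtain xs :: "'n list" where xs: "distinct xs" "set xs = UNIV"
    using finite_distinct_list[OF finite] by blast
  then have lxs: "length xs = CARD('n)" by (metis distinct_card)
  define e where "e = (\<lambda>i. axis i 1 :: real^'n)"
  have basis: "\<alpha> (map M (map (g \<circ> e) xs)) = of_real (det (matrix (g' \<circ> M \<circ> g))) * \<alpha> (map (g \<circ> e) xs)"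
    if M: "linear M" for M
  proof -
    have alt': "alternating_family (\<lambda>f. \<alpha> (map (g \<circ> f) xs))"
      using alternating_family_map[OF alternating_map_linear[OF alt g] xs] by (simp add: o_def)
    have "linear (g' \<circ> M \<circ> g)" using g g' M by (intro linear_compose)
    from alternating_family_linear_image[OF this alt']
    show ?thesis by (simp add: o_def gg' e_def)
  qed
  \<comment> \<open>\<open>M\<close> sends the coordinate basis, in the order of \<open>xs\<close>,
    to \<open>vs\<close>; the \<open>LEAST\<close> expression inverts the enumeration
    \<open>xs\<close>. Applying \<open>basis\<close> to \<open>M\<close> and to
    \<open>L \<circ> M\<close> reduces the claim to multiplicativity of the determinant.\<close>
  define M where "M = (\<lambda>v. \<Sum>i\<in>UNIV. (g' v $ i) *\<^sub>R (vs ! (LEAST m. m < length xs \<and> xs ! m = i)))"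
  have M: "linear M"
    unfolding M_def
    by (intro linear_compose_sum ballI)
      (simp add: linear_iff linear_add[OF g'] linear_scale[OF g'] scaleR_add_left)
  have "map M (map (g \<circ> e) xs) = vs"
  proof (rule nth_equalityI)
    fix m assume "m < length (map M (map (g \<circ> e) xs))"
    then have m: "m < length xs" by simp
    have "(LEAST m'. m' < length xs \<and> xs ! m' = xs ! m) = m"
      using m xs by (intro Least_equality) (auto simp: nth_eq_iff_index_eq)
    then have "M (g (e (xs ! m))) = vs ! m"
      unfolding M_def g'g e_def axis_def
      by (simp add: if_distrib[of "\<lambda>x. x *\<^sub>R _"] cong: if_cong)
    then show "map M (map (g \<circ> e) xs) ! m = vs ! m" using m by simp
  qed (simp add: len lxs)
  then have vs: "vs = map M (map (g \<circ> e) xs)" ..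
  have "matrix (g' \<circ> (L \<circ> M) \<circ> g) = matrix ((g' \<circ> L \<circ> g) \<circ> (g' \<circ> M \<circ> g))"
    by (simp add: o_def gg')
  also have "\<dots> = matrix (g' \<circ> L \<circ> g) ** matrix (g' \<circ> M \<circ> g)"
    using g g' M L by (intro matrix_compose linear_compose)
  finally have det: "det (matrix (g' \<circ> (L \<circ> M) \<circ> g))
      = det (matrix (g' \<circ> L \<circ> g)) * det (matrix (g' \<circ> M \<circ> g))"
    by (simp add: det_mul)
  have "\<alpha> (map L vs) = \<alpha> (map (L \<circ> M) (map (g \<circ> e) xs))"
    unfolding vs by (simp add: o_assoc)
  also have "\<dots> = of_real (det (matrix (g' \<circ> L \<circ> g))) * \<alpha> vs"
    unfolding basis[OF linear_compose[OF M L]] det unfolding vs basis[OF M] by simp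
  finally show ?thesis .
qed

section \<open>Real determinants of complex-linear maps\<close>

lemma of_real_smult: "of_real t *s v = t *\<^sub>R v" for v :: "complex^'n"
  unfolding vec_eq_iff vector_smult_component vector_scaleR_component by (simp add: scaleR_conv_of_real)

text \<open>The sign of \<open>det\<^sub>R L\<close> is found by moving \<open>L\<close> to a large multiple of the identity along
  \<open>L + z I\<close>; the complex numbers \<open>z\<close> for which this is singular are countably many, so that they
  do not separate the plane.\<close>

lemma det_complex_linear_nonneg:
  fixes g :: "real^'m \<Rightarrow> complex^'n" and L :: "complex^'n \<Rightarrow> complex^'n"
  assumes g: "linear g" and g': "linear g'" and gg': "\<And>v. g (g' v) = v" and g'g: "\<And>x. g' (g x) = x"
    and L: "linear L" and Lc: "\<And>c v. L (c *s v) = c *s L v"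
  shows "det (matrix (g' \<circ> L \<circ> g)) \<ge> 0"
proof -
  \<comment> \<open>The first parameter deforms \<open>L\<close>, the second adds a complex multiple
    of the identity. The path goes from \<open>M 0 t\<close> through \<open>M 1 t\<close> to
    \<open>M 1 0\<close>, which is \<open>L\<close>.\<close>
  define M where "M = (\<lambda>s z v. s *\<^sub>R L v + z *s v)"
  define D where "D = (\<lambda>s z. det (matrix (g' \<circ> M s z \<circ> g)))"
  have smul: "linear (\<lambda>v::complex^'n. z *s v)" for z
    by (simp add: linear_iff vector_add_ldistrib vec_eq_iff)
  have M: "linear (M s z)" for s z
    unfolding M_def by (intro linear_compose_add linear_compose_scale_right L smul)
  have D_nz: "D s z \<noteq> 0 \<longleftrightarrow> inj (M s z)" for s z
  proof -
    have lin: "linear (g' \<circ> M s z \<circ> g)" by (intro linear_compose g g' M)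
    have "inj (g' \<circ> M s z \<circ> g) \<longleftrightarrow> inj (M s z)"
      using gg' g'g unfolding inj_on_def by (metis comp_apply UNIV_I)
    then show ?thesis unfolding D_def using det_nz_iff_inj[OF lin] by simp
  qed
  have contD: "continuous_on UNIV (\<lambda>p. D (fst p) (snd p))"
  proof -
    have "matrix (g' \<circ> M s z \<circ> g) $ i $ j = s * g' (L (g (axis j 1))) $ i + g' (z *s g (axis j 1)) $ i"
      for s z i j
      by (simp add: matrix_def M_def linear_add[OF g'] linear_scale[OF g'])
    moreover have lin: "linear (\<lambda>z::complex. g' (z *s w))" for w
    proof -
      have "(c *\<^sub>R x) *s w = c *\<^sub>R (x *s w)" for c and x :: complex by (simp add: vec_eq_iff)
      then show ?thesis by (simp add: linear_iff vector_sadd_rdistrib linear_add[OF g'] linear_scale[OF g'])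
    qed
    then have "continuous_on UNIV (\<lambda>p::real \<times> complex. g' (snd p *s w))" for w
      by (intro continuous_on_compose2[OF linear_continuous_on[of "\<lambda>z. g' (z *s w)" UNIV]] continuous_intros)
        (auto simp: linear_conv_bounded_linear)
    ultimately show ?thesis
      unfolding D_def det_def by (auto intro!: continuous_intros)
  qed
  \<comment> \<open>The complex determinant vanishes for the same \<open>z\<close> as
    \<open>D 1\<close> does, but it is holomorphic in \<open>z\<close>, so that its zeros are
    countable unless it is constant.\<close>
  define C where "C = (\<lambda>z. det (\<chi> i j. L (axis j 1) $ i + (if i = j then z else 0)))"
  have matrix_M: "matrix (M 1 z) = (\<chi> i j. L (axis j 1) $ i + (if i = j then z else 0))" for z
    by (simp add: matrix_def M_def vec_eq_iff axis_def)
  have C_nz: "C z \<noteq> 0 \<longleftrightarrow> inj (M 1 z)" for z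
  proof -
    have "Vector_Spaces.linear (*s) (*s) (M 1 z)"
      unfolding M_def
      by unfold_locales (simp_all add: linear_add[OF L] Lc vector_add_ldistrib vec_eq_iff algebra_simps)
    then have "(*v) (matrix (M 1 z)) = M 1 z" by (simp add: fun_eq_iff matrix_works)
    moreover have "C z = det (matrix (M 1 z))" by (simp add: C_def matrix_M)
    ultimately show ?thesis
      by (metis invertible_det_nz invertible_left_inverse matrix_left_invertible_injective)
  qed
  have "(\<lambda>z. if b then z else 0) holomorphic_on UNIV" for b by (cases b) auto
  then have holC: "C holomorphic_on UNIV"
    unfolding C_def det_def
    by (auto intro!: holomorphic_intros)
  obtain B where B: "B > 0" "\<And>v. norm (L v) \<le> B * norm v"
    using linear_bounded_pos[OF L] by blast
  \<comment> \<open>As \<open>t\<close> exceeds the operator bound \<open>B\<close>, the map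
    \<open>M s t\<close> stays injective for \<open>s\<close> between 0 and 1, and the sign at
    \<open>s = 0\<close> persists to \<open>s = 1\<close>.\<close>
  define t where "t = B + 1"
  have inj_t: "inj (M s (of_real t))" if "0 \<le> s" "s \<le> 1" for s
    unfolding linear_injective_0[OF M]
  proof (intro allI impI)
    fix v assume "M s (of_real t) v = 0"
    then have "t *\<^sub>R v = - (s *\<^sub>R L v)"
      by (simp add: M_def eq_neg_iff_add_eq_0 add.commute of_real_smult)
    then have "norm (t *\<^sub>R v) = norm (s *\<^sub>R L v)" by simp
    then have "t * norm v = s * norm (L v)" using B that by (simp add: t_def)
    also have "\<dots> \<le> 1 * (B * norm v)" using B that by (intro mult_mono) auto
    finally have "norm v \<le> 0" by (simp add: t_def algebra_simps)
    then show "v = 0" by simp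
  qed
  have D0: "D 0 (of_real t) > 0"
  proof -
    have "g' \<circ> M 0 (of_real t) \<circ> g = (\<lambda>x. t *\<^sub>R x)"
      by (simp add: M_def fun_eq_iff of_real_smult linear_scale[OF g'] g'g)
    moreover have "matrix (\<lambda>x::real^'m. t *\<^sub>R x) = (\<chi> i j. if i = j then t else 0)"
      by (simp add: matrix_def axis_def vec_eq_iff)
    ultimately show ?thesis using B by (simp add: D_def det_diagonal t_def)
  qed
  have D1: "D 1 (of_real t) > 0"
  proof (rule ccontr)
    assume "\<not> D 1 (of_real t) > 0"
    moreover have "continuous_on {0..1} (\<lambda>s. D s (of_real t))"
      using continuous_on_compose2[OF contD, of "{0..1}" "\<lambda>s. (s, of_real t)"]
      by (simp add: continuous_intros)
    ultimately obtain s where "0 \<le> s" "s \<le> 1" "D s (of_real t) = 0"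
      using IVT2'[of "\<lambda>s. D s (of_real t)" 1 0 0] D0 by auto
    with inj_t D_nz show False by blast
  qed
  have countable: "countable {z. C z = 0}"
  proof (cases "C constant_on UNIV")
    case True
    then have "C z \<noteq> 0" for z
      using inj_t[of 1] C_nz[of "of_real t"] by (auto simp: constant_on_def)
    then show ?thesis by simp
  next
    case False
    then show ?thesis
      using holomorphic_countable_zeros[OF holC] connected_UNIV by simp
  qed
  have "D 1 0 \<ge> 0"
  proof (rule ccontr)
    assume neg: "\<not> D 1 0 \<ge> 0"
    then have "0 \<in> - {z. C z = 0}" using D_nz C_nz by (simp; metis less_irrefl not_le)
    moreover have t: "of_real t \<in> - {z. C z = 0}" using inj_t[of 1] C_nz by simp
    moreover have "connected (- {z. C z = 0})"
      by (intro path_connected_imp_connected path_connected_complement_countable countable) simp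
    then have "connected (D 1 ` (- {z. C z = 0}))"
      using continuous_on_compose2[OF contD, of "- {z. C z = 0}" "\<lambda>z. (1, z)"]
      by (intro connected_continuous_image) (simp_all add: continuous_intros)
    ultimately have "0 \<in> D 1 ` (- {z. C z = 0})"
      using neg D1 connectedD_interval[of "D 1 ` (- {z. C z = 0})" "D 1 0" "D 1 (of_real t)" 0]
      by (auto simp: not_le)
    then obtain z where "0 = D 1 z" "C z \<noteq> 0" by (elim imageE) simp
    then show False using D_nz[of 1 z] C_nz[of z] by simp
  qed
  moreover have "M 1 0 = L" by (simp add: M_def fun_eq_iff)
  ultimately show ?thesis by (simp add: D_def)
qed

section \<open>Powers of positive (1,1)-forms\<close>

text \<open>Type (1,1) enters as invariance under multiplication of both vectors by i, the shape in
  which it is used pointwise; \<open>alt_type_11_iff\<close> gives the equivalence.\<close>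

definition positive_form :: "(complex^'n) altform \<Rightarrow> bool" where
  "positive_form \<omega> \<longleftrightarrow> alternating 2 \<omega> \<and> (\<forall>v w. \<omega> [\<i> *s v, \<i> *s w] = \<omega> [v, w]) \<and>
     (\<forall>vs. \<omega> vs \<in> \<real>) \<and> (\<forall>v. v \<noteq> 0 \<longrightarrow> Re (\<omega> [v, \<i> *s v]) > 0)"

lemma linear_smult: "linear (\<lambda>v::complex^'n. c *s v)"
  by (simp add: linear_iff vector_add_ldistrib vec_eq_iff)

lemma positive_formD:
  assumes "positive_form \<omega>"
  shows positive_form_alternating: "alternating 2 \<omega>"
    and positive_form_real: "\<omega> vs \<in> \<real>"
    and positive_form_pos: "v \<noteq> 0 \<Longrightarrow> Re (\<omega> [v, \<i> *s v]) > 0"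
    and positive_form_swap: "\<omega> [v, w] = - \<omega> [w, v]"
    and positive_form_refl: "\<omega> [v, v] = 0"
    and positive_form_i_left: "\<omega> [\<i> *s v, w] = - \<omega> [v, \<i> *s w]"
    and positive_form_linear_left: "linear (\<lambda>v. \<omega> [v, w])"
    and positive_form_linear_right: "linear (\<lambda>w. \<omega> [v, w])"
proof -
  show alt: "alternating 2 \<omega>" using assms by (simp add: positive_form_def)
  have ii: "\<omega> [\<i> *s v, \<i> *s w] = \<omega> [v, w]" for v w using assms by (simp add: positive_form_def)
  show "\<omega> vs \<in> \<real>" and "v \<noteq> 0 \<Longrightarrow> Re (\<omega> [v, \<i> *s v]) > 0"
    using assms by (auto simp: positive_form_def)
  show "\<omega> [v, w] = - \<omega> [w, v]"
    using alternating_swap[OF alt, of "[]" v "[]" w "[]"] by simp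
  show "\<omega> [v, v] = 0"
    using alternating_eq[OF alt, of 0 1 "[v, v]"] by simp
  show "linear (\<lambda>v. \<omega> [v, w])" for w
    using alternating_linear[OF alt, of "[]" "[w]"] by simp
  show lin: "linear (\<lambda>w. \<omega> [v, w])" for v
    using alternating_linear[OF alt, of "[v]" "[]"] by simp
  have "\<omega> [\<i> *s v, w] = \<omega> [\<i> *s v, \<i> *s (- \<i> *s w)]"
    by (simp add: vector_smult_assoc)
  also have "\<dots> = \<omega> [v, - (\<i> *s w)]"
    unfolding ii by (rule arg_cong[of _ _ "\<lambda>u. \<omega> [v, u]"]) (simp add: vec_eq_iff)
  finally show "\<omega> [\<i> *s v, w] = - \<omega> [v, \<i> *s w]"
    by (simp add: linear_neg[OF lin])
qed

text \<open>The real frame belonging to a complex one, in the order that fits the complex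
  orientation.\<close>

fun complex_pairs :: "(complex^'n) list \<Rightarrow> (complex^'n) list" where
  "complex_pairs [] = []"
| "complex_pairs (u # us) = u # \<i> *s u # complex_pairs us"

lemma length_complex_pairs [simp]: "length (complex_pairs us) = 2 * length us"
  by (induction us) auto

lemma complex_pairs_append: "complex_pairs (us @ ws) = complex_pairs us @ complex_pairs ws"
  by (induction us) auto

lemma nth_complex_pairs:
  "j < length us \<Longrightarrow> complex_pairs us ! (2 * j) = us ! j"
  "j < length us \<Longrightarrow> complex_pairs us ! Suc (2 * j) = \<i> *s us ! j"
  by (induction us arbitrary: j; case_tac j; simp)+

lemma map_complex_pairs:
  assumes "\<And>c v. f (c *s v) = c *s f v"
  shows "map f (complex_pairs us) = complex_pairs (map f us)"
  by (induction us) (auto simp: assms)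

lemma set_complex_pairs: "set (complex_pairs us) = set us \<union> (\<lambda>u. \<i> *s u) ` set us"
  by (induction us) auto

text \<open>For a positive form \<omega> the two numbers are, up to sign, the imaginary and the real
  part of the associated Hermitian product of \<open>u\<close> and \<open>w\<close>.\<close>

definition omega_orthogonal :: "(complex^'n) altform \<Rightarrow> complex^'n \<Rightarrow> complex^'n \<Rightarrow> bool" where
  "omega_orthogonal \<omega> u w \<longleftrightarrow> \<omega> [u, w] = 0 \<and> \<omega> [u, \<i> *s w] = 0"

lemma omega_orthogonal_sym:
  assumes "positive_form \<omega>" "omega_orthogonal \<omega> u w"
  shows "omega_orthogonal \<omega> w u"
  using assms(2) positive_form_swap[OF assms(1), of w] positive_form_i_left[OF assms(1), of u w]
  by (simp add: omega_orthogonal_def)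

definition omega_orthogonal_list :: "(complex^'n) altform \<Rightarrow> (complex^'n) list \<Rightarrow> bool" where
  "omega_orthogonal_list \<omega> us \<longleftrightarrow> sorted_wrt (omega_orthogonal \<omega>) us \<and> 0 \<notin> set us"

lemma nths_pair:
  assumes "a < b" "b < length vs"
  shows "nths vs {a, b} = [vs ! a, vs ! b]"
proof -
  have "zip vs [0..<length vs] = map (\<lambda>i. (vs ! i, i)) [0..<length vs]"
    by (rule nth_equalityI) auto
  then have "nths vs {a, b} = map (\<lambda>i. vs ! i) (filter (\<lambda>i. i \<in> {a, b}) [0..<length vs])"
    unfolding nths_def by (simp add: filter_map o_def)
  also have "filter (\<lambda>i. i \<in> {a, b}) [0..<length vs] = [a, b]"
    using assms by (intro sorted_distinct_set_unique) (auto simp: sorted_wrt_filter)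
  finally show ?thesis by simp
qed

text \<open>In the shuffle expansion only a vector together with its own multiple by i can be fed to
  \<omega>: sets of another size give lists of the wrong length, and two entries from different
  pairs are \<omega>-orthogonal.\<close>

lemma positive_form_complex_pairs_eq_0:
  assumes pos: "positive_form \<omega>" and orth: "omega_orthogonal_list \<omega> us"
    and S: "S \<subseteq> {..<2 * length us}" and not: "\<And>j. j < length us \<Longrightarrow> S \<noteq> {2 * j, Suc (2 * j)}"
  shows "\<omega> (nths (complex_pairs us) S) = 0"
proof (cases "card S = 2")
  case False
  have "length (nths (complex_pairs us) S) = card S"
    unfolding length_nths using S by (auto intro!: arg_cong[of _ _ card])
  then show ?thesis
    using False alternating_length[OF positive_form_alternating[OF pos]] by simp
next
  case True
  then obtain a b where ab: "S = {a, b}" "a < b"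
    by (metis card_2_iff insert_commute linorder_neqE_nat)
  then have b: "b < 2 * length us" using S by auto
  have nths: "nths (complex_pairs us) S = [complex_pairs us ! a, complex_pairs us ! b]"
    unfolding ab(1) using ab b by (intro nths_pair) auto
  define j k where jk: "j = a div 2" "k = b div 2"
  have a: "a = 2 * j \<or> a = Suc (2 * j)" and b': "b = 2 * k \<or> b = Suc (2 * k)"
    unfolding jk by presburger+
  have "j \<le> k" using ab(2) unfolding jk by (intro div_le_mono) simp
  moreover have "j \<noteq> k"
  proof
    assume "j = k"
    then have "S = {2 * j, Suc (2 * j)}" using ab a b' by auto
    with not[of j] ab(2) b a show False by auto
  qed
  ultimately have jk': "j < k" "k < length us" using b b' by auto
  then have o: "omega_orthogonal \<omega> (us ! j) (us ! k)"
    using orth by (auto simp: omega_orthogonal_list_def sorted_wrt_iff_nth_less)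
  show ?thesis
    unfolding nths using a b' o jk'
    by (auto simp: nth_complex_pairs omega_orthogonal_def positive_form_i_left[OF pos]
        linear_neg[OF positive_form_linear_right[OF pos]])
qed

text \<open>The value is k! times the product of the numbers \<omega>(u, i u), where k is the length
  of \<open>us\<close>. In the induction each surviving shuffle splits off one pair and leaves an
  orthogonal list that is shorter by one.\<close>

lemma alt_power_complex_pairs_pos:
  assumes pos: "positive_form \<omega>" and "omega_orthogonal_list \<omega> us"
  shows "alt_power \<omega> (length us) (complex_pairs us) \<in> \<real> \<and>
    Re (alt_power \<omega> (length us) (complex_pairs us)) > 0"
  using assms(2)
proof (induction "length us" arbitrary: us)
  case 0
  then show ?case by (simp add: alt_one_def)
next
  case (Suc k)
  note orth = Suc.prems
  let ?vs = "complex_pairs us"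
  define T where "T = (\<lambda>S. (- 1) ^ card {(i, j). i \<in> S \<and> j \<in> {..<length ?vs} - S \<and> j < i}
      * \<omega> (nths ?vs S) * alt_power \<omega> k (nths ?vs (- S)))"
  have T0: "T S = 0" if "S \<subseteq> {..<2 * length us}" "\<And>j. j < length us \<Longrightarrow> S \<noteq> {2 * j, Suc (2 * j)}" for S
    using positive_form_complex_pairs_eq_0[OF pos orth that] by (simp add: T_def)
  have T1: "T {2 * j, Suc (2 * j)} \<in> \<real> \<and> Re (T {2 * j, Suc (2 * j)}) > 0" if j: "j < length us" for j
  proof -
    let ?S = "{2 * j, Suc (2 * j)}"
    \<comment> \<open>The positions \<open>2 * j\<close> and \<open>Suc (2 * j)\<close> both jump
      over the same \<open>2 * j\<close> entries, so the shuffle is even.\<close>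
    have "{(i, l). i \<in> ?S \<and> l \<in> {..<length ?vs} - ?S \<and> l < i} = ?S \<times> {..<2 * j}"
      using j by auto
    then have sign: "card {(i, l). i \<in> ?S \<and> l \<in> {..<length ?vs} - ?S \<and> l < i} = 2 * (2 * j)"
      by (simp add: card_cartesian_product)
    have om: "\<omega> (nths ?vs ?S) = \<omega> [us ! j, \<i> *s us ! j]"
      using j by (subst nths_pair) (auto simp: nth_complex_pairs)
    define ws where "ws = take j us @ drop (Suc j) us"
    have us: "us = take j us @ us ! j # drop (Suc j) us" using j by (rule id_take_nth_drop)
    have "?vs = complex_pairs (take j us) @ [us ! j, \<i> *s us ! j] @ complex_pairs (drop (Suc j) us)"
      by (subst us) (simp add: complex_pairs_append)
    moreover have "nths (complex_pairs (take j us)) (- ?S) = complex_pairs (take j us)"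
      using j by (intro nths_all) auto
    moreover have "nths (complex_pairs (drop (Suc j) us)) {l. l + 2 * j + 2 \<in> - ?S}
        = complex_pairs (drop (Suc j) us)"
      by (intro nths_all) auto
    ultimately have ws: "nths ?vs (- ?S) = complex_pairs ws"
      using j by (simp add: nths_append nths_Cons ws_def complex_pairs_append min_def algebra_simps)
    have "omega_orthogonal_list \<omega> ws"
      using orth unfolding omega_orthogonal_list_def ws_def
      by (subst (asm) (1 2) us) (auto simp: sorted_wrt_append dest: in_set_takeD in_set_dropD)
    moreover have "k = length ws" using j Suc.hyps(2) by (simp add: ws_def)
    ultimately have "alt_power \<omega> k (complex_pairs ws) \<in> \<real>" "Re (alt_power \<omega> k (complex_pairs ws)) > 0"
      using Suc.hyps(1) by blast+
    moreover have "\<omega> [us ! j, \<i> *s us ! j] \<in> \<real>" "Re (\<omega> [us ! j, \<i> *s us ! j]) > 0"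
      using positive_form_real[OF pos] positive_form_pos[OF pos] orth j
      by (auto simp: omega_orthogonal_list_def) (metis nth_mem)
    ultimately show ?thesis
      unfolding T_def sign om ws by (auto elim!: Reals_cases)
  qed
  have "alt_power \<omega> (length us) ?vs = alt_power \<omega> (Suc k) ?vs"
    by (simp only: Suc.hyps(2))
  then have eq: "alt_power \<omega> (length us) ?vs = (\<Sum>S\<in>Pow {..<2 * length us}. T S)"
    by (simp add: alt_wedge_def T_def)
  have T: "T S \<in> \<real> \<and> Re (T S) \<ge> 0" if "S \<in> Pow {..<2 * length us}" for S
    using T0[of S] T1 that by (metis Pow_iff Reals_0 order.refl order_less_imp_le zero_complex.sel(1))
  have lus: "0 < length us" "Suc 0 < 2 * length us" by (simp_all flip: Suc.hyps(2))
  have "Re (\<Sum>S\<in>Pow {..<2 * length us}. T S) > 0"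
    unfolding Re_sum
    by (rule sum_pos2[of _ "{2 * 0, Suc (2 * 0)}"]) (use T T1[of 0] lus in auto)
  then show ?case
    unfolding eq using T by (auto intro!: sum_in_Reals)
qed

section \<open>Frames adapted to a covector\<close>

lemma common_zero_of_functionals:
  fixes F :: "('v::euclidean_space \<Rightarrow> real) set"
  assumes "finite F" "card F < DIM('v)" and lin: "\<And>f. f \<in> F \<Longrightarrow> linear f"
  obtains x where "x \<noteq> 0" "\<And>f. f \<in> F \<Longrightarrow> f x = 0"
proof -
  \<comment> \<open>\<open>adjoint f 1\<close> is the vector that represents \<open>f\<close> by the
    inner product; fewer than \<open>DIM('v)\<close> such vectors leave a nonzero orthogonal
    direction.\<close>
  let ?S = "(\<lambda>f. adjoint f 1) ` F"
  have "dim (span ?S) \<le> card ?S" using assms(1) by (simp add: dim_le_card')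
  also have "\<dots> < DIM('v)" using assms(2) card_image_le[OF assms(1)] by (rule le_less_trans[rotated])
  finally obtain x where x: "x \<noteq> 0" "\<And>y. y \<in> span ?S \<Longrightarrow> orthogonal x y"
    using orthogonal_to_subspace_exists[of ?S] by auto
  moreover have "f x = 0" if "f \<in> F" for f
    using x(2)[OF span_base, of "adjoint f 1"] that adjoint_works[OF lin[OF that], of x 1]
    by (auto simp: orthogonal_def inner_commute)
  ultimately show ?thesis using that by blast
qed

text \<open>Dimension count: besides \<open>m\<close> chosen vectors, the next one has to satisfy
  two real equations for \<theta> and two for each chosen vector, and \<open>2 + 2 * m\<close> is
  smaller than the real dimension as long as \<open>Suc m < CARD('n)\<close>.\<close>

lemma omega_orthogonal_list_exists:
  fixes \<theta> :: "complex^'n::finite \<Rightarrow> complex"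
  assumes pos: "positive_form \<omega>" and \<theta>: "linear \<theta>" and "m < CARD('n)"
  shows "\<exists>us. length us = m \<and> omega_orthogonal_list \<omega> us \<and> (\<forall>u\<in>set us. \<theta> u = 0)"
  using assms(3)
proof (induction m)
  case 0
  show ?case by (auto simp: omega_orthogonal_list_def)
next
  case (Suc m)
  then obtain us where us: "length us = m" "omega_orthogonal_list \<omega> us" "\<forall>u\<in>set us. \<theta> u = 0"
    by auto
  let ?F = "{\<lambda>x. Re (\<theta> x), \<lambda>x. Im (\<theta> x)} \<union> ((\<lambda>u x. Re (\<omega> [u, x])) ` set us
    \<union> (\<lambda>u x. Re (\<omega> [u, \<i> *s x])) ` set us)"
  have "card ?F \<le> card {\<lambda>x. Re (\<theta> x), \<lambda>x. Im (\<theta> x)} + (card ((\<lambda>u x. Re (\<omega> [u, x])) ` set us)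
      + card ((\<lambda>u x. Re (\<omega> [u, \<i> *s x])) ` set us))"
    by (intro order.trans[OF card_Un_le] add_mono order.refl card_Un_le)
  also have "\<dots> \<le> 2 + (m + m)"
    using card_length[of us] us(1)
    by (intro add_mono) (auto intro!: order.trans[OF card_image_le] simp: card_insert_if)
  also have "\<dots> < DIM(complex^'n)" using Suc.prems by simp
  finally have card: "card ?F < DIM(complex^'n)" .
  have lin: "linear f" if "f \<in> ?F" for f
  proof -
    have Re: "linear (\<lambda>x. Re (h x))" and Im: "linear (\<lambda>x. Im (h x))" if "linear h" for h :: "complex^'n \<Rightarrow> complex"
      using linear_compose[OF that bounded_linear.linear[OF bounded_linear_Re]]
        linear_compose[OF that bounded_linear.linear[OF bounded_linear_Im]] by (simp_all add: o_def)
    have "linear (\<lambda>x. \<omega> [u, \<i> *s x])" for u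
      using linear_compose[OF linear_smult positive_form_linear_right[OF pos]] by (simp add: o_def)
    then show ?thesis
      using that Re Im \<theta> positive_form_linear_right[OF pos] by auto
  qed
  obtain x where x: "x \<noteq> 0" "\<And>f. f \<in> ?F \<Longrightarrow> f x = 0"
    by (rule common_zero_of_functionals[OF _ card lin]) (simp, assumption, rule that)
  have "\<theta> x = 0" using x(2)[of "\<lambda>x. Re (\<theta> x)"] x(2)[of "\<lambda>x. Im (\<theta> x)"] by (simp add: complex_eq_iff)
  moreover have "omega_orthogonal \<omega> x u" if "u \<in> set us" for u
  proof (rule omega_orthogonal_sym[OF pos])
    have "Re (\<omega> [u, x]) = 0" "Re (\<omega> [u, \<i> *s x]) = 0"
      using x(2)[of "\<lambda>x. Re (\<omega> [u, x])"] x(2)[of "\<lambda>x. Re (\<omega> [u, \<i> *s x])"] that by auto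
    then show "omega_orthogonal \<omega> u x"
      using positive_form_real[OF pos]
      by (auto simp: omega_orthogonal_def complex_eq_iff complex_is_Real_iff)
  qed
  ultimately show ?case
    using us x(1) by (intro exI[of _ "x # us"]) (auto simp: omega_orthogonal_list_def)
qed

text \<open>Gram-Schmidt: multiples of u and i u are subtracted in turn. Both lie in the kernel of
  \<theta>, which preserves the value of \<theta>, and both are orthogonal to the vectors already
  treated, which preserves what has been achieved.\<close>

lemma omega_orthogonal_projection:
  fixes \<theta> :: "complex^'n \<Rightarrow> complex"
  assumes pos: "positive_form \<omega>" and \<theta>: "linear \<theta>" and \<theta>i: "\<And>v. \<theta> (\<i> *s v) = s * \<theta> v"
    and "omega_orthogonal_list \<omega> us" "\<forall>u\<in>set us. \<theta> u = 0"
  shows "\<exists>b. \<theta> b = \<theta> a \<and> (\<forall>u\<in>set us. omega_orthogonal \<omega> b u)"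
  using assms(4,5)
proof (induction us)
  case (Cons u us)
  then obtain b where b: "\<theta> b = \<theta> a" "\<forall>w\<in>set us. omega_orthogonal \<omega> b w"
    by (auto simp: omega_orthogonal_list_def)
  define r where "r = Re (\<omega> [u, \<i> *s u])"
  have r: "\<omega> [u, \<i> *s u] = of_real r" "r > 0"
    using positive_form_real[OF pos] positive_form_pos[OF pos, of u] Cons.prems
    by (auto simp: r_def omega_orthogonal_list_def)
  \<comment> \<open>As \<omega>(u, u) = 0 and \<omega>(u, i u) = r, the multiple \<open>p\<close> of
    u corrects \<omega>(b, i u), and the multiple \<open>q\<close> of i u corrects \<omega>(b,
    u).\<close>
  define p q where pq: "p = Re (\<omega> [b, \<i> *s u]) / r" "q = - Re (\<omega> [b, u]) / r"
  define b' where "b' = b - p *\<^sub>R u - q *\<^sub>R (\<i> *s u)"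
  have om: "\<omega> [b', w] = \<omega> [b, w] - of_real p * \<omega> [u, w] + of_real q * \<omega> [u, \<i> *s w]" for w
    unfolding b'_def
    by (simp add: linear_diff[OF positive_form_linear_left[OF pos]] linear_scale[OF positive_form_linear_left[OF pos]]
        positive_form_i_left[OF pos] scaleR_conv_of_real[where 'a = complex])
  have ii: "\<i> *s (\<i> *s w) = - w" for w :: "complex^'n" by (simp add: vec_eq_iff)
  have omi: "\<omega> [b', \<i> *s w] = \<omega> [b, \<i> *s w] - of_real p * \<omega> [u, \<i> *s w] - of_real q * \<omega> [u, w]" for w
    unfolding om ii by (simp add: linear_neg[OF positive_form_linear_right[OF pos]])
  have "\<theta> b' = \<theta> a"
    using Cons.prems b by (simp add: b'_def linear_diff[OF \<theta>] linear_scale[OF \<theta>] \<theta>i)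
  moreover have "omega_orthogonal \<omega> b' w" if "w \<in> set us" for w
    using b that Cons.prems
    by (auto simp: omega_orthogonal_def om omi omega_orthogonal_list_def
        linear_neg[OF positive_form_linear_right[OF pos]])
  moreover have "omega_orthogonal \<omega> b' u"
  proof -
    have "of_real (Re (\<omega> [b, w])) = \<omega> [b, w]" for w
      using positive_form_real[OF pos] by simp
    then show ?thesis
      using r by (simp add: omega_orthogonal_def om omi positive_form_refl[OF pos] pq
          linear_neg[OF positive_form_linear_right[OF pos]])
  qed
  ultimately show ?case by (intro exI[of _ b']) auto
qed auto

lemma covector_wedge_vanish:
  assumes "\<And>v. v \<in> set vs \<Longrightarrow> \<theta> v = 0"
  shows "asum (\<lambda>v l. \<theta> v * F v l) vs = 0"
  using asum_cong[of vs "\<lambda>v l. \<theta> v * F v l" "\<lambda>v l. 0"] assms by simp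

text \<open>In the frame all vectors except b and i b lie in the kernel of \<theta>, so only the
  terms that feed these two to \<theta> and its conjugate survive. They contribute the factor
  \<open>cnj s - s\<close>, and the additional \<open>s\<close> turns it into 2 for both
  types.\<close>

lemma wedge_positive_power_pos:
  fixes \<theta> :: "complex^'n::finite \<Rightarrow> complex"
  assumes pos: "positive_form \<omega>" and \<theta>: "linear \<theta>" and \<theta>i: "\<And>v. \<theta> (\<i> *s v) = s * \<theta> v"
    and s: "s = \<i> \<or> s = - \<i>" and a: "\<theta> a \<noteq> 0"
  shows "\<exists>us. length us = CARD('n) \<and>
    Re (s * covector_wedge \<theta> (covector_wedge (\<lambda>v. cnj (\<theta> v)) (alt_power \<omega> (CARD('n) - 1))) (complex_pairs us)) > 0"
proof -
  obtain us where us: "length us = CARD('n) - 1" "omega_orthogonal_list \<omega> us" "\<forall>u\<in>set us. \<theta> u = 0"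
    using omega_orthogonal_list_exists[OF pos \<theta>, of "CARD('n) - 1"] by auto
  obtain b where b: "\<theta> b = \<theta> a" "\<forall>u\<in>set us. omega_orthogonal \<omega> b u"
    using omega_orthogonal_projection[OF pos \<theta> \<theta>i us(2,3)] by blast
  define W where "W = alt_power \<omega> (CARD('n) - 1)"
  have zero: "\<theta> v = 0" if "v \<in> set (complex_pairs us)" for v
    using that us(3) by (auto simp: set_complex_pairs \<theta>i)
  have inner: "covector_wedge (\<lambda>v. cnj (\<theta> v)) W (x # complex_pairs us) = cnj (\<theta> x) * W (complex_pairs us)" for x
    unfolding covector_wedge_def asum_Cons
    using covector_wedge_vanish[of "complex_pairs us" "\<lambda>v. cnj (\<theta> v)"] zero by simp
  have "covector_wedge \<theta> (covector_wedge (\<lambda>v. cnj (\<theta> v)) W) (complex_pairs (b # us))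
      = (\<theta> b * cnj (\<theta> (\<i> *s b)) - \<theta> (\<i> *s b) * cnj (\<theta> b)) * W (complex_pairs us)"
    unfolding covector_wedge_def[of \<theta>] complex_pairs.simps asum_Cons inner
    using covector_wedge_vanish[of "complex_pairs us" \<theta>] zero by (simp add: algebra_simps)
  also have "\<dots> = (cnj s - s) * (\<theta> b * cnj (\<theta> b)) * W (complex_pairs us)"
    by (simp add: \<theta>i algebra_simps)
  also have "\<theta> b * cnj (\<theta> b) = of_real ((cmod (\<theta> b))\<^sup>2)"
    by (rule complex_norm_square[symmetric])
  finally have "s * covector_wedge \<theta> (covector_wedge (\<lambda>v. cnj (\<theta> v)) W) (complex_pairs (b # us))
      = (s * (cnj s - s)) * of_real ((cmod (\<theta> b))\<^sup>2) * W (complex_pairs us)"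
    by (simp only: mult.assoc)
  also have "s * (cnj s - s) = 2"
    using s by (auto simp: complex_eq_iff)
  finally have "s * covector_wedge \<theta> (covector_wedge (\<lambda>v. cnj (\<theta> v)) W) (complex_pairs (b # us))
      = of_real (2 * (cmod (\<theta> b))\<^sup>2) * W (complex_pairs us)"
    by simp
  moreover have "Re (W (complex_pairs us)) > 0"
    using alt_power_complex_pairs_pos[OF pos us(2)] by (simp add: W_def us(1))
  ultimately show ?thesis
    using us(1) a b by (intro exI[of _ "b # us"]) (simp add: W_def)
qed

text \<open>A fixed frame turns a top form into a density. The order picked by \<open>SOME\<close>
  does not affect the value: permuting the axes moves the vectors in pairs, which is an even
  permutation.\<close>

definition standard_frame :: "(complex^'n::finite) list" where
  "standard_frame = complex_pairs (map (\<lambda>i. axis i 1) (SOME xs. distinct xs \<and> set xs = UNIV))"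

text \<open>Being complex-linear, \<open>L\<close> only has to send the axes to \<open>us\<close>;
  the multiples by i follow. As its real determinant is nonnegative, signs found on
  \<open>complex_pairs us\<close> can be compared with those on the standard frame.\<close>

lemma standard_frame_image:
  fixes us :: "(complex^'n::finite) list"
  assumes "length us = CARD('n)"
  obtains L :: "complex^'n \<Rightarrow> complex^'n" where "linear L" "\<And>c v. L (c *s v) = c *s L v"
    "map L standard_frame = complex_pairs us"
proof -
  define xs :: "'n list" where "xs = (SOME xs. distinct xs \<and> set xs = UNIV)"
  have "\<exists>xs::'n list. distinct xs \<and> set xs = UNIV"
    using finite_distinct_list[OF finite] by blast
  then have xs: "distinct xs" "set xs = UNIV"
    unfolding xs_def by (metis (mono_tags, lifting) someI_ex)+
  then have lxs: "length xs = CARD('n)" by (metis distinct_card)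
  define L where "L = (\<lambda>v::complex^'n. \<Sum>i\<in>UNIV. (v $ i) *s (us ! (LEAST m. m < length xs \<and> xs ! m = i)))"
  have L: "linear L"
    unfolding L_def
    by (intro linear_compose_sum ballI)
      (simp add: linear_iff vec_eq_iff algebra_simps)
  have Lc: "L (c *s v) = c *s L v" for c v
    unfolding L_def by (simp add: vec_eq_iff sum_distrib_left algebra_simps)
  have "map L (map (\<lambda>i. axis i 1) xs) = us"
  proof (rule nth_equalityI)
    fix m assume "m < length (map L (map (\<lambda>i. axis i 1) xs))"
    then have m: "m < length xs" by simp
    have "(LEAST m'. m' < length xs \<and> xs ! m' = xs ! m) = m"
      using m xs by (intro Least_equality) (auto simp: nth_eq_iff_index_eq)
    then have "L (axis (xs ! m) 1) = us ! m"
      unfolding L_def axis_def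
      by (simp add: if_distrib[of "\<lambda>x. x *s _"] cong: if_cong)
    then show "map L (map (\<lambda>i. axis i 1) xs) ! m = us ! m" using m by simp
  qed (simp add: assms lxs)
  then have "map L standard_frame = complex_pairs us"
    by (simp add: standard_frame_def map_complex_pairs Lc flip: xs_def)
  with L Lc show ?thesis by (rule that)
qed

lemma length_standard_frame [simp]: "length (standard_frame :: (complex^'n::finite) list) = 2 * CARD('n)"
proof -
  \<comment> \<open>Any image of the frame has the length of the frame; a list of zero vectors
    serves as target.\<close>
  obtain L :: "complex^'n \<Rightarrow> complex^'n" where "map L standard_frame = complex_pairs (replicate CARD('n) 0)"
    by (rule standard_frame_image[of "replicate CARD('n) (0 :: complex^'n)"]) (simp, rule that)
  then have "length (map L standard_frame) = 2 * CARD('n)" by simp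
  then show ?thesis by simp
qed

section \<open>Calculus\<close>

lemma has_vector_derivative_line:
  assumes "(f has_derivative f') (at (y + a *\<^sub>R v))"
  shows "((\<lambda>t. f (y + t *\<^sub>R v)) has_vector_derivative f' v) (at a)"
proof -
  have "((\<lambda>t. y + t *\<^sub>R v) has_derivative (\<lambda>h. h *\<^sub>R v)) (at a)"
    by (auto intro!: derivative_eq_intros)
  from has_derivative_compose[OF this assms]
  show ?thesis
    using linear_scale[OF has_derivative_linear[OF assms]]
    by (simp add: has_vector_derivative_def)
qed

lemma has_real_derivative_line:
  fixes f :: "'v::real_normed_vector \<Rightarrow> real"
  assumes "(f has_derivative f') (at (y + a *\<^sub>R v))"
  shows "((\<lambda>t. f (y + t *\<^sub>R v)) has_real_derivative f' v) (at a)"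
  using has_vector_derivative_line[OF assms] by (simp add: has_real_derivative_iff_has_vector_derivative)

text \<open>The mean value theorem is applied to the increment by t w as a function along
  \<open>v\<close>, and then to the derivative in direction \<open>v\<close> as a function along
  \<open>w\<close>.\<close>

lemma second_difference_mvt:
  fixes g :: "'v::real_normed_vector \<Rightarrow> real"
  assumes g: "\<And>y. y \<in> ball x e \<Longrightarrow> (g has_derivative g' y) (at y)"
    and gv: "\<And>y. y \<in> ball x e \<Longrightarrow> ((\<lambda>y. g' y v) has_derivative h' y) (at y)"
    and t: "0 < t" "t * (norm v + norm w) < e"
  obtains y where "dist x y \<le> t * (norm v + norm w)"
    "g (x + t *\<^sub>R v + t *\<^sub>R w) - g (x + t *\<^sub>R v) - g (x + t *\<^sub>R w) + g x = t\<^sup>2 * h' y w"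
proof -
  have dist: "dist x (x + a *\<^sub>R v + b *\<^sub>R w) \<le> t * (norm v + norm w)"
    if "0 \<le> a" "a \<le> t" "0 \<le> b" "b \<le> t" for a b
  proof -
    have "dist x (x + a *\<^sub>R v + b *\<^sub>R w) = norm (a *\<^sub>R v + b *\<^sub>R w)"
      by (metis add.assoc dist_add_cancel dist_0_norm add_0_right)
    also have "\<dots> \<le> a * norm v + b * norm w"
      using norm_triangle_ineq[of "a *\<^sub>R v" "b *\<^sub>R w"] that by simp
    also have "\<dots> \<le> t * norm v + t * norm w"
      using that by (intro add_mono mult_right_mono) auto
    finally show ?thesis by (simp add: distrib_left)
  qed
  have ball: "x + a *\<^sub>R v + b *\<^sub>R w \<in> ball x e" if "0 \<le> a" "a \<le> t" "0 \<le> b" "b \<le> t" for a b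
    using dist[OF that] t by simp
  define p where "p = (\<lambda>a. g ((x + t *\<^sub>R w) + a *\<^sub>R v) - g (x + a *\<^sub>R v))"
  have "(p has_real_derivative (g' ((x + t *\<^sub>R w) + a *\<^sub>R v) v - g' (x + a *\<^sub>R v) v)) (at a)"
    if "0 \<le> a" "a \<le> t" for a
    unfolding p_def using ball[of a t] ball[of a 0] that t
    by (intro DERIV_diff has_real_derivative_line g) (simp_all add: add_ac)
  from MVT2[OF t(1) this] obtain a where a: "0 < a" "a < t"
    "p t - p 0 = t * (g' ((x + t *\<^sub>R w) + a *\<^sub>R v) v - g' (x + a *\<^sub>R v) v)"
    by auto
  have "((\<lambda>b. g' ((x + a *\<^sub>R v) + b *\<^sub>R w) v) has_real_derivative h' ((x + a *\<^sub>R v) + b *\<^sub>R w) w) (at b)"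
    if "0 \<le> b" "b \<le> t" for b
    using ball[of a b] that a by (intro has_real_derivative_line gv) simp
  from MVT2[OF t(1) this] obtain b where b: "0 < b" "b < t"
    "g' ((x + a *\<^sub>R v) + t *\<^sub>R w) v - g' (x + a *\<^sub>R v) v = t * h' ((x + a *\<^sub>R v) + b *\<^sub>R w) w"
    by auto
  show ?thesis
  proof (rule that)
    show "dist x (x + a *\<^sub>R v + b *\<^sub>R w) \<le> t * (norm v + norm w)" using a b by (intro dist) auto
    show "g (x + t *\<^sub>R v + t *\<^sub>R w) - g (x + t *\<^sub>R v) - g (x + t *\<^sub>R w) + g x
        = t\<^sup>2 * h' (x + a *\<^sub>R v + b *\<^sub>R w) w"
      using a(3) b(3) by (simp add: p_def add_ac power2_eq_square algebra_simps)
  qed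
qed

text \<open>The second difference does not change when \<open>v\<close> and \<open>w\<close> are
  exchanged, so it yields both mixed derivatives, at points that tend to \<open>x\<close> with the
  step size. Continuity of the two derivatives then gives equality at \<open>x\<close>.\<close>

lemma symmetric_second_derivative_real:
  fixes g :: "'v::real_normed_vector \<Rightarrow> real"
  assumes S: "open S" "x \<in> S"
    and g: "\<And>y. y \<in> S \<Longrightarrow> (g has_derivative g' y) (at y)"
    and gv: "\<And>y. y \<in> S \<Longrightarrow> ((\<lambda>y. g' y v) has_derivative hv y) (at y)"
    and gw: "\<And>y. y \<in> S \<Longrightarrow> ((\<lambda>y. g' y w) has_derivative hw y) (at y)"
    and cv: "continuous_on S (\<lambda>y. hv y w)" and cw: "continuous_on S (\<lambda>y. hw y v)"
  shows "hv x w = hw x v"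
proof -
  obtain e where e: "e > 0" "ball x e \<subseteq> S" using S openE by blast
  \<comment> \<open>The summand 1 keeps the denominator positive even if \<open>v\<close> and
    \<open>w\<close> are both 0; the step sizes keep the parallelogram inside the ball.\<close>
  define t where "t = (\<lambda>k. e / (real k + 2) / (1 + norm v + norm w))"
  have t: "0 < t k" "t k * (norm v + norm w) < e" for k
  proof -
    have pos: "1 + norm v + norm w > 0" by (simp add: add_pos_nonneg)
    show "0 < t k" using e pos by (simp add: t_def)
    have "t k * (norm v + norm w) < t k * (1 + norm v + norm w)" using \<open>0 < t k\<close> by simp
    also have "\<dots> = e / (real k + 2)" using pos by (simp add: t_def)
    also have "\<dots> < e" using e by (simp add: divide_less_eq)
    finally show "t k * (norm v + norm w) < e" .
  qed
  have "t \<longlonglongrightarrow> 0"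
    unfolding t_def divide_inverse[of _ "_ + _ + _"]
    by real_asymp
  then have lim: "(\<lambda>k. t k * (norm v + norm w)) \<longlonglongrightarrow> 0" by (rule tendsto_mult_left_zero)
  have tendsto: "(\<lambda>k. h (y k)) \<longlonglongrightarrow> h x"
    if "\<And>k. dist x (y k) \<le> t k * (norm v + norm w)" "continuous_on S h" for y :: "nat \<Rightarrow> 'v" and h :: "'v \<Rightarrow> real"
  proof -
    have "(\<lambda>k. dist (y k) x) \<longlonglongrightarrow> 0"
      by (rule Lim_null_comparison[OF _ lim]) (simp add: that(1) dist_commute)
    then have "y \<longlonglongrightarrow> x" by (rule tendsto_dist_iff[THEN iffD2])
    moreover have "isCont h x" using that(2) S by (simp add: continuous_on_eq_continuous_at)
    ultimately show ?thesis by (rule isCont_tendsto_compose[rotated])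
  qed
  let ?D = "\<lambda>t. g (x + t *\<^sub>R v + t *\<^sub>R w) - g (x + t *\<^sub>R v) - g (x + t *\<^sub>R w) + g x"
  have "\<exists>y. dist x y \<le> t k * (norm v + norm w) \<and> ?D (t k) = (t k)\<^sup>2 * hv y w" for k
    by (rule second_difference_mvt[where g = g and g' = g' and h' = hv, OF _ _ t]) (use g gv e(2) in auto)
  then obtain y where y: "\<And>k. dist x (y k) \<le> t k * (norm v + norm w)" "\<And>k. ?D (t k) = (t k)\<^sup>2 * hv (y k) w"
    by metis
  have "\<exists>y. dist x y \<le> t k * (norm v + norm w) \<and> ?D (t k) = (t k)\<^sup>2 * hw y v" for k
  proof -
    have t': "t k * (norm w + norm v) < e" using t(2)[of k] by (simp add: add.commute)
    obtain y where "dist x y \<le> t k * (norm w + norm v)"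
      "g (x + t k *\<^sub>R w + t k *\<^sub>R v) - g (x + t k *\<^sub>R w) - g (x + t k *\<^sub>R v) + g x = (t k)\<^sup>2 * hw y v"
      by (rule second_difference_mvt[where g = g and g' = g' and h' = hw, OF _ _ t(1) t']) (use g gw e(2) in auto)
    then show ?thesis by (intro exI[of _ y]) (simp add: algebra_simps)
  qed
  then obtain z where z: "\<And>k. dist x (z k) \<le> t k * (norm v + norm w)" "\<And>k. ?D (t k) = (t k)\<^sup>2 * hw (z k) v"
    by metis
  have "hv (y k) w = hw (z k) v" for k
    using y(2)[of k] z(2)[of k] t(1)[of k] by simp
  then show ?thesis
    using tendsto[OF y(1) cv] tendsto[OF z(1) cw] LIMSEQ_unique by simp
qed

lemma symmetric_second_derivative_complex:
  fixes f :: "'v::real_normed_vector \<Rightarrow> complex"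
  assumes S: "open S" "x \<in> S"
    and f: "\<And>y. y \<in> S \<Longrightarrow> (f has_derivative f' y) (at y)"
    and fv: "\<And>y. y \<in> S \<Longrightarrow> ((\<lambda>y. f' y v) has_derivative hv y) (at y)"
    and fw: "\<And>y. y \<in> S \<Longrightarrow> ((\<lambda>y. f' y w) has_derivative hw y) (at y)"
    and cv: "continuous_on S (\<lambda>y. hv y w)" and cw: "continuous_on S (\<lambda>y. hw y v)"
  shows "hv x w = hw x v"
proof (rule complex_eqI)
  show "Re (hv x w) = Re (hw x v)"
    by (rule symmetric_second_derivative_real[OF S, of "\<lambda>y. Re (f y)" "\<lambda>y u. Re (f' y u)" v
          "\<lambda>y u. Re (hv y u)" w "\<lambda>y u. Re (hw y u)"])
      (intro has_derivative_Re f fv fw continuous_on_Re cv cw; assumption)+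
  show "Im (hv x w) = Im (hw x v)"
    by (rule symmetric_second_derivative_real[OF S, of "\<lambda>y. Im (f y)" "\<lambda>y u. Im (f' y u)" v
          "\<lambda>y u. Im (hv y u)" w "\<lambda>y u. Im (hw y u)"])
      (intro has_derivative_Im f fv fw continuous_on_Im cv cw; assumption)+
qed

section \<open>Integration over Euclidean space\<close>

lemma integrable_compact_support:
  fixes f :: "'e::euclidean_space \<Rightarrow> real"
  assumes "continuous_on UNIV f" "compact K" "\<And>x. x \<notin> K \<Longrightarrow> f x = 0"
  shows "integrable lborel f"
proof -
  have "integrable lborel (\<lambda>x. indicator K x *\<^sub>R f x)"
    using assms by (intro borel_integrable_compact continuous_on_subset[OF assms(1)]) auto
  moreover have "(\<lambda>x. indicator K x *\<^sub>R f x) = f"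
    using assms(3) by (auto simp: fun_eq_iff indicator_def)
  ultimately show ?thesis by simp
qed

lemma integral_lborel_translation:
  fixes f :: "'e::euclidean_space \<Rightarrow> real"
  assumes "integrable lborel f"
  shows "integrable lborel (\<lambda>x. f (x + v))" "integral\<^sup>L lborel (\<lambda>x. f (x + v)) = integral\<^sup>L lborel f"
proof -
  have f: "f \<in> borel_measurable borel" using borel_measurable_integrable[OF assms] by simp
  have "integrable (distr lborel borel ((+) v)) f" using assms by (simp add: lborel_distr_plus)
  then show "integrable lborel (\<lambda>x. f (x + v))"
    using f by (subst (asm) integrable_distr_eq) (auto simp: add.commute)
  have "integral\<^sup>L (distr lborel borel ((+) v)) f = integral\<^sup>L lborel (\<lambda>x. f (v + x))"
    using f by (intro integral_distr) auto
  then show "integral\<^sup>L lborel (\<lambda>x. f (x + v)) = integral\<^sup>L lborel f"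
    by (simp add: lborel_distr_plus add.commute)
qed

text \<open>The difference quotients have integral 0 and converge to the derivative. The mean value
  theorem bounds them by the bound of the derivative, as needed for dominated convergence.\<close>

lemma integral_directional_derivative_eq_0:
  fixes f :: "'e::euclidean_space \<Rightarrow> real"
  assumes f: "\<And>x. (f has_derivative f' x) (at x)"
    and cont: "continuous_on UNIV (\<lambda>x. f' x v)"
    and K: "compact K" "\<And>x. x \<notin> K \<Longrightarrow> f x = 0" "\<And>x. x \<notin> K \<Longrightarrow> f' x v = 0"
  shows "integral\<^sup>L lborel (\<lambda>x. f' x v) = 0"
proof -
  have contf: "continuous_on UNIV f"
    using f by (auto intro!: continuous_at_imp_continuous_on has_derivative_continuous)
  have intf: "integrable lborel f" by (rule integrable_compact_support[OF contf K(1,2)])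
  define q where "q = (\<lambda>k x. (f (x + (1 / real (Suc k)) *\<^sub>R v) - f x) * real (Suc k))"
  have q0: "integral\<^sup>L lborel (q k) = 0" for k
    unfolding q_def using integral_lborel_translation[OF intf] intf by simp
  obtain B where B: "\<And>x. \<bar>f' x v\<bar> \<le> B" "B \<ge> 0"
  proof -
    have "bounded ((\<lambda>x. f' x v) ` K)"
      by (rule compact_imp_bounded[OF compact_continuous_image[OF continuous_on_subset[OF cont] K(1)]]) simp
    then obtain B where B: "\<And>x. x \<in> K \<Longrightarrow> \<bar>f' x v\<bar> \<le> B" unfolding bounded_iff real_norm_def by blast
    have "\<bar>f' x v\<bar> \<le> max B 0" for x
    proof (cases "x \<in> K")
      case True
      then show ?thesis using B[of x] by linarith
    qed (simp add: K(3))
    then show ?thesis by (rule that) simp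
  qed
  obtain r where r: "K \<subseteq> cball 0 r" using bounded_subset_ballD[OF compact_imp_bounded[OF K(1)], of 0] ball_subset_cball by (meson subset_trans)
  \<comment> \<open>The steps are at most 1, so outside this larger ball neither the point nor its
    translate lies in the support.\<close>
  let ?C = "cball (0::'e) (r + norm v)"
  have q_mvt: "\<exists>\<xi>. q k x = f' \<xi> v" for k x
  proof -
    obtain z where "f (x + (1 / real (Suc k)) *\<^sub>R v) - f (x + 0 *\<^sub>R v) = (1 / real (Suc k) - 0) * f' (x + z *\<^sub>R v) v"
      using MVT2[of 0 "1 / real (Suc k)" "\<lambda>t. f (x + t *\<^sub>R v)" "\<lambda>t. f' (x + t *\<^sub>R v) v"]
        has_real_derivative_line[OF f] by (metis of_nat_0_less_iff zero_less_Suc zero_less_divide_1_iff)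
    then show ?thesis
      by (intro exI[of _ "x + z *\<^sub>R v"]) (simp add: q_def field_simps)
  qed
  have q_supp: "q k x = 0" if "x \<notin> ?C" for k x
  proof -
    have norm: "norm x > r + norm v" using that by simp
    then have "x \<notin> K" using r by (smt (verit) mem_cball_0 norm_ge_zero subsetD)
    moreover have "norm ((1 / real (Suc k)) *\<^sub>R v) \<le> norm v"
      by (simp add: divide_le_eq mult_left_le algebra_simps)
    then have "norm (x + (1 / real (Suc k)) *\<^sub>R v) > r"
      using norm norm_diff_ineq[of x "(1 / real (Suc k)) *\<^sub>R v"] by linarith
    then have "x + (1 / real (Suc k)) *\<^sub>R v \<notin> K" using r by auto
    ultimately show ?thesis by (simp add: q_def K(2))
  qed
  have "(\<lambda>k. integral\<^sup>L lborel (q k)) \<longlonglongrightarrow> integral\<^sup>L lborel (\<lambda>x. f' x v)"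
  proof (rule integral_dominated_convergence[where w = "\<lambda>x. B * indicator ?C x"])
    show "(\<lambda>x. f' x v) \<in> borel_measurable lborel"
      using borel_measurable_continuous_onI[OF cont] by simp
    show "q k \<in> borel_measurable lborel" for k
      unfolding q_def using borel_measurable_integrable[OF intf]
        borel_measurable_integrable[OF integral_lborel_translation(1)[OF intf]] by measurable
    show "integrable lborel (\<lambda>x. B * indicator ?C x)"
      by (intro integrable_mult_right integrable_real_indicator) (use emeasure_lborel_cball_finite[of 0 "r + norm v"] in auto)
    show "AE x in lborel. norm (q k x) \<le> B * indicator ?C x" for k
    proof (rule AE_I2)
      fix x show "norm (q k x) \<le> B * indicator ?C x"
        using q_mvt[of k x] B(1) q_supp[of x k] by (cases "x \<in> ?C") auto
    qed
    show "AE x in lborel. (\<lambda>k. q k x) \<longlonglongrightarrow> f' x v"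
    proof (rule AE_I2)
      fix x
      have "((\<lambda>t. f (x + t *\<^sub>R v)) has_real_derivative f' x v) (at 0)"
        using has_real_derivative_line[of f "f' x" x 0 v] f by simp
      then have "((\<lambda>h. (f (x + h *\<^sub>R v) - f x) / h) \<longlongrightarrow> f' x v) (at 0)"
        by (simp add: DERIV_def)
      moreover have "filterlim (\<lambda>k. 1 / real (Suc k)) (at 0) sequentially"
        unfolding filterlim_at using LIMSEQ_inverse_real_of_nat by (auto simp: inverse_eq_divide)
      ultimately have "(\<lambda>k. (f (x + (1 / real (Suc k)) *\<^sub>R v) - f x) / (1 / real (Suc k))) \<longlonglongrightarrow> f' x v"
        by (rule filterlim_compose)
      then show "(\<lambda>k. q k x) \<longlonglongrightarrow> f' x v" by (simp add: q_def)
    qed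
  qed
  then have "(\<lambda>k. 0::real) \<longlonglongrightarrow> integral\<^sup>L lborel (\<lambda>x. f' x v)" by (simp only: q0)
  then show ?thesis using LIMSEQ_unique tendsto_const by blast
qed

lemma integral_lborel_change_of_variables:
  fixes f F :: "real^'m::{finite,wellorder} \<Rightarrow> real"
  assumes S: "open S" and \<phi>: "\<And>x. x \<in> S \<Longrightarrow> (\<phi> has_derivative \<phi>' x) (at x)" "inj_on \<phi> S"
    and f: "integrable lborel f" "\<And>y. y \<notin> \<phi> ` S \<Longrightarrow> f y = 0"
    and F: "integrable lborel F" "\<And>x. x \<notin> S \<Longrightarrow> F x = 0"
    and eq: "\<And>x. x \<in> S \<Longrightarrow> F x = \<bar>det (matrix (\<phi>' x))\<bar> * f (\<phi> x)"
  shows "integral\<^sup>L lborel F = integral\<^sup>L lborel f"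
proof -
  \<comment> \<open>The change of variables theorem speaks of functions with values in a space
    \<open>real^'n\<close>; a real function enters through dimension 1.\<close>
  let ?f = "\<lambda>y. vec (f y) :: real^1"
  have HK: "integral\<^sup>L lborel h = integral T h" if "integrable lborel h" "\<And>x. x \<notin> T \<Longrightarrow> h x = 0" for h :: "real^'m::_ \<Rightarrow> real" and T
  proof -
    have "(h has_integral integral\<^sup>L lborel h) UNIV" by (rule has_integral_integral_lborel[OF that(1)])
    moreover have "h = (\<lambda>x. if x \<in> T then h x else 0)" using that(2) by auto
    ultimately have "(h has_integral integral\<^sup>L lborel h) T"
      by (metis has_integral_restrict_UNIV)
    then show ?thesis by (simp add: integral_unique)
  qed
  have "integral (\<phi> ` S) ?f = integral S (\<lambda>x. \<bar>det (matrix (\<phi>' x))\<bar> *\<^sub>R ?f (\<phi> x))"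
  proof (rule integral_change_of_variables)
    show "S \<in> sets lebesgue" using S by (simp add: lmeasurable_open borel_open)
    show "(\<phi> has_derivative \<phi>' x) (at x within S)" if "x \<in> S" for x
      using \<phi>(1)[OF that] by (rule has_derivative_at_withinI)
    have "(\<lambda>x. \<bar>det (matrix (\<phi>' x))\<bar> * f (\<phi> x)) absolutely_integrable_on S"
    proof -
      have "integrable lebesgue F" using F(1) by (rule integrable_completion[THEN iffD2, rotated]) (use F(1) in auto)
      then have "F absolutely_integrable_on UNIV" by (simp add: set_integrable_def)
      then have "F absolutely_integrable_on S"
        by (rule set_integrable_subset) (use S in auto)
      then show ?thesis
        by (rule set_integrable_cong[THEN iffD1, rotated -1]) (auto simp: eq)
    qed
    then show "?f absolutely_integrable_on \<phi> ` S \<or>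
      (\<lambda>x. \<bar>det (matrix (\<phi>' x))\<bar> *\<^sub>R ?f (\<phi> x)) absolutely_integrable_on S"
      by (simp add: absolutely_integrable_on_1_iff)
  qed (rule \<phi>(2))
  then have "integral (\<phi> ` S) f = integral S (\<lambda>x. \<bar>det (matrix (\<phi>' x))\<bar> * f (\<phi> x))"
    by (simp add: integral_on_1_eq)
  also have "\<dots> = integral S F" by (rule integral_cong) (simp add: eq)
  finally show ?thesis using HK[OF f] HK[OF F] by simp
qed

section \<open>Holomorphic functions of several variables\<close>

lemma norm_smult: "norm (c *s v) = cmod c * norm v" for v :: "complex^'n"
  by (simp add: norm_vec_def L2_set_right_distrib norm_mult)

lemma continuous_on_smult_const:
  fixes v :: "complex^'n"
  assumes "continuous_on A f"
  shows "continuous_on A (\<lambda>x. f x *s v)"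
  unfolding vector_scalar_mult_def by (intro continuous_on_vec_lambda continuous_on_mult assms continuous_on_const)

lemma has_field_derivative_complex_line:
  fixes F :: "complex^'n \<Rightarrow> complex"
  assumes "(F has_derivative L) (at (x + t *s v))" and "\<And>c w. L (c *s w) = c * L w"
  shows "((\<lambda>t. F (x + t *s v)) has_field_derivative L v) (at t)"
proof -
  have "bounded_linear (\<lambda>h. h *s v)"
    by (intro linear_conv_bounded_linear[THEN iffD1]) (simp add: linear_iff vec_eq_iff algebra_simps)
  then have "((\<lambda>t. x + t *s v) has_derivative (\<lambda>h. h *s v)) (at t)"
    by (auto intro!: derivative_eq_intros bounded_linear_imp_has_derivative)
  from has_derivative_compose[OF this assms(1)]
  show ?thesis by (simp add: has_field_derivative_def assms(2) mult_commute_abs)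
qed

text \<open>The directional derivative is a Cauchy integral over a circle in the complex line, which
  may be differentiated under the integral sign.\<close>

context
  fixes F :: "complex^'n \<Rightarrow> complex" and F' S
  assumes S: "open S"
    and F: "\<And>x. x \<in> S \<Longrightarrow> (F has_derivative F' x) (at x)"
    and F'c: "\<And>x c w. x \<in> S \<Longrightarrow> F' x (c *s w) = c * F' x w"
begin

lemma holomorphic_directional_derivative_integral:
  assumes "cball x0 e \<subseteq> S" and e: "e > 0"
  obtains c :: "real \<Rightarrow> complex" where "continuous_on UNIV c" "\<And>u. c u \<noteq> 0"
    "\<And>x u. x \<in> ball x0 (e / 2) \<Longrightarrow> x + c u *s v \<in> S"
    "\<And>x. x \<in> ball x0 (e / 2) \<Longrightarrow> F' x v = integral {0..1} (\<lambda>u. F (x + c u *s v) / c u)"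
proof -
  \<comment> \<open>Circles of radius \<open>r\<close> in the direction \<open>v\<close> stay within
    distance \<open>e\<close> of \<open>x0\<close> for every centre in the ball of half the size, so
    that one circle serves a whole neighbourhood.\<close>
  define r where "r = e / (2 * (1 + norm v))"
  have nv: "1 + norm v > 0" by (simp add: add_pos_nonneg)
  have r: "r > 0" using e nv by (simp add: r_def)
  have rv: "r * norm v \<le> e / 2"
  proof -
    have "r * norm v \<le> r * (1 + norm v)" using r by simp
    also have "\<dots> = e / 2" using nv by (simp add: r_def field_simps)
    finally show ?thesis .
  qed
  \<comment> \<open>Cauchy's formula for the first derivative integrates F / t^2. On this circle dt
    = 2 pi i c(u) du, which leaves the integrand F / c(u) on the unit interval.\<close>
  define c where "c = (\<lambda>u::real. r * exp (2 * pi * \<i> * u))"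
  have in_S: "x + t *s v \<in> S" if "x \<in> ball x0 (e / 2)" "cmod t \<le> r" for x t
  proof -
    have "dist x0 (x + t *s v) \<le> dist x0 x + cmod t * norm v"
      using dist_triangle[of x0 "x + t *s v" x] by (simp add: norm_smult dist_norm)
    also have "cmod t * norm v \<le> r * norm v" using that by (intro mult_right_mono) auto
    finally show ?thesis using that rv assms(1) by (auto simp: subset_iff)
  qed
  have nc: "cmod (c u) = r" for u
    using r by (simp add: c_def norm_mult)
  show ?thesis
  proof (rule that)
    show "continuous_on UNIV c" unfolding c_def by (intro continuous_intros)
    show c0: "c u \<noteq> 0" for u using nc[of u] r by auto
    show "x + c u *s v \<in> S" if "x \<in> ball x0 (e / 2)" for x u using in_S[OF that] nc by simp
    show "F' x v = integral {0..1} (\<lambda>u. F (x + c u *s v) / c u)" if x: "x \<in> ball x0 (e / 2)" for x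
    proof -
      let ?h = "\<lambda>t. F (x + t *s v)"
      have der: "(?h has_field_derivative F' (x + t *s v) v) (at t)" if "cmod t \<le> r" for t
        using in_S[OF x that] by (intro has_field_derivative_complex_line F F'c)
      have "continuous_on (cball 0 r) ?h"
        by (intro continuous_at_imp_continuous_on ballI DERIV_isCont[OF der]) auto
      moreover have "?h holomorphic_on ball 0 r"
        unfolding holomorphic_on_def field_differentiable_def
        by (intro ballI exI, rule has_field_derivative_at_within[OF der]) simp
      ultimately have hc: "((\<lambda>u. ?h u / (u - 0) ^ Suc 1) has_contour_integral
          (2 * pi * \<i>) / fact 1 * (deriv ^^ 1) ?h 0) (circlepath 0 r)"
        by (rule Cauchy_has_contour_integral_higher_derivative_circlepath) (simp add: r)
      have deriv: "deriv ?h 0 = F' x v"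
        using der[of 0] r by (intro DERIV_imp_deriv) simp
      have "((\<lambda>u. ?h (c u) / (c u)\<^sup>2 * (2 * pi * \<i> * c u)) has_integral
          (2 * pi * \<i>) / fact 1 * (deriv ^^ 1) ?h 0) {0..1}"
      proof (rule has_integral_eq[OF _ hc[unfolded has_contour_integral_def]])
        fix u :: real assume u: "u \<in> {0..1}"
        have "vector_derivative (circlepath 0 r) (at u within {0..1}) = 2 * pi * \<i> * c u"
          using u by (simp add: vector_derivative_circlepath01 c_def mult_ac)
        moreover have "circlepath 0 r u = c u" by (simp add: circlepath c_def)
        ultimately show "?h (circlepath 0 r u) / (circlepath 0 r u - 0) ^ Suc 1
            * vector_derivative (circlepath 0 r) (at u within {0..1}) = ?h (c u) / (c u)\<^sup>2 * (2 * pi * \<i> * c u)"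
          by (simp add: power2_eq_square)
      qed
      then have "((\<lambda>u. ?h (c u) / (c u)\<^sup>2 * (2 * pi * \<i> * c u)) has_integral 2 * pi * \<i> * F' x v) {0..1}"
        by (simp add: deriv)
      from has_integral_mult_right[OF this, of "1 / (2 * pi * \<i>)"]
      have "((\<lambda>u. ?h (c u) / c u) has_integral F' x v) {0..1}"
        using c0 by (simp add: power2_eq_square)
      then show ?thesis by (simp add: integral_unique)
    qed
  qed
qed

lemma holomorphic_derivative_continuous: "continuous_on S (\<lambda>x. F' x v)"
proof -
  have "continuous (at x0) (\<lambda>x. F' x v)" if x0: "x0 \<in> S" for x0
  proof -
    obtain e where e: "e > 0" "cball x0 e \<subseteq> S" using S[unfolded open_contains_cball, rule_format, OF x0] by blast
    obtain c :: "real \<Rightarrow> complex" where c: "continuous_on UNIV c" "\<And>u. c u \<noteq> 0"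
      "\<And>x u. x \<in> ball x0 (e / 2) \<Longrightarrow> x + c u *s v \<in> S"
      "\<And>x. x \<in> ball x0 (e / 2) \<Longrightarrow> F' x v = integral {0..1} (\<lambda>u. F (x + c u *s v) / c u)"
      by (rule holomorphic_directional_derivative_integral[where v = v, OF e(2,1)]) blast
    have contF: "continuous_on S F"
      using F by (auto intro!: continuous_at_imp_continuous_on has_derivative_continuous)
    have "continuous_on (ball x0 (e / 2) \<times> cbox 0 1) (\<lambda>p. F (fst p + c (snd p) *s v) / c (snd p))"
      using c by (intro continuous_intros continuous_on_smult_const continuous_on_compose2[OF contF] continuous_on_compose2[OF c(1)]) auto
    then have "continuous_on (ball x0 (e / 2)) (\<lambda>x. integral (cbox 0 1) (\<lambda>u. F (x + c u *s v) / c u))"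
      by (intro integral_continuous_on_param) (simp add: case_prod_beta)
    then have "continuous_on (ball x0 (e / 2)) (\<lambda>x. F' x v)"
      by (rule continuous_on_eq) (simp add: c(4))
    then show ?thesis using e by (simp add: continuous_on_eq_continuous_at)
  qed
  then show ?thesis by (auto intro: continuous_at_imp_continuous_on)
qed

text \<open>Continuity of the derivative, shown before, makes the derivative of the integrand
  jointly continuous, so that the Leibniz rule applies. Complex linearity passes through the
  integral.\<close>

lemma holomorphic_derivative_has_derivative:
  assumes "x0 \<in> S"
  shows "\<exists>L. ((\<lambda>x. F' x v) has_derivative L) (at x0) \<and> (\<forall>c w. L (c *s w) = c * L w)"
proof -
  obtain e where e: "e > 0" "cball x0 e \<subseteq> S" using S[unfolded open_contains_cball, rule_format, OF assms] by blast
  obtain c :: "real \<Rightarrow> complex" where c: "continuous_on UNIV c" "\<And>u. c u \<noteq> 0"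
    "\<And>x u. x \<in> ball x0 (e / 2) \<Longrightarrow> x + c u *s v \<in> S"
    "\<And>x. x \<in> ball x0 (e / 2) \<Longrightarrow> F' x v = integral {0..1} (\<lambda>u. F (x + c u *s v) / c u)"
    by (rule holomorphic_directional_derivative_integral[where v = v, OF e(2,1)]) blast
  have contF: "continuous_on S F"
    using F by (auto intro!: continuous_at_imp_continuous_on has_derivative_continuous)
  have contp: "continuous_on (ball x0 (e / 2) \<times> cbox 0 1) (\<lambda>p. h (fst p + c (snd p) *s v) / c (snd p))"
    if "continuous_on S h" for h :: "complex^'n \<Rightarrow> complex"
    using c by (intro continuous_intros continuous_on_smult_const continuous_on_compose2[OF that] continuous_on_compose2[OF c(1)]) auto
  \<comment> \<open>The Leibniz rule asks for continuity in the operator norm; in finite dimension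
    this can be checked on basis vectors.\<close>
  define D where "D = (\<lambda>x u. Blinfun (\<lambda>w. F' (x + c u *s v) w / c u))"
  have D: "blinfun_apply (D x u) = (\<lambda>w. F' (x + c u *s v) w / c u)" if "x \<in> ball x0 (e / 2)" for x u
    unfolding D_def using has_derivative_bounded_linear[OF F[OF c(3)[OF that]]] bounded_linear_divide
    by (intro bounded_linear_Blinfun_apply) (rule bounded_linear_compose)
  have x0: "x0 \<in> ball x0 (e / 2)" using e by simp
  have pair: "continuous_on A (\<lambda>u. (x, u))" for A :: "real set" and x :: "complex^'n"
    by (intro continuous_intros)
  have contD: "continuous_on (ball x0 (e / 2) \<times> cbox 0 1) (\<lambda>(x, u). D x u)"
  proof (rule continuous_on_blinfun_componentwise)
    fix i :: "complex^'n" assume "i \<in> Basis"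
    show "continuous_on (ball x0 (e / 2) \<times> cbox 0 1) (\<lambda>p. blinfun_apply (case p of (x, u) \<Rightarrow> D x u) i)"
      using contp[OF holomorphic_derivative_continuous[of i]]
      by (rule continuous_on_eq) (auto simp: D)
  qed
  have "((\<lambda>x. integral (cbox 0 1) (\<lambda>u. F (x + c u *s v) / c u)) has_derivative
      blinfun_apply (integral (cbox 0 1) (D x0))) (at x0 within ball x0 (e / 2))"
  proof (rule leibniz_rule)
    show "((\<lambda>x. F (x + c u *s v) / c u) has_derivative blinfun_apply (D x u)) (at x within ball x0 (e / 2))"
      if "x \<in> ball x0 (e / 2)" for x u
    proof -
      have "((\<lambda>y. y + c u *s v) has_derivative (\<lambda>h. h)) (at x)"
        by (auto intro!: derivative_eq_intros)
      from has_derivative_compose[OF this, of F "F' (x + c u *s v)"] F[OF c(3)[OF that]]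
      have "((\<lambda>y. F (y + c u *s v)) has_derivative F' (x + c u *s v)) (at x)" by simp
      from bounded_linear.has_derivative[OF bounded_linear_divide this]
      show ?thesis unfolding D[OF that] by (rule has_derivative_at_withinI)
    qed
    show "(\<lambda>u. F (x + c u *s v) / c u) integrable_on cbox 0 1" if "x \<in> ball x0 (e / 2)" for x
      using continuous_on_compose2[OF contp[OF contF] pair, of x "cbox 0 1"] that
      by (intro integrable_continuous) (simp add: image_subset_iff)
  qed (use contD x0 in auto)
  then have "((\<lambda>x. F' x v) has_derivative blinfun_apply (integral (cbox 0 1) (D x0))) (at x0 within ball x0 (e / 2))"
    by (rule has_derivative_transform[rotated -1]) (use x0 c(4) in auto)
  then have "((\<lambda>x. F' x v) has_derivative blinfun_apply (integral (cbox 0 1) (D x0))) (at x0)"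
    using x0 by (simp add: at_within_open[OF _ open_ball])
  moreover have "blinfun_apply (integral (cbox 0 1) (D x0)) (a *s w) = a * blinfun_apply (integral (cbox 0 1) (D x0)) w" for a w
  proof -
    have "D x0 integrable_on cbox 0 1"
      using continuous_on_compose2[OF contD pair, of x0 "cbox 0 1"] x0
      by (intro integrable_continuous) (simp add: image_subset_iff)
    then have "blinfun_apply (integral (cbox 0 1) (D x0)) w = integral (cbox 0 1) (\<lambda>u. blinfun_apply (D x0 u) w)" for w
      by (rule blinfun_apply_integral)
    then show ?thesis
      using c(3)[OF x0] by (simp add: D[OF x0] F'c flip: integral_mult_right)
  qed
  ultimately show ?thesis by blast
qed

end

section \<open>Smooth functions\<close>

lemma frechet_derivative_eq: "(f has_derivative f') (at x) \<Longrightarrow> frechet_derivative f (at x) = f'"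
  by (rule frechet_derivative_at[symmetric])

lemma frechet_derivative_cong:
  assumes "open S" "x \<in> S" "\<And>y. y \<in> S \<Longrightarrow> f y = g y"
  shows "frechet_derivative f (at x) = frechet_derivative g (at x)"
proof -
  have "(f has_derivative L) (at x) \<longleftrightarrow> (g has_derivative L) (at x)" for L
    using has_derivative_transform_within_open[of f L x UNIV S g]
      has_derivative_transform_within_open[of g L x UNIV S f] assms by auto
  then show ?thesis unfolding frechet_derivative_def by simp
qed

text \<open>Derivatives are taken in the whole space, so agreement on \<open>S\<close> passes from
  one order to the next because \<open>S\<close> is open.\<close>

lemma Ck_on_cong:
  assumes "open S" "\<And>y. y \<in> S \<Longrightarrow> f y = g y" "Ck_on k f S"
  shows "Ck_on k g S"
  using assms(2,3)
proof (induction k arbitrary: f g)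
  case 0
  then show ?case by (simp cong: continuous_on_cong)
next
  case (Suc k)
  have "g differentiable (at x)" if "x \<in> S" for x
  proof -
    have "(f has_derivative frechet_derivative f (at x)) (at x)"
      using Suc.prems that by (simp add: frechet_derivative_works)
    then have "(g has_derivative frechet_derivative f (at x)) (at x)"
      by (rule has_derivative_transform_within_open[OF _ assms(1) that]) (rule Suc.prems(1))
    then show ?thesis by (rule differentiableI)
  qed
  moreover have "Ck_on k (\<lambda>x. frechet_derivative g (at x) v) S" for v
  proof (rule Suc.IH)
    show "Ck_on k (\<lambda>x. frechet_derivative f (at x) v) S" using Suc.prems(2) by simp
    show "frechet_derivative f (at y) v = frechet_derivative g (at y) v" if "y \<in> S" for y
      using frechet_derivative_cong[of S y f g] assms(1) that Suc.prems(1) by simp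
  qed
  ultimately show ?case by simp
qed

lemma Ck_on_add:
  assumes S: "open S" and "Ck_on k f S" "Ck_on k g S"
  shows "Ck_on k (\<lambda>x. f x + g x) S"
  using assms(2,3)
proof (induction k arbitrary: f g)
  case (Suc k)
  have "Ck_on k (\<lambda>x. frechet_derivative (\<lambda>x. f x + g x) (at x) v) S" for v
  proof (rule Ck_on_cong[OF S])
    show "Ck_on k (\<lambda>x. frechet_derivative f (at x) v + frechet_derivative g (at x) v) S"
      using Suc by simp
    show "frechet_derivative f (at x) v + frechet_derivative g (at x) v
        = frechet_derivative (\<lambda>x. f x + g x) (at x) v" if "x \<in> S" for x
      using Suc.prems that
        frechet_derivative_eq[OF has_derivative_add[OF frechet_derivative_works[THEN iffD1] frechet_derivative_works[THEN iffD1]], of f x g]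
      by simp
  qed
  then show ?case using Suc.prems by (simp add: differentiable_add)
qed (simp add: continuous_on_add)

lemma Ck_on_bounded_linear:
  assumes S: "open S" and h: "bounded_linear h" and "Ck_on k f S"
  shows "Ck_on k (\<lambda>x. h (f x)) S"
  using assms(3)
proof (induction k arbitrary: f)
  case 0
  then show ?case by (simp add: bounded_linear.continuous_on[OF h])
next
  case (Suc k)
  have der: "((\<lambda>x. h (f x)) has_derivative (\<lambda>v. h (frechet_derivative f (at x) v))) (at x)" if "x \<in> S" for x
    using Suc.prems that by (intro bounded_linear.has_derivative[OF h]) (simp add: frechet_derivative_works)
  have "Ck_on k (\<lambda>x. frechet_derivative (\<lambda>x. h (f x)) (at x) v) S" for v
  proof (rule Ck_on_cong[OF S])
    show "Ck_on k (\<lambda>x. h (frechet_derivative f (at x) v)) S" using Suc by simp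
  qed (simp add: frechet_derivative_eq[OF der])
  then show ?case using der by (auto simp: differentiable_def)
qed

lemma Ck_on_0: "Ck_on k (\<lambda>x. 0) S"
proof (induction k)
  case (Suc k)
  have "frechet_derivative (\<lambda>x. 0) (at x) = (\<lambda>_. 0)" for x :: 'a
    by (intro frechet_derivative_eq) simp
  then show ?case using Suc by simp
qed simp

lemma smooth_on_cong:
  "open S \<Longrightarrow> smooth_on f S \<Longrightarrow> (\<And>y. y \<in> S \<Longrightarrow> f y = g y) \<Longrightarrow> smooth_on g S"
  unfolding smooth_on_def using Ck_on_cong by blast

lemma smooth_on_add: "open S \<Longrightarrow> smooth_on f S \<Longrightarrow> smooth_on g S \<Longrightarrow> smooth_on (\<lambda>x. f x + g x) S"
  unfolding smooth_on_def using Ck_on_add by blast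

lemma smooth_on_bounded_linear:
  "open S \<Longrightarrow> bounded_linear h \<Longrightarrow> smooth_on f S \<Longrightarrow> smooth_on (\<lambda>x. h (f x)) S"
  unfolding smooth_on_def using Ck_on_bounded_linear by blast

lemma smooth_on_mult_const:
  fixes f :: "'v::real_normed_vector \<Rightarrow> complex"
  shows "open S \<Longrightarrow> smooth_on f S \<Longrightarrow> smooth_on (\<lambda>x. c * f x) S"
  by (rule smooth_on_bounded_linear[OF _ bounded_linear_mult_right])

lemma smooth_on_diff:
  fixes f :: "'v::real_normed_vector \<Rightarrow> complex"
  assumes "open S" "smooth_on f S" "smooth_on g S"
  shows "smooth_on (\<lambda>x. f x - g x) S"
  using smooth_on_add[OF assms(1,2) smooth_on_mult_const[OF assms(1,3), of "-1"]] by simp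

lemma smooth_on_sum:
  assumes "open S" "\<And>i. i \<in> I \<Longrightarrow> smooth_on (f i) S"
  shows "smooth_on (\<lambda>x. \<Sum>i\<in>I. f i x) S"
  using assms(2)
proof (induction I rule: infinite_finite_induct)
  case (insert i I)
  then show ?case by (simp add: smooth_on_add[OF assms(1)])
qed (simp_all add: smooth_on_def Ck_on_0)

lemma smooth_on_frechet_derivative:
  assumes "smooth_on f S"
  shows "smooth_on (\<lambda>x. frechet_derivative f (at x) v) S"
  using assms unfolding smooth_on_def by (metis Ck_on.simps(2))

lemma smooth_on_has_derivative:
  assumes "smooth_on f S" "x \<in> S"
  shows "(f has_derivative frechet_derivative f (at x)) (at x)"
  using assms unfolding smooth_on_def
  by (metis Ck_on.simps(2) frechet_derivative_works)

lemma smooth_on_continuous: "smooth_on f S \<Longrightarrow> continuous_on S f"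
  unfolding smooth_on_def by (metis Ck_on.simps(1))

section \<open>The operators \<open>d\<close>, \<open>\<partial>\<close> and \<open>dbar\<close> in a chart\<close>

text \<open>The three derivations d, \<partial> and dbar are instances with constant coefficients,
  so that the product rule, commutation and smoothness are proved once for all of them.\<close>

definition gen_d :: "complex \<Rightarrow> complex \<Rightarrow> (complex^'n::finite \<Rightarrow> complex) \<Rightarrow> complex^'n \<Rightarrow> complex^'n \<Rightarrow> complex" where
  "gen_d a b f x v = a * fun_d f x v + b * fun_d f x (\<i> *s v)"

lemma fun_d_gen: "fun_d = gen_d 1 0"
  and fun_del_gen: "fun_del = gen_d (1 / 2) (- \<i> / 2)"
  and fun_delbar_gen: "fun_delbar = gen_d (1 / 2) (\<i> / 2)"
  by (auto simp: fun_eq_iff gen_d_def fun_del_def fun_delbar_def field_simps)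

lemma fun_d_frechet: "fun_d f x = frechet_derivative f (at x)"
  by (simp add: fun_d_def fun_eq_iff)

lemma fun_d_eq: "(f has_derivative f') (at x) \<Longrightarrow> fun_d f x = f'"
  by (simp add: fun_d_def frechet_derivative_eq fun_eq_iff)

lemma gen_d_eq: "(f has_derivative f') (at x) \<Longrightarrow> gen_d a b f x v = a * f' v + b * f' (\<i> *s v)"
  by (simp add: gen_d_def fun_d_eq)

lemma gen_d_cong:
  assumes "open S" "x \<in> S" "\<And>y. y \<in> S \<Longrightarrow> f y = g y"
  shows "gen_d a b f x v = gen_d a b g x v"
  using frechet_derivative_cong[of S x f g] assms by (simp add: gen_d_def fun_d_def)

lemma gen_d_0 [simp]: "gen_d a b (\<lambda>x. 0) x v = 0"
  by (subst gen_d_eq[where f' = "\<lambda>_. 0"]) auto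

lemma linear_gen_d:
  assumes "f differentiable (at x)"
  shows "linear (gen_d a b f x)"
proof -
  obtain f' where f': "(f has_derivative f') (at x)" using assms by (auto simp: differentiable_def)
  have "linear (\<lambda>v. f' (\<i> *s v))"
    using linear_compose[OF linear_smult has_derivative_linear[OF f']] by (simp add: o_def)
  then show ?thesis
    unfolding gen_d_eq[OF f', abs_def]
    by (intro linear_compose_add linear_const_mult has_derivative_linear[OF f'])
qed

lemma gen_d_add:
  assumes "f differentiable (at x)" "g differentiable (at x)"
  shows "gen_d a b (\<lambda>x. f x + g x) x v = gen_d a b f x v + gen_d a b g x v"
proof -
  obtain f' g' where "(f has_derivative f') (at x)" "(g has_derivative g') (at x)"
    using assms by (auto simp: differentiable_def)
  then show ?thesis
    by (simp add: gen_d_eq[OF has_derivative_add] gen_d_eq algebra_simps)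
qed

lemma gen_d_mult:
  assumes "f differentiable (at x)" "g differentiable (at x)"
  shows "gen_d a b (\<lambda>x. f x * g x) x v = gen_d a b f x v * g x + f x * gen_d a b g x v"
proof -
  obtain f' g' where "(f has_derivative f') (at x)" "(g has_derivative g') (at x)"
    using assms by (auto simp: differentiable_def)
  then show ?thesis
    by (simp add: gen_d_eq[OF has_derivative_mult] gen_d_eq algebra_simps)
qed

lemma gen_d_mult_const:
  assumes "f differentiable (at x)"
  shows "gen_d a b (\<lambda>x. c * f x) x v = c * gen_d a b f x v"
proof -
  obtain f' where "(f has_derivative f') (at x)"
    using assms by (auto simp: differentiable_def)
  then show ?thesis
    by (simp add: gen_d_eq[OF has_derivative_mult_right] gen_d_eq algebra_simps)
qed

lemma gen_d_sum:
  assumes "finite I" "\<And>i. i \<in> I \<Longrightarrow> f i differentiable (at x)"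
  shows "gen_d a b (\<lambda>x. \<Sum>i\<in>I. f i x) x v = (\<Sum>i\<in>I. gen_d a b (f i) x v)"
  using assms
proof (induction I)
  case (insert i I)
  then show ?case by (simp add: gen_d_add differentiable_sum)
qed simp

lemma gen_d_asum:
  assumes "\<And>w l. (\<lambda>y. F y w l) differentiable (at x)"
  shows "gen_d a b (\<lambda>y. asum (F y) vs) x v = asum (\<lambda>w l. gen_d a b (\<lambda>y. F y w l) x v) vs"
  unfolding asum_def
  by (subst gen_d_sum) (auto intro!: sum.cong gen_d_mult_const differentiable_mult assms)

lemma smooth_on_differentiable: "smooth_on f S \<Longrightarrow> x \<in> S \<Longrightarrow> f differentiable (at x)"
  using smooth_on_has_derivative unfolding differentiable_def by blast

lemma smooth_on_gen_d:
  assumes "open S" "smooth_on f S"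
  shows "smooth_on (\<lambda>x. gen_d a b f x v) S"
  unfolding gen_d_def fun_d_def
  by (intro smooth_on_add smooth_on_mult_const smooth_on_frechet_derivative assms)

lemma fun_d_commute:
  assumes S: "open S" "x \<in> S" and f: "smooth_on f S"
  shows "fun_d (\<lambda>y. fun_d f y w) x v = fun_d (\<lambda>y. fun_d f y v) x w"
proof -
  have sm: "smooth_on (\<lambda>y. fun_d f y v) S" for v
    unfolding fun_d_def by (rule smooth_on_frechet_derivative[OF f])
  have der: "((\<lambda>y. fun_d f y v) has_derivative fun_d (\<lambda>y. fun_d f y v) y) (at y)" if "y \<in> S" for v y
    using smooth_on_has_derivative[OF sm that] by (simp add: fun_d_frechet)
  have cont: "continuous_on S (\<lambda>y. fun_d (\<lambda>y. fun_d f y v) y w)" for v w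
    unfolding fun_d_def[of "\<lambda>y. fun_d f y v"]
    by (intro smooth_on_continuous smooth_on_frechet_derivative sm)
  have "(f has_derivative fun_d f y) (at y)" if "y \<in> S" for y
    using smooth_on_has_derivative[OF f that] by (simp add: fun_d_frechet)
  from symmetric_second_derivative_complex[OF S this der der cont cont, of w v]
  show ?thesis .
qed

lemma gen_d_commute:
  assumes S: "open S" "x \<in> S" and f: "smooth_on f S"
  shows "gen_d a b (\<lambda>y. gen_d a' b' f y w) x v = gen_d a' b' (\<lambda>y. gen_d a b f y v) x w"
proof -
  have diff: "(\<lambda>y. fun_d f y v) differentiable (at x)" for v
    unfolding fun_d_def by (intro smooth_on_differentiable[OF smooth_on_frechet_derivative[OF f]] S)
  have *: "fun_d (\<lambda>y. gen_d a b f y w) x v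
      = a * fun_d (\<lambda>y. fun_d f y w) x v + b * fun_d (\<lambda>y. fun_d f y (\<i> *s w)) x v" for a b v w
    unfolding gen_d_def
    by (simp add: gen_d_add[where a = 1 and b = 0, folded fun_d_gen] differentiable_mult diff
        gen_d_mult_const[where a = 1 and b = 0, folded fun_d_gen])
  show ?thesis
    unfolding gen_d_def[of _ _ _ x] * using fun_d_commute[OF S f] by (simp add: algebra_simps)
qed

text \<open>Second derivatives commute, whereas removing two entries in the opposite order changes
  the sign. Equal coefficients give d d = 0 and \<partial> \<partial> = 0, different ones give
  \<partial> dbar = - dbar \<partial>.\<close>

lemma asum_gen_d_anticommute:
  assumes S: "open S" "x \<in> S" and sm: "\<And>l. smooth_on (\<lambda>y. \<alpha> y l) S"
  shows "asum (\<lambda>v l. gen_d a b (\<lambda>y. asum (\<lambda>w m. gen_d a' b' (\<lambda>z. \<alpha> z m) y w) l) x v) vs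
    = - asum (\<lambda>v l. gen_d a' b' (\<lambda>y. asum (\<lambda>w m. gen_d a b (\<lambda>z. \<alpha> z m) y w) l) x v) vs"
proof -
  have *: "asum (\<lambda>v l. gen_d a b (\<lambda>y. asum (\<lambda>w m. gen_d a' b' (\<lambda>z. \<alpha> z m) y w) l) x v) vs
      = asum2 (\<lambda>v w m. gen_d a b (\<lambda>y. gen_d a' b' (\<lambda>z. \<alpha> z m) y w) x v) vs" for a b a' b'
    unfolding asum2_def
    by (rule asum_cong) (intro gen_d_asum smooth_on_differentiable[OF smooth_on_gen_d[OF S(1) sm] S(2)])
  show ?thesis
    unfolding * by (subst asum2_swap) (simp only: gen_d_commute[OF S sm])
qed

lemma asum2_add: "asum2 (\<lambda>v w m. F v w m + G v w m) vs = asum2 F vs + asum2 G vs"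
proof -
  have "(\<lambda>v. asum (\<lambda>w m. F v w m + G v w m)) = (\<lambda>v l. asum (F v) l + asum (G v) l)"
    by (simp add: fun_eq_iff asum_add)
  then show ?thesis by (simp add: asum2_def asum_add)
qed

text \<open>The product rule with d\<theta> = 0, which is what \<open>closed\<close> says at
  \<open>x\<close>; the sign comes from moving d past the covector.\<close>

lemma asum_fun_d_covector_wedge:
  assumes \<theta>: "\<And>w. (\<lambda>y. \<theta> y w) differentiable (at x)" and \<gamma>: "\<And>l. (\<lambda>y. \<gamma> y l) differentiable (at x)"
    and closed: "\<And>v w. fun_d (\<lambda>y. \<theta> y w) x v = fun_d (\<lambda>y. \<theta> y v) x w"
  shows "asum (\<lambda>v l. fun_d (\<lambda>y. covector_wedge (\<theta> y) (\<gamma> y) l) x v) vs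
    = - covector_wedge (\<theta> x) (asum (\<lambda>v l. fun_d (\<lambda>y. \<gamma> y l) x v)) vs"
proof -
  have "asum (\<lambda>v l. fun_d (\<lambda>y. covector_wedge (\<theta> y) (\<gamma> y) l) x v) vs
      = asum2 (\<lambda>v w m. fun_d (\<lambda>y. \<theta> y w) x v * \<gamma> x m + \<theta> x w * fun_d (\<lambda>y. \<gamma> y m) x v) vs"
    unfolding asum2_def covector_wedge_def fun_d_gen
    by (rule asum_cong, subst gen_d_asum) (intro differentiable_mult \<theta> \<gamma>, simp only: gen_d_mult[OF \<theta> \<gamma>])
  also have "\<dots> = asum2 (\<lambda>v w m. fun_d (\<lambda>y. \<theta> y w) x v * \<gamma> x m) vs
      + asum2 (\<lambda>v w m. \<theta> x w * fun_d (\<lambda>y. \<gamma> y m) x v) vs"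
    by (rule asum2_add)
  also have "asum2 (\<lambda>v w m. fun_d (\<lambda>y. \<theta> y w) x v * \<gamma> x m) vs = 0"
    by (rule asum2_sym_eq_0) (simp add: closed)
  also have "asum2 (\<lambda>v w m. \<theta> x w * fun_d (\<lambda>y. \<gamma> y m) x v) vs
      = - asum2 (\<lambda>v w m. \<theta> x v * fun_d (\<lambda>y. \<gamma> y m) x w) vs"
    by (rule asum2_swap)
  also have "asum2 (\<lambda>v w m. \<theta> x v * fun_d (\<lambda>y. \<gamma> y m) x w)
      = covector_wedge (\<theta> x) (asum (\<lambda>v l. fun_d (\<lambda>y. \<gamma> y l) x v))"
    unfolding asum2_def covector_wedge_def by (rule arg_cong[of _ _ asum]) (simp add: fun_eq_iff asum_mult)
  finally show ?thesis by simp
qed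

lemma asum_fun_d_scale:
  assumes \<rho>: "\<rho> differentiable (at x)" and \<gamma>: "\<And>l. (\<lambda>y. \<gamma> y l) differentiable (at x)"
  shows "asum (\<lambda>v l. fun_d (\<lambda>y. \<rho> y * \<gamma> y l) x v) vs
    = covector_wedge (fun_d \<rho> x) (\<gamma> x) vs + \<rho> x * asum (\<lambda>v l. fun_d (\<lambda>y. \<gamma> y l) x v) vs"
  unfolding covector_wedge_def fun_d_gen gen_d_mult[OF \<rho> \<gamma>] by (simp add: asum_add asum_mult)

section \<open>Forms in charts\<close>

text \<open>The conditions of \<^const>\<open>dforms\<close> other than the compatibility of the charts.\<close>

definition chart_forms :: "('a, 'n::finite) chart set \<Rightarrow> nat \<Rightarrow> ('a, 'n) dform set" where
  "chart_forms A k = {\<alpha>.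
     (\<forall>c x. \<not> (c \<in> A \<and> x \<in> chart_image c) \<longrightarrow> \<alpha> c x = 0) \<and>
     (\<forall>c\<in>A. \<forall>x\<in>chart_image c. alternating k (\<alpha> c x)) \<and>
     (\<forall>c\<in>A. \<forall>vs. smooth_on (\<lambda>x. \<alpha> c x vs) (chart_image c))}"

definition compatible :: "('a, 'n::finite) chart set \<Rightarrow> ('a, 'n) dform \<Rightarrow> bool" where
  "compatible A \<alpha> \<longleftrightarrow> (\<forall>c\<in>A. \<forall>c'\<in>A. \<forall>p\<in>fst c \<inter> fst c'. \<forall>vs.
     \<alpha> c (snd c p) vs =
     \<alpha> c' (snd c' p) (map (frechet_derivative (transition c c') (at (snd c p))) vs))"

lemma dforms_eq: "dforms A k = {\<alpha> \<in> chart_forms A k. compatible A \<alpha>}"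
  by (auto simp: dforms_def chart_forms_def compatible_def)

lemma chart_formsD:
  assumes "\<alpha> \<in> chart_forms A k"
  shows chart_forms_0: "\<not> (c \<in> A \<and> x \<in> chart_image c) \<Longrightarrow> \<alpha> c x = 0"
    and chart_forms_alternating: "c \<in> A \<Longrightarrow> x \<in> chart_image c \<Longrightarrow> alternating k (\<alpha> c x)"
    and chart_forms_smooth: "c \<in> A \<Longrightarrow> smooth_on (\<lambda>x. \<alpha> c x vs) (chart_image c)"
  using assms unfolding chart_forms_def by blast+

lemma ext_op_apply:
  "c \<in> A \<Longrightarrow> x \<in> chart_image c \<Longrightarrow> ext_op D A \<alpha> c x vs = asum (\<lambda>v l. D (\<lambda>y. \<alpha> c y l) x v) vs"
  by (simp add: ext_op_def asum_def remove_nth_def mult.assoc)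

lemma ext_op_outside: "\<not> (c \<in> A \<and> x \<in> chart_image c) \<Longrightarrow> ext_op D A \<alpha> c x = 0"
  by (auto simp: ext_op_def fun_eq_iff)

lemma dform_eqI:
  assumes "\<And>c x vs. c \<in> A \<Longrightarrow> x \<in> chart_image c \<Longrightarrow> \<alpha> c x vs = \<beta> c x vs"
    and "\<And>c x. \<not> (c \<in> A \<and> x \<in> chart_image c) \<Longrightarrow> \<alpha> c x = 0"
    and "\<And>c x. \<not> (c \<in> A \<and> x \<in> chart_image c) \<Longrightarrow> \<beta> c x = 0"
  shows "\<alpha> = \<beta>"
proof (intro ext)
  show "\<alpha> c x vs = \<beta> c x vs" for c x vs
    using assms by (cases "c \<in> A \<and> x \<in> chart_image c") auto
qed

locale open_charts =
  fixes A :: "('a::{t2_space, second_countable_topology}, 'n::finite) chart set"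
  assumes open_chart_image: "c \<in> A \<Longrightarrow> open (chart_image c)"
begin

lemma chart_forms_differentiable:
  "\<alpha> \<in> chart_forms A k \<Longrightarrow> c \<in> A \<Longrightarrow> x \<in> chart_image c \<Longrightarrow> (\<lambda>y. \<alpha> c y vs) differentiable (at x)"
  by (rule smooth_on_differentiable[OF chart_forms_smooth])

text \<open>Only conditions inside one chart are at stake, so all operators are treated together.
  Multilinearity and alternation are identities between coefficients on an open set and are
  therefore inherited by their derivatives.\<close>

lemma ext_op_chart_forms:
  assumes \<alpha>: "\<alpha> \<in> chart_forms A k"
  shows "ext_op (gen_d a b) A \<alpha> \<in> chart_forms A (Suc k)"
  unfolding chart_forms_def
proof (intro CollectI conjI allI ballI impI)
  show "ext_op (gen_d a b) A \<alpha> c x = 0" if "\<not> (c \<in> A \<and> x \<in> chart_image c)" for c x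
    by (rule ext_op_outside[OF that])
next
  fix c x assume c: "c \<in> A" and x: "x \<in> chart_image c"
  note S = open_chart_image[OF c] x
  note diff = chart_forms_differentiable[OF \<alpha> c x]
  have "alternating k (\<lambda>l. gen_d a b (\<lambda>y. \<alpha> c y l) x v)" for v
  proof (rule alternatingI)
    fix vs :: "(complex^'n) list" assume "length vs \<noteq> k"
    then have "gen_d a b (\<lambda>y. \<alpha> c y vs) x v = gen_d a b (\<lambda>y. 0) x v"
      using alternating_length[OF chart_forms_alternating[OF \<alpha> c]] by (intro gen_d_cong[OF S])
    then show "gen_d a b (\<lambda>y. \<alpha> c y vs) x v = 0" by simp
  next
    fix xs ys :: "(complex^'n) list" assume len: "length xs + Suc (length ys) = k"
    have lin: "linear (\<lambda>w. \<alpha> c y (xs @ w # ys))" if "y \<in> chart_image c" for y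
      by (rule alternating_linear[OF chart_forms_alternating[OF \<alpha> c that] len])
    show "linear (\<lambda>w. gen_d a b (\<lambda>y. \<alpha> c y (xs @ w # ys)) x v)"
    proof (rule linearI)
      fix w1 w2
      have "gen_d a b (\<lambda>y. \<alpha> c y (xs @ (w1 + w2) # ys)) x v
          = gen_d a b (\<lambda>y. \<alpha> c y (xs @ w1 # ys) + \<alpha> c y (xs @ w2 # ys)) x v"
        by (intro gen_d_cong[OF S] linear_add[OF lin])
      then show "gen_d a b (\<lambda>y. \<alpha> c y (xs @ (w1 + w2) # ys)) x v
          = gen_d a b (\<lambda>y. \<alpha> c y (xs @ w1 # ys)) x v + gen_d a b (\<lambda>y. \<alpha> c y (xs @ w2 # ys)) x v"
        by (simp add: gen_d_add diff)
    next
      fix r w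
      have "gen_d a b (\<lambda>y. \<alpha> c y (xs @ (r *\<^sub>R w) # ys)) x v
          = gen_d a b (\<lambda>y. of_real r * \<alpha> c y (xs @ w # ys)) x v"
        by (intro gen_d_cong[OF S]) (simp add: linear_scale[OF lin] scaleR_conv_of_real[where 'a = complex])
      then show "gen_d a b (\<lambda>y. \<alpha> c y (xs @ (r *\<^sub>R w) # ys)) x v
          = r *\<^sub>R gen_d a b (\<lambda>y. \<alpha> c y (xs @ w # ys)) x v"
        by (simp add: gen_d_mult_const diff scaleR_conv_of_real[where 'a = complex])
    qed
  next
    fix xs u ms ys
    have "\<alpha> c y (xs @ u # ms @ u # ys) = 0" if "y \<in> chart_image c" for y
      by (rule alternating_eq[OF chart_forms_alternating[OF \<alpha> c that], of "length xs" "length xs + Suc (length ms)"])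
        (simp_all add: nth_append)
    then have "gen_d a b (\<lambda>y. \<alpha> c y (xs @ u # ms @ u # ys)) x v = gen_d a b (\<lambda>y. 0) x v"
      by (intro gen_d_cong[OF S])
    then show "gen_d a b (\<lambda>y. \<alpha> c y (xs @ u # ms @ u # ys)) x v = 0" by simp
  qed
  then have "alternating (Suc k) (asum (\<lambda>v l. gen_d a b (\<lambda>y. \<alpha> c y l) x v))"
    using linear_gen_d[OF diff] by (intro alternating_asum) auto
  moreover have "ext_op (gen_d a b) A \<alpha> c x = asum (\<lambda>v l. gen_d a b (\<lambda>y. \<alpha> c y l) x v)"
    using c x by (simp add: fun_eq_iff ext_op_apply)
  ultimately show "alternating (Suc k) (ext_op (gen_d a b) A \<alpha> c x)" by simp
next
  fix c vs assume c: "c \<in> A"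
  have "smooth_on (\<lambda>x. \<Sum>i<length vs. (- 1) ^ i * gen_d a b (\<lambda>y. \<alpha> c y (remove_nth i vs)) x (vs ! i)) (chart_image c)"
    by (intro smooth_on_sum smooth_on_mult_const smooth_on_gen_d chart_forms_smooth[OF \<alpha>] open_chart_image c)
  then show "smooth_on (\<lambda>x. ext_op (gen_d a b) A \<alpha> c x vs) (chart_image c)"
    by (rule smooth_on_cong[OF open_chart_image[OF c]]) (simp add: ext_op_apply[OF c] asum_def)
qed

lemma ext_op_anticommute:
  assumes \<alpha>: "\<alpha> \<in> chart_forms A k"
  shows "ext_op (gen_d a b) A (ext_op (gen_d a' b') A \<alpha>) = - ext_op (gen_d a' b') A (ext_op (gen_d a b) A \<alpha>)"
proof (rule dform_eqI)
  fix c x vs assume c: "c \<in> A" and x: "x \<in> chart_image c"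
  note S = open_chart_image[OF c] x
  have *: "ext_op (gen_d a b) A (ext_op (gen_d a' b') A \<alpha>) c x vs
      = asum (\<lambda>v l. gen_d a b (\<lambda>y. asum (\<lambda>w m. gen_d a' b' (\<lambda>z. \<alpha> c z m) y w) l) x v) vs" for a b a' b'
  proof -
    have "gen_d a b (\<lambda>y. ext_op (gen_d a' b') A \<alpha> c y l) x v
        = gen_d a b (\<lambda>y. asum (\<lambda>w m. gen_d a' b' (\<lambda>z. \<alpha> c z m) y w) l) x v" for v l
      by (rule gen_d_cong[OF S], rule ext_op_apply[OF c])
    then show ?thesis by (simp only: ext_op_apply[OF c x])
  qed
  show "ext_op (gen_d a b) A (ext_op (gen_d a' b') A \<alpha>) c x vs
      = (- ext_op (gen_d a' b') A (ext_op (gen_d a b) A \<alpha>)) c x vs"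
    unfolding fun_Compl_def * by (rule asum_gen_d_anticommute[OF S chart_forms_smooth[OF \<alpha> c]])
qed (auto simp: ext_op_outside)

lemma ext_op_square:
  assumes "\<alpha> \<in> chart_forms A k"
  shows "ext_op (gen_d a b) A (ext_op (gen_d a b) A \<alpha>) = 0"
proof (intro ext)
  fix c x vs
  let ?X = "ext_op (gen_d a b) A (ext_op (gen_d a b) A \<alpha>)"
  have "?X = - ?X" by (rule ext_op_anticommute[OF assms])
  then have "?X c x vs = - ?X c x vs" unfolding fun_Compl_def by (rule fun_cong[OF fun_cong[OF fun_cong]])
  then show "?X c x vs = 0 c x vs" by (simp only: eq_neg_iff_add_eq_0) simp
qed

lemma ext_op_add:
  assumes \<alpha>: "\<alpha> \<in> chart_forms A k" and \<beta>: "\<beta> \<in> chart_forms A k"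
  shows "ext_op (gen_d a b) A (\<alpha> + \<beta>) = ext_op (gen_d a b) A \<alpha> + ext_op (gen_d a b) A \<beta>"
proof (rule dform_eqI)
  fix c x vs assume c: "c \<in> A" and x: "x \<in> chart_image c"
  show "ext_op (gen_d a b) A (\<alpha> + \<beta>) c x vs = (ext_op (gen_d a b) A \<alpha> + ext_op (gen_d a b) A \<beta>) c x vs"
    using chart_forms_differentiable[OF \<alpha> c x] chart_forms_differentiable[OF \<beta> c x]
    by (simp add: ext_op_apply[OF c x] gen_d_add asum_add)
qed (auto simp: ext_op_outside)

lemma ext_op_uminus:
  assumes \<alpha>: "\<alpha> \<in> chart_forms A k"
  shows "ext_op (gen_d a b) A (- \<alpha>) = - ext_op (gen_d a b) A \<alpha>"
proof (rule dform_eqI)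
  fix c x vs assume c: "c \<in> A" and x: "x \<in> chart_image c"
  show "ext_op (gen_d a b) A (- \<alpha>) c x vs = (- ext_op (gen_d a b) A \<alpha>) c x vs"
    using gen_d_mult_const[OF chart_forms_differentiable[OF \<alpha> c x], of a b "-1"]
    by (simp add: ext_op_apply[OF c x] asum_neg)
qed (auto simp: ext_op_outside)

lemma ext_d_eq: "ext_d A \<alpha> = del A \<alpha> + delbar A \<alpha>"
proof (rule dform_eqI)
  fix c x vs assume c: "c \<in> A" and x: "x \<in> chart_image c"
  have "fun_d f x v = fun_del f x v + fun_delbar f x v" for f and x :: "complex^'n" and v
    by (simp add: fun_del_def fun_delbar_def field_simps)
  then show "ext_d A \<alpha> c x vs = (del A \<alpha> + delbar A \<alpha>) c x vs"
    by (simp add: ext_d_def del_def delbar_def ext_op_apply[OF c x] asum_add)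
qed (auto simp: ext_d_def del_def delbar_def ext_op_outside)

lemma chart_forms_add:
  assumes \<alpha>: "\<alpha> \<in> chart_forms A k" and \<beta>: "\<beta> \<in> chart_forms A k"
  shows "\<alpha> + \<beta> \<in> chart_forms A k"
  unfolding chart_forms_def
proof (intro CollectI conjI allI ballI impI)
  show "(\<alpha> + \<beta>) c x = 0" if "\<not> (c \<in> A \<and> x \<in> chart_image c)" for c x
    using chart_forms_0[OF \<alpha> that] chart_forms_0[OF \<beta> that] by simp
next
  fix c x assume c: "c \<in> A" and x: "x \<in> chart_image c"
  show "alternating k ((\<alpha> + \<beta>) c x)"
    using chart_forms_alternating[OF \<alpha> c x] chart_forms_alternating[OF \<beta> c x]
    unfolding alternating_def by (auto intro!: linear_compose_add)
next
  fix c vs assume c: "c \<in> A"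
  show "smooth_on (\<lambda>x. (\<alpha> + \<beta>) c x vs) (chart_image c)"
    using smooth_on_add[OF open_chart_image[OF c] chart_forms_smooth[OF \<alpha> c] chart_forms_smooth[OF \<beta> c]]
    by simp
qed

lemma chart_forms_uminus:
  assumes \<alpha>: "\<alpha> \<in> chart_forms A k"
  shows "- \<alpha> \<in> chart_forms A k"
  unfolding chart_forms_def
proof (intro CollectI conjI allI ballI impI)
  show "(- \<alpha>) c x = 0" if "\<not> (c \<in> A \<and> x \<in> chart_image c)" for c x
    using chart_forms_0[OF \<alpha> that] by (simp add: fun_eq_iff)
next
  fix c x assume c: "c \<in> A" and x: "x \<in> chart_image c"
  show "alternating k ((- \<alpha>) c x)"
    using chart_forms_alternating[OF \<alpha> c x]
    unfolding alternating_def by (auto intro!: linear_compose_neg)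
next
  fix c vs assume c: "c \<in> A"
  show "smooth_on (\<lambda>x. (- \<alpha>) c x vs) (chart_image c)"
    using smooth_on_mult_const[OF open_chart_image[OF c] chart_forms_smooth[OF \<alpha> c], of "-1"]
    by simp
qed

lemma zero_chart_forms: "0 \<in> chart_forms A k"
  by (auto simp: chart_forms_def alternating_def smooth_on_def Ck_on_0 zero_fun_def
      intro!: module_hom_zero Ck_on_0)

lemma compatibleD:
  assumes "compatible A \<alpha>" "c \<in> A" "c' \<in> A" "p \<in> fst c" "p \<in> fst c'"
  shows "\<alpha> c (snd c p) vs =
     \<alpha> c' (snd c' p) (map (frechet_derivative (transition c c') (at (snd c p))) vs)"
  using assms unfolding compatible_def by blast

lemma compatible_add: "compatible A \<alpha> \<Longrightarrow> compatible A \<beta> \<Longrightarrow> compatible A (\<alpha> + \<beta>)"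
  unfolding compatible_def[of _ "_ + _"] plus_fun_apply
  by (intro ballI allI arg_cong2[where f = "(+)"] compatibleD) auto

lemma compatible_uminus: "compatible A \<alpha> \<Longrightarrow> compatible A (- \<alpha>)"
  unfolding compatible_def[of _ "- _"] unfolding fun_Compl_def
  by (intro ballI allI arg_cong[where f = uminus] compatibleD) auto

lemma dforms_add: "\<alpha> \<in> dforms A k \<Longrightarrow> \<beta> \<in> dforms A k \<Longrightarrow> \<alpha> + \<beta> \<in> dforms A k"
  and dforms_uminus: "\<alpha> \<in> dforms A k \<Longrightarrow> - \<alpha> \<in> dforms A k"
  by (simp_all add: dforms_eq compatible_add compatible_uminus chart_forms_add chart_forms_uminus)

lemma zero_dforms: "0 \<in> dforms A k"
  by (simp add: dforms_eq zero_chart_forms compatible_def)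

end

section \<open>The type of a form\<close>

lemma nths_eq_Nil: "(\<And>j. j < length xs \<Longrightarrow> j \<notin> B) \<Longrightarrow> nths xs B = []"
  using length_nths[of xs B] by (metis (no_types, lifting) Collect_empty_eq card.empty length_0_conv)

lemma nths_singleton_position:
  assumes "i < length vs"
  shows "nths vs {i} = [vs ! i]" "nths vs (- {i}) = remove_nth i vs"
proof -
  have vs: "vs = take i vs @ vs ! i # drop (Suc i) vs"
    using assms by (rule id_take_nth_drop)
  have "nths (take i vs) {i} = []" "nths (drop (Suc i) vs) {j. Suc j + i \<in> {i}} = []"
    by (auto intro!: nths_eq_Nil)
  then show "nths vs {i} = [vs ! i]"
    using assms by (subst vs) (simp add: nths_append nths_Cons min_def)
  have "nths (take i vs) (- {i}) = take i vs" "nths (drop (Suc i) vs) {j. Suc j + i \<in> - {i}} = drop (Suc i) vs"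
    by (auto intro!: nths_all)
  then show "nths vs (- {i}) = remove_nth i vs"
    using assms by (subst vs) (simp add: nths_append nths_Cons min_def remove_nth_def)
qed

text \<open>Only one-element sets of positions hand \<theta> a list of length 1, and the inversions
  of the shuffle for \<open>{i}\<close> are the \<open>i\<close> entries before it.\<close>

lemma alt_wedge_alt_covector: "alt_wedge (alt_covector \<theta>) \<beta> = covector_wedge \<theta> \<beta>"
proof
  fix vs :: "'a list"
  let ?n = "length vs"
  let ?T = "\<lambda>S. (- 1) ^ card {(i, j). i \<in> S \<and> j \<in> {..<?n} - S \<and> j < i}
        * alt_covector \<theta> (nths vs S) * \<beta> (nths vs (- S))"
  have "?T S = 0" if S: "S \<in> Pow {..<?n} - (\<lambda>i. {i}) ` {..<?n}" for S
  proof -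
    have "length (nths vs S) = card S"
      unfolding length_nths using S by (auto intro!: arg_cong[of _ _ card])
    moreover have "card S \<noteq> 1"
      using S by (auto simp: card_1_singleton_iff)
    ultimately show ?thesis by (simp add: alt_covector_def)
  qed
  then have "alt_wedge (alt_covector \<theta>) \<beta> vs = (\<Sum>S\<in>(\<lambda>i. {i}) ` {..<?n}. ?T S)"
    unfolding alt_wedge_def by (intro sum.mono_neutral_right) auto
  also have "\<dots> = (\<Sum>i<?n. ?T {i})"
    by (subst sum.reindex) (auto simp: inj_on_def)
  also have "\<dots> = (\<Sum>i<?n. (- 1) ^ i * (\<theta> (vs ! i) * \<beta> (remove_nth i vs)))"
  proof (rule sum.cong)
    fix i assume "i \<in> {..<?n}"
    then have i: "i < ?n" by simp
    have "{(k, j). k \<in> {i} \<and> j \<in> {..<?n} - {i} \<and> j < k} = {i} \<times> {..<i}"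
      using i by auto
    then have "card {(k, j). k \<in> {i} \<and> j \<in> {..<?n} - {i} \<and> j < k} = i"
      by (simp add: card_cartesian_product)
    then show "?T {i} = (- 1) ^ i * (\<theta> (vs ! i) * \<beta> (remove_nth i vs))"
      unfolding nths_singleton_position[OF i] by (simp add: alt_covector_def)
  qed simp
  finally show "alt_wedge (alt_covector \<theta>) \<beta> vs = covector_wedge \<theta> \<beta> vs"
    by (simp add: covector_wedge_def asum_def)
qed

lemma alternating_alt_one: "alternating 0 alt_one"
  by (auto simp: alternating_def alt_one_def)

lemma linear_cnj_component: "linear (\<lambda>v::complex^'n. cnj (v $ j))" and linear_component: "linear (\<lambda>v::complex^'n. v $ j)"
  by (simp_all add: linear_iff)

lemma dz_dzbar_10: "dz_dzbar [i] [] = covector_wedge (\<lambda>v. v $ i) alt_one"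
  and dz_dzbar_01: "dz_dzbar [] [j] = covector_wedge (\<lambda>v. cnj (v $ j)) alt_one"
  and dz_dzbar_11: "dz_dzbar [i] [j] = covector_wedge (\<lambda>v. v $ i) (covector_wedge (\<lambda>v. cnj (v $ j)) alt_one)"
  by (simp_all add: dz_dzbar_def dz_def dzbar_def alt_wedge_alt_covector)

lemma covector_wedge_alt_one: "covector_wedge \<theta> alt_one [v] = \<theta> v"
  by (simp add: covector_wedge_def asum_Cons alt_one_def)

lemma covector_wedge_2:
  "covector_wedge \<theta> (covector_wedge \<eta> alt_one) [v, w] = \<theta> v * \<eta> w - \<theta> w * \<eta> v"
  by (simp add: covector_wedge_def asum_Cons alt_one_def)

lemma sum_lists_length_1:
  "(\<Sum>I\<in>{I :: 'n::finite list. length I = Suc 0}. f I) = (\<Sum>i\<in>UNIV. f [i])"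
proof -
  have "{I :: 'n list. length I = Suc 0} = (\<lambda>i. [i]) ` UNIV"
    by (auto simp: length_Suc_conv)
  then show ?thesis by (simp add: sum.reindex inj_on_def)
qed

lemma alternating_1_eqI:
  assumes "alternating 1 \<alpha>" "alternating 1 \<beta>" "\<And>v. \<alpha> [v] = \<beta> [v]"
  shows "\<alpha> vs = \<beta> vs"
proof (cases "length vs = 1")
  case True
  then obtain v where "vs = [v]" by (auto simp: length_Suc_conv)
  then show ?thesis by (simp add: assms(3))
qed (simp add: alternating_length[OF assms(1)] alternating_length[OF assms(2)])

lemma alternating_2_eqI:
  assumes "alternating 2 \<alpha>" "alternating 2 \<beta>" "\<And>v w. \<alpha> [v, w] = \<beta> [v, w]"
  shows "\<alpha> vs = \<beta> vs"
proof (cases "length vs = 2")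
  case True
  then obtain v w where "vs = [v, w]" by (auto simp: length_Suc_conv numeral_2_eq_2)
  then show ?thesis by (simp add: assms(3))
qed (simp add: alternating_length[OF assms(1)] alternating_length[OF assms(2)])

lemma alternating_sum_mult:
  assumes "\<And>i. i \<in> I \<Longrightarrow> alternating k (F i)"
  shows "alternating k (\<lambda>vs. \<Sum>i\<in>I. a i * F i vs)"
proof (rule alternatingI)
  show "(\<Sum>i\<in>I. a i * F i vs) = 0" if "length vs \<noteq> k" for vs
    using alternating_length[OF assms that] by (simp add: sum.neutral)
  show "linear (\<lambda>w. \<Sum>i\<in>I. a i * F i (xs @ w # ys))" if "length xs + Suc (length ys) = k" for xs ys
    by (intro linear_compose_sum ballI linear_const_mult alternating_linear[OF assms that])
  fix xs v ms ys
  have "F i (xs @ v # ms @ v # ys) = 0" if "i \<in> I" for i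
    by (rule alternating_eq[OF assms[OF that], of "length xs" "length xs + Suc (length ms)"])
      (simp_all add: nth_append)
  then show "(\<Sum>i\<in>I. a i * F i (xs @ v # ms @ v # ys)) = 0" by (simp add: sum.neutral)
qed

lemma i_times_i_smult: "\<i> *s (\<i> *s v) = - v" for v :: "complex^'n"
  by (simp add: vec_eq_iff)

lemma smult_decompose: "c *s v = Re c *\<^sub>R v + Im c *\<^sub>R (\<i> *s v)" for v :: "complex^'n"
  unfolding vec_eq_iff vector_add_component vector_scaleR_component vector_smult_component
  by (simp add: complex_eq_iff)

lemma linear_i_scale:
  fixes \<theta> :: "complex^'n \<Rightarrow> complex"
  assumes "linear \<theta>" "\<And>v. \<theta> (\<i> *s v) = t * \<theta> v"
  shows "t = \<i> \<Longrightarrow> \<theta> (c *s v) = c * \<theta> v" and "t = - \<i> \<Longrightarrow> \<theta> (c *s v) = cnj c * \<theta> v"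
proof -
  have "\<theta> (c *s v) = (Re c + Im c * t) * \<theta> v"
    by (subst smult_decompose)
      (simp add: linear_add[OF assms(1)] linear_scale[OF assms(1)] assms(2) scaleR_conv_of_real[where 'a = complex] algebra_simps)
  then show "t = \<i> \<Longrightarrow> \<theta> (c *s v) = c * \<theta> v" "t = - \<i> \<Longrightarrow> \<theta> (c *s v) = cnj c * \<theta> v"
    by (simp_all add: complex_eq_iff algebra_simps)
qed

lemma linear_basis_expansion:
  fixes \<theta> :: "complex^'n::finite \<Rightarrow> complex"
  assumes "linear \<theta>"
  shows "\<theta> v = (\<Sum>i\<in>UNIV. \<theta> (v $ i *s axis i 1))"
  by (subst basis_expansion[of v, symmetric]) (rule linear_sum[OF assms])

text \<open>In degree 1 the type is an eigenvalue condition for multiplication by i, and it is used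
  in this shape from here on. The coefficients of a complex-linear functional are its values on the
  axes.\<close>

lemma alt_type_10_iff:
  fixes \<beta> :: "(complex^'n::finite) altform"
  assumes \<beta>: "alternating 1 \<beta>"
  shows "alt_type 1 0 \<beta> \<longleftrightarrow> (\<forall>v. \<beta> [\<i> *s v] = \<i> * \<beta> [v])"
proof
  assume "alt_type 1 0 \<beta>"
  then obtain a where "\<And>vs. \<beta> vs = (\<Sum>i\<in>UNIV. a [i] [] * dz_dzbar [i] [] vs)"
    by (auto simp: alt_type_def sum_lists_length_1)
  then show "\<forall>v. \<beta> [\<i> *s v] = \<i> * \<beta> [v]"
    by (simp add: dz_dzbar_10 covector_wedge_alt_one sum_distrib_left mult_ac)
next
  assume i: "\<forall>v. \<beta> [\<i> *s v] = \<i> * \<beta> [v]"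
  have lin: "linear (\<lambda>v. \<beta> [v])" using alternating_linear[OF \<beta>, of "[]" "[]"] by simp
  have eq: "\<beta> vs = (\<Sum>i\<in>UNIV. \<beta> [axis i 1] * dz_dzbar [i] [] vs)" for vs
  proof (rule alternating_1_eqI[OF \<beta>, of "\<lambda>vs. \<Sum>i\<in>UNIV. \<beta> [axis i 1] * dz_dzbar [i] [] vs"])
    show "alternating 1 (\<lambda>vs. \<Sum>i\<in>UNIV. \<beta> [axis i 1] * dz_dzbar [i] [] vs)"
      using alternating_covector_wedge[OF linear_component alternating_alt_one]
      by (intro alternating_sum_mult) (simp add: dz_dzbar_10)
    show "\<beta> [v] = (\<Sum>i\<in>UNIV. \<beta> [axis i 1] * dz_dzbar [i] [] [v])" for v
      unfolding linear_basis_expansion[OF lin, of v] linear_i_scale(1)[OF lin i[rule_format] refl]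
      by (simp add: dz_dzbar_10 covector_wedge_alt_one mult.commute)
  qed
  show "alt_type 1 0 \<beta>"
    unfolding alt_type_def
    by (intro exI[of _ "\<lambda>I J. \<beta> [axis (hd I) 1]"] allI, rule trans[OF eq]) (simp add: sum_lists_length_1)
qed

lemma alt_type_01_iff:
  fixes \<beta> :: "(complex^'n::finite) altform"
  assumes \<beta>: "alternating 1 \<beta>"
  shows "alt_type 0 1 \<beta> \<longleftrightarrow> (\<forall>v. \<beta> [\<i> *s v] = - \<i> * \<beta> [v])"
proof
  assume "alt_type 0 1 \<beta>"
  then obtain a where "\<And>vs. \<beta> vs = (\<Sum>i\<in>UNIV. a [] [i] * dz_dzbar [] [i] vs)"
    by (auto simp: alt_type_def sum_lists_length_1)
  then show "\<forall>v. \<beta> [\<i> *s v] = - \<i> * \<beta> [v]"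
    by (simp add: dz_dzbar_01 covector_wedge_alt_one sum_distrib_left mult_ac sum_negf)
next
  assume i: "\<forall>v. \<beta> [\<i> *s v] = - \<i> * \<beta> [v]"
  have lin: "linear (\<lambda>v. \<beta> [v])" using alternating_linear[OF \<beta>, of "[]" "[]"] by simp
  have eq: "\<beta> vs = (\<Sum>i\<in>UNIV. \<beta> [axis i 1] * dz_dzbar [] [i] vs)" for vs
  proof (rule alternating_1_eqI[OF \<beta>, of "\<lambda>vs. \<Sum>i\<in>UNIV. \<beta> [axis i 1] * dz_dzbar [] [i] vs"])
    show "alternating 1 (\<lambda>vs. \<Sum>i\<in>UNIV. \<beta> [axis i 1] * dz_dzbar [] [i] vs)"
      using alternating_covector_wedge[OF linear_cnj_component alternating_alt_one]
      by (intro alternating_sum_mult) (simp add: dz_dzbar_01)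
    show "\<beta> [v] = (\<Sum>i\<in>UNIV. \<beta> [axis i 1] * dz_dzbar [] [i] [v])" for v
      unfolding linear_basis_expansion[OF lin, of v] linear_i_scale(2)[OF lin i[rule_format] refl]
      by (simp add: dz_dzbar_01 covector_wedge_alt_one mult.commute)
  qed
  show "alt_type 0 1 \<beta>"
    unfolding alt_type_def
    by (intro exI[of _ "\<lambda>I J. \<beta> [axis (hd J) 1]"] allI, rule trans[OF eq]) (simp add: sum_lists_length_1)
qed

lemma alt_type_11_iff:
  fixes \<beta> :: "(complex^'n::finite) altform"
  assumes \<beta>: "alternating 2 \<beta>"
  shows "alt_type 1 1 \<beta> \<longleftrightarrow> (\<forall>v w. \<beta> [\<i> *s v, \<i> *s w] = \<beta> [v, w])"
proof
  assume "alt_type 1 1 \<beta>"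
  then obtain a where "\<And>vs. \<beta> vs = (\<Sum>i\<in>UNIV. \<Sum>j\<in>UNIV. a [i] [j] * dz_dzbar [i] [j] vs)"
    by (auto simp: alt_type_def sum_lists_length_1)
  moreover have "\<i> * x * (\<i> * y) = - (x * y)" for x y
  proof -
    have "\<i> * x * (\<i> * y) = (\<i> * \<i>) * (x * y)" by (simp only: mult_ac)
    then show ?thesis by simp
  qed
  ultimately show "\<forall>v w. \<beta> [\<i> *s v, \<i> *s w] = \<beta> [v, w]"
    by (simp add: dz_dzbar_11 covector_wedge_2 right_diff_distrib)
next
  assume ii: "\<forall>v w. \<beta> [\<i> *s v, \<i> *s w] = \<beta> [v, w]"
  have lin1: "linear (\<lambda>v. \<beta> [v, w])" for w using alternating_linear[OF \<beta>, of "[]" "[w]"] by simp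
  have lin2: "linear (\<lambda>w. \<beta> [v, w])" for v using alternating_linear[OF \<beta>, of "[v]" "[]"] by simp
  have swap: "\<beta> [v, w] = - \<beta> [w, v]" for v w
    using alternating_swap[OF \<beta>, of "[]" v "[]" w "[]"] by simp
  have i_left: "\<beta> [\<i> *s v, w] = - \<beta> [v, \<i> *s w]" for v w
  proof -
    have "\<beta> [\<i> *s v, \<i> *s (\<i> *s w)] = \<beta> [v, \<i> *s w]" using ii by blast
    then show ?thesis unfolding i_times_i_smult linear_neg[OF lin2] by (simp add: equation_minus_iff)
  qed
  \<comment> \<open>\<open>h\<close> is the sesquilinear part of \<beta>, linear in \<open>v\<close>
    and antilinear in \<open>w\<close>, and \<beta>(v, w) = h(v, w) - h(w, v). Its values on the
    axes are therefore the coefficients with respect to the products of \<open>dz\<close> and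
    \<open>dzbar\<close>.\<close>
  define h where "h = (\<lambda>v w. (\<beta> [v, w] + \<i> * \<beta> [v, \<i> *s w]) / 2)"
  have h1: "linear (\<lambda>v. h v w)" for w
    unfolding h_def divide_inverse by (intro linear_mult_const linear_compose_add linear_const_mult lin1)
  have h2: "linear (\<lambda>w. h v w)" for v
    unfolding h_def divide_inverse
    by (intro linear_mult_const linear_compose_add linear_const_mult lin2
        linear_compose[OF linear_smult lin2, unfolded o_def])
  have h1i: "h (\<i> *s v) w = \<i> * h v w" for v w
    by (simp add: h_def i_left i_times_i_smult linear_neg[OF lin2] algebra_simps add_divide_distrib)
  have h2i: "h v (\<i> *s w) = - \<i> * h v w" for v w
    by (simp add: h_def i_times_i_smult linear_neg[OF lin2] algebra_simps add_divide_distrib diff_divide_distrib)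
  have expand: "h v w = (\<Sum>i\<in>UNIV. \<Sum>j\<in>UNIV. h (axis i 1) (axis j 1) * (v $ i * cnj (w $ j)))" for v w
  proof -
    have "h v w = (\<Sum>i\<in>UNIV. v $ i * h (axis i 1) w)"
      unfolding linear_basis_expansion[OF h1, of v] linear_i_scale(1)[OF h1 h1i refl] ..
    also have "\<dots> = (\<Sum>i\<in>UNIV. v $ i * (\<Sum>j\<in>UNIV. cnj (w $ j) * h (axis i 1) (axis j 1)))"
      unfolding linear_basis_expansion[OF h2, of _ w] linear_i_scale(2)[OF h2 h2i refl] ..
    finally show ?thesis by (simp add: sum_distrib_left mult_ac)
  qed
  have \<beta>h: "\<beta> [v, w] = h v w - h w v" for v w
    using swap[of w v] swap[of w "\<i> *s v"] i_left[of v w] by (simp add: h_def field_simps)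
  have eq: "\<beta> vs = (\<Sum>i\<in>UNIV. \<Sum>j\<in>UNIV. h (axis i 1) (axis j 1) * dz_dzbar [i] [j] vs)" for vs
  proof (rule alternating_2_eqI[OF \<beta>, of "\<lambda>vs. \<Sum>i\<in>UNIV. \<Sum>j\<in>UNIV. h (axis i 1) (axis j 1) * dz_dzbar [i] [j] vs"])
    have alt: "alternating 2 (dz_dzbar [i] [j])" for i j :: 'n
      using alternating_covector_wedge[OF linear_component alternating_covector_wedge[OF linear_cnj_component alternating_alt_one], of i j]
      by (simp add: dz_dzbar_11 numeral_2_eq_2)
    have "alternating 2 (\<lambda>vs. \<Sum>i\<in>UNIV. 1 * (\<Sum>j\<in>UNIV. h (axis i 1) (axis j 1) * dz_dzbar [i] [j] vs))"
      by (intro alternating_sum_mult alt)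
    then show "alternating 2 (\<lambda>vs. \<Sum>i\<in>UNIV. \<Sum>j\<in>UNIV. h (axis i 1) (axis j 1) * dz_dzbar [i] [j] vs)"
      by simp
    show "\<beta> [v, w] = (\<Sum>i\<in>UNIV. \<Sum>j\<in>UNIV. h (axis i 1) (axis j 1) * dz_dzbar [i] [j] [v, w])" for v w
      unfolding \<beta>h expand[of v] expand[of w]
      by (simp add: dz_dzbar_11 covector_wedge_2 right_diff_distrib sum_subtractf)
  qed
  show "alt_type 1 1 \<beta>"
    unfolding alt_type_def
    by (intro exI[of _ "\<lambda>I J. h (axis (hd I) 1) (axis (hd J) 1)"] allI, rule trans[OF eq]) (simp add: sum_lists_length_1)
qed

section \<open>Charts and transition maps\<close>

locale complex_atlas =
  fixes A :: "('a::{t2_space, second_countable_topology}, 'n::finite) chart set"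
  assumes manifold: "complex_manifold A"
begin

lemma chart: "c \<in> A \<Longrightarrow> is_chart c"
  using manifold by (auto simp: complex_manifold_def)

sublocale open_charts A
  by unfold_locales (use chart in \<open>auto simp: is_chart_def\<close>)

definition chart_inv :: "('a, 'n) chart \<Rightarrow> complex^'n \<Rightarrow> 'a" where
  "chart_inv c = inv_into (fst c) (snd c)"

definition overlap :: "('a, 'n) chart \<Rightarrow> ('a, 'n) chart \<Rightarrow> (complex^'n) set" where
  "overlap c c' = snd c ` (fst c \<inter> fst c')"

definition d_transition :: "('a, 'n) chart \<Rightarrow> ('a, 'n) chart \<Rightarrow> complex^'n \<Rightarrow> complex^'n \<Rightarrow> complex^'n" where
  "d_transition c c' x = frechet_derivative (transition c c') (at x)"

lemma chart_homeomorphism: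
  assumes "c \<in> A"
  shows "homeomorphism (fst c) (chart_image c) (snd c) (chart_inv c)"
proof -
  obtain g where g: "homeomorphism (fst c) (chart_image c) (snd c) g"
    using chart[OF assms] by (auto simp: is_chart_def)
  have "inj_on (snd c) (fst c)"
    by (rule inj_on_inverseI[of _ g]) (rule homeomorphism_apply1[OF g])
  then have "chart_inv c (snd c p) = p" if "p \<in> fst c" for p
    using that by (simp add: chart_inv_def)
  then have "chart_inv c x = g x" if "x \<in> chart_image c" for x
    using that g unfolding homeomorphism_def chart_image_def by (metis imageE)
  then show ?thesis by (intro homeomorphism_cong[OF g]) auto
qed

lemma open_chart_domain: "c \<in> A \<Longrightarrow> open (fst c)"
  using chart by (auto simp: is_chart_def)

lemma chart_inv_chart: "c \<in> A \<Longrightarrow> p \<in> fst c \<Longrightarrow> chart_inv c (snd c p) = p"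
  and chart_chart_inv: "c \<in> A \<Longrightarrow> x \<in> chart_image c \<Longrightarrow> snd c (chart_inv c x) = x"
  and chart_inv_domain: "c \<in> A \<Longrightarrow> x \<in> chart_image c \<Longrightarrow> chart_inv c x \<in> fst c"
  and continuous_on_chart: "c \<in> A \<Longrightarrow> continuous_on (fst c) (snd c)"
  and continuous_on_chart_inv: "c \<in> A \<Longrightarrow> continuous_on (chart_image c) (chart_inv c)"
  using chart_homeomorphism[of c] unfolding homeomorphism_def by auto

lemma chart_in_image: "p \<in> fst c \<Longrightarrow> snd c p \<in> chart_image c"
  by (simp add: chart_image_def)

lemma ex_chart: "\<exists>c\<in>A. p \<in> fst c"
  using manifold by (auto simp: complex_manifold_def set_eq_iff)

lemma overlap_subset: "overlap c c' \<subseteq> chart_image c"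
  by (auto simp: overlap_def chart_image_def)

lemma overlap_eq: "c \<in> A \<Longrightarrow> overlap c c' = chart_image c \<inter> chart_inv c -` fst c'"
  by (auto simp: overlap_def chart_image_def chart_inv_chart)

lemma open_overlap: "c \<in> A \<Longrightarrow> c' \<in> A \<Longrightarrow> open (overlap c c')"
  unfolding overlap_eq
  by (rule continuous_open_preimage[OF continuous_on_chart_inv open_chart_image open_chart_domain])

lemma transition_eq: "transition c c' x = snd c' (chart_inv c x)"
  by (simp add: transition_def chart_inv_def)

lemma transition_chart: "c \<in> A \<Longrightarrow> p \<in> fst c \<Longrightarrow> transition c c' (snd c p) = snd c' p"
  by (simp add: transition_eq chart_inv_chart)

lemma transition_overlap: "c \<in> A \<Longrightarrow> transition c c' ` overlap c c' = overlap c' c"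
  by (force simp: overlap_def transition_chart)

lemma inj_on_transition: "c \<in> A \<Longrightarrow> c' \<in> A \<Longrightarrow> inj_on (transition c c') (overlap c c')"
  unfolding overlap_def by (auto simp: inj_on_def transition_chart) (metis chart_inv_chart)

lemma transition_has_derivative:
  assumes "c \<in> A" "c' \<in> A" "x \<in> overlap c c'"
  shows "(transition c c' has_derivative d_transition c c' x) (at x)"
    and "d_transition c c' x (a *s v) = a *s d_transition c c' x v"
proof -
  have "holomorphic_map_on (transition c c') (overlap c c')"
    using manifold assms by (auto simp: complex_manifold_def overlap_def)
  then obtain L where L: "(transition c c' has_derivative L) (at x)" "\<forall>c v. L (c *s v) = c *s L v"
    using assms by (auto simp: holomorphic_map_on_def)
  moreover have "d_transition c c' x = L" using L by (simp add: d_transition_def frechet_derivative_eq)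
  ultimately show "(transition c c' has_derivative d_transition c c' x) (at x)"
    "d_transition c c' x (a *s v) = a *s d_transition c c' x v" by auto
qed

lemma linear_d_transition: "c \<in> A \<Longrightarrow> c' \<in> A \<Longrightarrow> x \<in> overlap c c' \<Longrightarrow> linear (d_transition c c' x)"
  by (rule has_derivative_linear[OF transition_has_derivative(1)])

text \<open>The entries of the Jacobian are directional derivatives of holomorphic functions, to
  which the Cauchy integral applies. This is needed where \<partial> acts on their
  conjugates.\<close>

lemma d_transition_component_has_derivative:
  assumes "c \<in> A" "c' \<in> A" "x \<in> overlap c c'"
  shows "\<exists>L. ((\<lambda>y. d_transition c c' y w $ j) has_derivative L) (at x) \<and> (\<forall>a v. L (a *s v) = a * L v)"
proof (rule holomorphic_derivative_has_derivative[where F = "\<lambda>y. transition c c' y $ j", OF open_overlap[OF assms(1,2)] _ _ assms(3)])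
  fix y assume y: "y \<in> overlap c c'"
  show "((\<lambda>y. transition c c' y $ j) has_derivative (\<lambda>w. d_transition c c' y w $ j)) (at y)"
    by (rule bounded_linear.has_derivative[OF bounded_linear_vec_nth transition_has_derivative(1)[OF assms(1,2) y]])
  show "d_transition c c' y (a *s v) $ j = a * d_transition c c' y v $ j" for a v
    by (simp add: transition_has_derivative(2)[OF assms(1,2) y])
qed

lemma compatibleI:
  assumes "\<And>c c' x vs. c \<in> A \<Longrightarrow> c' \<in> A \<Longrightarrow> x \<in> overlap c c' \<Longrightarrow>
    \<alpha> c x vs = \<alpha> c' (transition c c' x) (map (d_transition c c' x) vs)"
  shows "compatible A \<alpha>"
  unfolding compatible_def
proof (intro ballI allI)
  fix c c' p vs assume "c \<in> A" "c' \<in> A" "p \<in> fst c \<inter> fst c'"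
  then show "\<alpha> c (snd c p) vs =
      \<alpha> c' (snd c' p) (map (frechet_derivative (transition c c') (at (snd c p))) vs)"
    using assms[of c c' "snd c p" vs] by (auto simp: overlap_def transition_chart d_transition_def)
qed

lemma compatible_overlap:
  assumes "compatible A \<alpha>" "c \<in> A" "c' \<in> A" "x \<in> overlap c c'"
  shows "\<alpha> c x vs = \<alpha> c' (transition c c' x) (map (d_transition c c' x) vs)"
proof -
  obtain p where "p \<in> fst c" "p \<in> fst c'" "x = snd c p" using assms(4) by (auto simp: overlap_def)
  then show ?thesis
    using compatibleD[OF assms(1-3), of p vs] assms by (simp add: transition_chart d_transition_def)
qed

lemma transition_in_image: "c \<in> A \<Longrightarrow> x \<in> overlap c c' \<Longrightarrow> transition c c' x \<in> chart_image c'"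
  using transition_overlap[of c c'] overlap_subset[of c' c] by blast

section \<open>One-forms and their types\<close>

text \<open>The eigenvalue t = i stands for type (1,0) and t = -i for type (0,1), which lets both be
  handled together.\<close>

definition typed_one_forms :: "complex \<Rightarrow> ('a, 'n) dform set" where
  "typed_one_forms t = {\<alpha> \<in> dforms A 1. \<forall>c\<in>A. \<forall>x\<in>chart_image c. \<forall>v. \<alpha> c x [\<i> *s v] = t * \<alpha> c x [v]}"

lemma pq_forms_10: "pq_forms A 1 0 = typed_one_forms \<i>"
  and pq_forms_01: "pq_forms A 0 1 = typed_one_forms (- \<i>)"
proof -
  have alt: "alternating 1 (\<alpha> c x)" if "\<alpha> \<in> dforms A 1" "c \<in> A" "x \<in> chart_image c" for \<alpha> c x
    using that by (auto simp: dforms_eq intro: chart_forms_alternating)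
  show "pq_forms A 1 0 = typed_one_forms \<i>"
    using alt_type_10_iff[OF alt] by (auto simp: pq_forms_def typed_one_forms_def)
  show "pq_forms A 0 1 = typed_one_forms (- \<i>)"
    using alt_type_01_iff[OF alt] by (auto simp: pq_forms_def typed_one_forms_def)
qed

lemma pq_forms_11:
  "pq_forms A 1 1 = {\<alpha> \<in> dforms A 2. \<forall>c\<in>A. \<forall>x\<in>chart_image c. \<forall>v w. \<alpha> c x [\<i> *s v, \<i> *s w] = \<alpha> c x [v, w]}"
proof -
  have alt: "alternating 2 (\<alpha> c x)" if "\<alpha> \<in> dforms A 2" "c \<in> A" "x \<in> chart_image c" for \<alpha> c x
    using that by (auto simp: dforms_eq intro: chart_forms_alternating)
  show ?thesis
    unfolding pq_forms_def one_add_one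
    by (intro Collect_cong conj_cong refl ball_cong alt_type_11_iff[OF alt]; assumption)
qed

lemma typed_one_formsD:
  assumes "\<alpha> \<in> typed_one_forms t"
  shows typed_one_forms_dforms: "\<alpha> \<in> dforms A 1"
    and typed_one_forms_chart_forms: "\<alpha> \<in> chart_forms A 1"
    and typed_one_forms_compatible: "compatible A \<alpha>"
    and typed_one_forms_i: "c \<in> A \<Longrightarrow> x \<in> chart_image c \<Longrightarrow> \<alpha> c x [\<i> *s v] = t * \<alpha> c x [v]"
  using assms by (auto simp: typed_one_forms_def dforms_eq)

lemma typed_one_forms_add: "\<alpha> \<in> typed_one_forms t \<Longrightarrow> \<beta> \<in> typed_one_forms t \<Longrightarrow> \<alpha> + \<beta> \<in> typed_one_forms t"
  and typed_one_forms_uminus: "\<alpha> \<in> typed_one_forms t \<Longrightarrow> - \<alpha> \<in> typed_one_forms t"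
  and zero_typed_one_forms: "0 \<in> typed_one_forms t"
  by (auto simp: typed_one_forms_def dforms_add dforms_uminus zero_dforms algebra_simps)

text \<open>For t = i or t = -i this is the projection onto the eigenspace of multiplication by i
  with eigenvalue \<open>t\<close>. It respects the transition maps, as their differentials commute
  with i.\<close>

definition one_form_part :: "complex \<Rightarrow> ('a, 'n) dform \<Rightarrow> ('a, 'n) dform" where
  "one_form_part t \<alpha> = (\<lambda>c x vs. (\<alpha> c x vs - t * \<alpha> c x (map (\<lambda>v. \<i> *s v) vs)) / 2)"

lemma one_form_part_in:
  assumes \<alpha>: "\<alpha> \<in> dforms A 1" and t: "t = \<i> \<or> t = - \<i>"
  shows "one_form_part t \<alpha> \<in> typed_one_forms t"
proof -
  have cf: "\<alpha> \<in> chart_forms A 1" and comp: "compatible A \<alpha>" using \<alpha> by (auto simp: dforms_eq)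
  have "one_form_part t \<alpha> \<in> chart_forms A 1"
    unfolding chart_forms_def
  proof (intro CollectI conjI allI ballI impI)
    show "one_form_part t \<alpha> c x = 0" if "\<not> (c \<in> A \<and> x \<in> chart_image c)" for c x
      using chart_forms_0[OF cf that] by (simp add: one_form_part_def fun_eq_iff)
  next
    fix c x assume c: "c \<in> A" and x: "x \<in> chart_image c"
    note alt = chart_forms_alternating[OF cf c x]
    have "alternating 1 (\<lambda>vs. \<Sum>j\<in>{0, 1::nat}. (if j = 0 then 1 / 2 else - t / 2) *
        (if j = 0 then \<alpha> c x vs else \<alpha> c x (map (\<lambda>v. \<i> *s v) vs)))"
      by (rule alternating_sum_mult) (use alt alternating_map_linear[OF alt linear_smult] in auto)
    then show "alternating 1 (one_form_part t \<alpha> c x)"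
      by (simp add: one_form_part_def diff_divide_distrib)
  next
    fix c vs assume c: "c \<in> A"
    have "smooth_on (\<lambda>x. 1 / 2 * (\<alpha> c x vs - t * \<alpha> c x (map (\<lambda>v. \<i> *s v) vs))) (chart_image c)"
      by (intro smooth_on_mult_const smooth_on_diff open_chart_image c chart_forms_smooth[OF cf])
    then show "smooth_on (\<lambda>x. one_form_part t \<alpha> c x vs) (chart_image c)"
      by (simp add: one_form_part_def)
  qed
  moreover have "compatible A (one_form_part t \<alpha>)"
  proof (rule compatibleI)
    fix c c' x vs assume c: "c \<in> A" "c' \<in> A" "x \<in> overlap c c'"
    have "map (d_transition c c' x) (map (\<lambda>v. \<i> *s v) vs) = map (\<lambda>v. \<i> *s v) (map (d_transition c c' x) vs)"
      by (simp add: transition_has_derivative(2)[OF c])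
    then show "one_form_part t \<alpha> c x vs
        = one_form_part t \<alpha> c' (transition c c' x) (map (d_transition c c' x) vs)"
      unfolding one_form_part_def compatible_overlap[OF comp c] by (simp only:)
  qed
  moreover have "one_form_part t \<alpha> c x [\<i> *s v] = t * one_form_part t \<alpha> c x [v]"
    if c: "c \<in> A" and x: "x \<in> chart_image c" for c x v
  proof -
    have "linear (\<lambda>v. \<alpha> c x [v])"
      using alternating_linear[OF chart_forms_alternating[OF cf c x], of "[]" "[]"] by simp
    then show ?thesis
      using t linear_neg[of "\<lambda>v. \<alpha> c x [v]" v]
      by (auto simp: one_form_part_def i_times_i_smult algebra_simps add_divide_distrib diff_divide_distrib)
  qed
  ultimately show ?thesis by (auto simp: typed_one_forms_def dforms_eq)
qed

lemma one_form_part_sum: "\<alpha> = one_form_part \<i> \<alpha> + one_form_part (- \<i>) \<alpha>"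
  by (simp add: one_form_part_def fun_eq_iff field_simps)

text \<open>The parameter follows the types: t = i is \<partial> and t = -i is dbar, so that
  \<open>typed_d t\<close> sends functions to \<open>typed_one_forms t\<close>.\<close>

definition typed_d :: "complex \<Rightarrow> ('a, 'n) dform \<Rightarrow> ('a, 'n) dform" where
  "typed_d t = ext_op (gen_d (1 / 2) (- t / 2)) A"

lemma del_eq: "del A = typed_d \<i>" and delbar_eq: "delbar A = typed_d (- \<i>)"
  by (simp_all add: typed_d_def del_def delbar_def fun_del_gen fun_delbar_gen fun_eq_iff)

lemma gen_d_i:
  assumes "f differentiable (at x)" "t = \<i> \<or> t = - \<i>"
  shows "gen_d (1 / 2) (- t / 2) f x (\<i> *s v) = t * gen_d (1 / 2) (- t / 2) f x v"
proof -
  obtain f' where f': "(f has_derivative f') (at x)" using assms(1) by (auto simp: differentiable_def)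
  show ?thesis
    using assms(2)
    by (auto simp: gen_d_eq[OF f'] i_times_i_smult linear_neg[OF has_derivative_linear[OF f']] algebra_simps)
qed

text \<open>The chain rule holds for every combination \<open>gen_d\<close>, because the
  differential of a transition map commutes with multiplication by i.\<close>

lemma gen_d_transition:
  assumes c: "c \<in> A" "c' \<in> A" "x \<in> overlap c c'" and h: "h differentiable (at (transition c c' x))"
  shows "gen_d a b (\<lambda>y. h (transition c c' y)) x v = gen_d a b h (transition c c' x) (d_transition c c' x v)"
    and "(\<lambda>y. h (transition c c' y)) differentiable (at x)"
proof -
  obtain h' where h': "(h has_derivative h') (at (transition c c' x))" using h by (auto simp: differentiable_def)
  note der = has_derivative_compose[OF transition_has_derivative(1)[OF c] h']
  show "gen_d a b (\<lambda>y. h (transition c c' y)) x v = gen_d a b h (transition c c' x) (d_transition c c' x v)"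
    by (simp add: gen_d_eq[OF der] gen_d_eq[OF h'] transition_has_derivative(2)[OF c])
  show "(\<lambda>y. h (transition c c' y)) differentiable (at x)"
    using der by (rule differentiableI)
qed

lemma ext_op_function:
  "c \<in> A \<Longrightarrow> x \<in> chart_image c \<Longrightarrow> ext_op D A f c x [v] = D (\<lambda>y. f c y []) x v"
  by (simp add: ext_op_apply asum_Cons)

lemma ext_op_one_form:
  "c \<in> A \<Longrightarrow> x \<in> chart_image c \<Longrightarrow>
    ext_op D A \<alpha> c x [v, w] = D (\<lambda>y. \<alpha> c y [w]) x v - D (\<lambda>y. \<alpha> c y [v]) x w"
  by (simp add: ext_op_apply asum_Cons)

lemma typed_d_function:
  assumes f: "f \<in> dforms A 0" and t: "t = \<i> \<or> t = - \<i>"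
  shows "typed_d t f \<in> typed_one_forms t"
proof -
  have cf: "f \<in> chart_forms A 0" and comp: "compatible A f" using f by (auto simp: dforms_eq)
  have cf1: "typed_d t f \<in> chart_forms A 1"
    using ext_op_chart_forms[OF cf] by (simp add: typed_d_def)
  moreover have "compatible A (typed_d t f)"
  proof (rule compatibleI)
    fix c c' x vs assume c: "c \<in> A" "c' \<in> A" "x \<in> overlap c c'"
    have x: "x \<in> chart_image c" and x': "transition c c' x \<in> chart_image c'"
      using overlap_subset[of c c'] transition_in_image[OF c(1,3)] c(3) by blast+
    show "typed_d t f c x vs = typed_d t f c' (transition c c' x) (map (d_transition c c' x) vs)"
    proof (rule alternating_1_eqI[where \<beta> = "\<lambda>vs. typed_d t f c' (transition c c' x) (map (d_transition c c' x) vs)"])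
      show "alternating 1 (typed_d t f c x)" by (rule chart_forms_alternating[OF cf1 c(1) x])
      show "alternating 1 (\<lambda>vs. typed_d t f c' (transition c c' x) (map (d_transition c c' x) vs))"
        by (rule alternating_map_linear[OF chart_forms_alternating[OF cf1 c(2) x'] linear_d_transition[OF c]])
      fix v
      have "typed_d t f c x [v] = gen_d (1 / 2) (- t / 2) (\<lambda>y. f c y []) x v"
        unfolding typed_d_def by (rule ext_op_function[OF c(1) x])
      also have "\<dots> = gen_d (1 / 2) (- t / 2) (\<lambda>y. f c' (transition c c' y) []) x v"
        using compatible_overlap[OF comp c(1,2), of _ "[]"]
        by (intro gen_d_cong[OF open_overlap[OF c(1,2)] c(3)]) simp
      also have "\<dots> = gen_d (1 / 2) (- t / 2) (\<lambda>y. f c' y []) (transition c c' x) (d_transition c c' x v)"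
        by (rule gen_d_transition(1)[OF c chart_forms_differentiable[OF cf c(2) x']])
      also have "\<dots> = typed_d t f c' (transition c c' x) (map (d_transition c c' x) [v])"
        unfolding typed_d_def by (simp add: ext_op_function[OF c(2) x'])
      finally show "typed_d t f c x [v] = typed_d t f c' (transition c c' x) (map (d_transition c c' x) [v])" .
    qed
  qed
  moreover have "typed_d t f c x [\<i> *s v] = t * typed_d t f c x [v]"
    if "c \<in> A" "x \<in> chart_image c" for c x v
    unfolding typed_d_def ext_op_function[OF that]
    by (rule gen_d_i[OF chart_forms_differentiable[OF cf that] t])
  ultimately show ?thesis by (auto simp: typed_one_forms_def dforms_eq)
qed

text \<open>For t = i or t = -i the factor \<open>s * t\<close> is 1 if \<open>s\<close> and
  \<open>t\<close> differ, as in type (1,1), and -1 if they agree. The second claim tells the types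
  (2,0) and (0,2) apart.\<close>

lemma typed_d_one_form_i:
  assumes \<alpha>: "\<alpha> \<in> typed_one_forms t" and s: "s = \<i> \<or> s = - \<i>"
    and c: "c \<in> A" and x: "x \<in> chart_image c"
  shows "typed_d s \<alpha> c x [\<i> *s v, \<i> *s w] = s * t * typed_d s \<alpha> c x [v, w]"
    and "s = t \<Longrightarrow> typed_d s \<alpha> c x [\<i> *s v, w] = s * typed_d s \<alpha> c x [v, w]"
proof -
  note diff = chart_forms_differentiable[OF typed_one_forms_chart_forms[OF \<alpha>] c x]
  have i: "gen_d a b (\<lambda>y. \<alpha> c y [\<i> *s w]) x v = t * gen_d a b (\<lambda>y. \<alpha> c y [w]) x v" for a b v w
  proof -
    have "gen_d a b (\<lambda>y. \<alpha> c y [\<i> *s w]) x v = gen_d a b (\<lambda>y. t * \<alpha> c y [w]) x v"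
      by (rule gen_d_cong[OF open_chart_image[OF c] x]) (rule typed_one_forms_i[OF \<alpha> c])
    then show ?thesis by (simp add: gen_d_mult_const[OF diff])
  qed
  show "typed_d s \<alpha> c x [\<i> *s v, \<i> *s w] = s * t * typed_d s \<alpha> c x [v, w]"
    unfolding typed_d_def ext_op_one_form[OF c x] i gen_d_i[OF diff s] by (simp add: algebra_simps)
  show "typed_d s \<alpha> c x [\<i> *s v, w] = s * typed_d s \<alpha> c x [v, w]" if "s = t"
    unfolding typed_d_def ext_op_one_form[OF c x] i gen_d_i[OF diff s] by (simp add: algebra_simps that)
qed

text \<open>No second derivatives of the transition maps enter here: they are holomorphic, so that
  \<open>\<partial>\<close> annihilates the coefficients of the pulled back \<open>dzbar\<^sub>j\<close>.\<close>

lemma del_one_form_01: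
  assumes \<alpha>: "\<alpha> \<in> pq_forms A 0 1"
  shows "del A \<alpha> \<in> pq_forms A 1 1"
proof -
  have \<alpha>': "\<alpha> \<in> typed_one_forms (- \<i>)" using \<alpha> by (simp only: pq_forms_01)
  note cf = typed_one_forms_chart_forms[OF \<alpha>'] and comp = typed_one_forms_compatible[OF \<alpha>']
  have cf2: "del A \<alpha> \<in> chart_forms A 2"
    using ext_op_chart_forms[OF cf] by (simp add: del_eq typed_d_def numeral_2_eq_2)
  have expand: "\<alpha> c y [w] = (\<Sum>j\<in>UNIV. \<alpha> c y [axis j 1] * cnj (w $ j))"
    if "c \<in> A" "y \<in> chart_image c" for c y w
  proof -
    have lin: "linear (\<lambda>w. \<alpha> c y [w])"
      using alternating_linear[OF chart_forms_alternating[OF cf that], of "[]" "[]"] by simp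
    show ?thesis
      unfolding linear_basis_expansion[OF lin, of w]
        linear_i_scale(2)[OF lin typed_one_forms_i[OF \<alpha>' that] refl]
      by (simp add: mult.commute)
  qed
  have "compatible A (del A \<alpha>)"
  proof (rule compatibleI)
    fix c c' x vs assume c: "c \<in> A" "c' \<in> A" "x \<in> overlap c c'"
    have x: "x \<in> chart_image c" and x': "transition c c' x \<in> chart_image c'"
      using overlap_subset[of c c'] transition_in_image[OF c(1,3)] c(3) by blast+
    note diff = chart_forms_differentiable[OF cf c(2) x']
    have del: "fun_del (\<lambda>y. \<alpha> c y [w]) x v
        = fun_del (\<lambda>y. \<alpha> c' y [d_transition c c' x w]) (transition c c' x) (d_transition c c' x v)" for v w
    proof -
      have cnj: "(\<lambda>y. cnj (d_transition c c' y w $ j)) differentiable (at x)"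
          "fun_del (\<lambda>y. cnj (d_transition c c' y w $ j)) x v = 0" for j
      proof -
        obtain L where L: "((\<lambda>y. d_transition c c' y w $ j) has_derivative L) (at x)" "\<And>a v. L (a *s v) = a * L v"
          using d_transition_component_has_derivative[OF c] by blast
        have der: "((\<lambda>y. cnj (d_transition c c' y w $ j)) has_derivative (\<lambda>v. cnj (L v))) (at x)"
          by (rule has_derivative_cnj[OF L(1)])
        then show "(\<lambda>y. cnj (d_transition c c' y w $ j)) differentiable (at x)" by (rule differentiableI)
        show "fun_del (\<lambda>y. cnj (d_transition c c' y w $ j)) x v = 0"
          by (simp add: fun_del_def fun_d_eq[OF der] L(2))
      qed
      note tr = gen_d_transition[OF c diff]
      have "fun_del (\<lambda>y. \<alpha> c y [w]) x v
          = fun_del (\<lambda>y. \<Sum>j\<in>UNIV. \<alpha> c' (transition c c' y) [axis j 1] * cnj (d_transition c c' y w $ j)) x v"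
        unfolding fun_del_gen
      proof (rule gen_d_cong[OF open_overlap[OF c(1,2)] c(3)])
        fix y assume y: "y \<in> overlap c c'"
        have "\<alpha> c y [w] = \<alpha> c' (transition c c' y) [d_transition c c' y w]"
          using compatible_overlap[OF comp c(1,2) y, of "[w]"] by simp
        also have "\<dots> = (\<Sum>j\<in>UNIV. \<alpha> c' (transition c c' y) [axis j 1] * cnj (d_transition c c' y w $ j))"
          by (rule expand[OF c(2) transition_in_image[OF c(1) y]])
        finally show "\<alpha> c y [w] = (\<Sum>j\<in>UNIV. \<alpha> c' (transition c c' y) [axis j 1] * cnj (d_transition c c' y w $ j))" .
      qed
      also have "\<dots> = (\<Sum>j\<in>UNIV. fun_del (\<lambda>y. \<alpha> c' y [axis j 1]) (transition c c' x) (d_transition c c' x v)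
          * cnj (d_transition c c' x w $ j))"
        using tr cnj unfolding fun_del_gen by (simp add: gen_d_sum gen_d_mult differentiable_mult)
      also have "\<dots> = fun_del (\<lambda>y. \<Sum>j\<in>UNIV. \<alpha> c' y [axis j 1] * cnj (d_transition c c' x w $ j))
          (transition c c' x) (d_transition c c' x v)"
        using diff unfolding fun_del_gen
        by (simp add: gen_d_sum gen_d_mult_const differentiable_mult mult.commute[of _ "cnj _"])
      also have "\<dots> = fun_del (\<lambda>y. \<alpha> c' y [d_transition c c' x w]) (transition c c' x) (d_transition c c' x v)"
        unfolding fun_del_gen
        by (rule gen_d_cong[OF open_chart_image[OF c(2)] x']) (rule expand[OF c(2), symmetric])
      finally show ?thesis .
    qed
    show "del A \<alpha> c x vs = del A \<alpha> c' (transition c c' x) (map (d_transition c c' x) vs)"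
    proof (rule alternating_2_eqI[where \<beta> = "\<lambda>vs. del A \<alpha> c' (transition c c' x) (map (d_transition c c' x) vs)"])
      show "alternating 2 (del A \<alpha> c x)" by (rule chart_forms_alternating[OF cf2 c(1) x])
      show "alternating 2 (\<lambda>vs. del A \<alpha> c' (transition c c' x) (map (d_transition c c' x) vs))"
        by (rule alternating_map_linear[OF chart_forms_alternating[OF cf2 c(2) x'] linear_d_transition[OF c]])
      show "del A \<alpha> c x [v, w] = del A \<alpha> c' (transition c c' x) (map (d_transition c c' x) [v, w])" for v w
        unfolding del_def list.map ext_op_one_form[OF c(1) x] ext_op_one_form[OF c(2) x'] del ..
    qed
  qed
  then show ?thesis
    unfolding pq_forms_11 dforms_eq using cf2 typed_d_one_form_i(1)[OF \<alpha>', of \<i>] by (simp add: del_eq)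
qed

lemma typed_d_chart_forms: "\<alpha> \<in> chart_forms A k \<Longrightarrow> typed_d t \<alpha> \<in> chart_forms A (Suc k)"
  and typed_d_anticommute: "\<alpha> \<in> chart_forms A k \<Longrightarrow> typed_d s (typed_d t \<alpha>) = - typed_d t (typed_d s \<alpha>)"
  and typed_d_square: "\<alpha> \<in> chart_forms A k \<Longrightarrow> typed_d t (typed_d t \<alpha>) = 0"
  and typed_d_add: "\<alpha> \<in> chart_forms A k \<Longrightarrow> \<beta> \<in> chart_forms A k \<Longrightarrow>
    typed_d t (\<alpha> + \<beta>) = typed_d t \<alpha> + typed_d t \<beta>"
  and typed_d_uminus: "\<alpha> \<in> chart_forms A k \<Longrightarrow> typed_d t (- \<alpha>) = - typed_d t \<alpha>"
  unfolding typed_d_def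
  by (rule ext_op_chart_forms ext_op_anticommute ext_op_square ext_op_add ext_op_uminus; assumption)+

lemma ext_d_typed: "ext_d A \<alpha> = typed_d \<i> \<alpha> + typed_d (- \<i>) \<alpha>"
  by (simp add: ext_d_eq del_eq delbar_eq)

text \<open>Here d\<alpha> splits into P of type (2,0), Q of type (0,2) and R + S of type (1,1).
  Evaluation at (i v, i w) separates P + Q from R + S, and evaluation at (i v, w) separates P from
  Q.\<close>

lemma closed_one_form_parts:
  assumes \<alpha>: "\<alpha> \<in> dforms A 1" and closed: "ext_d A \<alpha> = 0"
  shows "typed_d \<i> (one_form_part \<i> \<alpha>) = 0" "typed_d (- \<i>) (one_form_part (- \<i>) \<alpha>) = 0"
    "typed_d (- \<i>) (one_form_part \<i> \<alpha>) = - typed_d \<i> (one_form_part (- \<i>) \<alpha>)"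
proof -
  let ?a = "one_form_part \<i> \<alpha>" and ?b = "one_form_part (- \<i>) \<alpha>"
  have a: "?a \<in> typed_one_forms \<i>" and b: "?b \<in> typed_one_forms (- \<i>)"
    using one_form_part_in[OF \<alpha>] by auto
  note cfa = typed_one_forms_chart_forms[OF a] and cfb = typed_one_forms_chart_forms[OF b]
  define P Q R S where "P = typed_d \<i> ?a" and "Q = typed_d (- \<i>) ?b" and "R = typed_d (- \<i>) ?a"
    and "S = typed_d \<i> ?b"
  have sum: "(P + S) + (R + Q) = 0"
    using closed unfolding ext_d_typed P_def Q_def R_def S_def
    by (subst (asm) (1 2) one_form_part_sum) (simp only: typed_d_add[OF cfa cfb])
  have cf2: "typed_d t \<beta> \<in> chart_forms A 2" if "\<beta> \<in> chart_forms A 1" for t \<beta>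
    using typed_d_chart_forms[OF that] by (simp add: numeral_2_eq_2)
  have *: "P c x [v, w] = 0 \<and> Q c x [v, w] = 0 \<and> R c x [v, w] = - S c x [v, w]"
    if c: "c \<in> A" and x: "x \<in> chart_image c" for c x v w
  proof -
    have sum': "P c x [v, w] + S c x [v, w] + (R c x [v, w] + Q c x [v, w]) = 0" for v w
      using arg_cong[OF sum, of "\<lambda>f. f c x [v, w]"] by simp
    have "P c x [\<i> *s v, \<i> *s w] = - P c x [v, w]" "S c x [\<i> *s v, \<i> *s w] = S c x [v, w]"
      "R c x [\<i> *s v, \<i> *s w] = R c x [v, w]" "Q c x [\<i> *s v, \<i> *s w] = - Q c x [v, w]" for v w
      unfolding P_def Q_def R_def S_def
      using typed_d_one_form_i(1)[OF a, of \<i>, OF _ c x] typed_d_one_form_i(1)[OF a, of "- \<i>", OF _ c x]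
        typed_d_one_form_i(1)[OF b, of \<i>, OF _ c x] typed_d_one_form_i(1)[OF b, of "- \<i>", OF _ c x]
      by simp_all
    then have neg: "- P c x [v, w] + S c x [v, w] + (R c x [v, w] - Q c x [v, w]) = 0" for v w
      using sum'[of "\<i> *s v" "\<i> *s w"] by simp
    have alg: "p + q = 0 \<and> s + r = 0" if "p + s + (r + q) = 0" "- p + s + (r - q) = 0" for p q r s :: complex
    proof -
      have "p + q = ((p + s + (r + q)) - (- p + s + (r - q))) / 2"
        "s + r = ((p + s + (r + q)) + (- p + s + (r - q))) / 2"
        by (simp_all add: field_simps)
      then show ?thesis unfolding that by simp
    qed
    note PQ = alg[OF sum' neg, THEN conjunct1] and RS = alg[OF sum' neg, THEN conjunct2]
    have "P c x [\<i> *s v, w] = \<i> * P c x [v, w]" "Q c x [\<i> *s v, w] = - \<i> * Q c x [v, w]"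
      unfolding P_def Q_def
      using typed_d_one_form_i(2)[OF a, of \<i>, OF _ c x] typed_d_one_form_i(2)[OF b, of "- \<i>", OF _ c x]
      by simp_all
    then have "\<i> * (P c x [v, w] - Q c x [v, w]) = 0" using PQ[of "\<i> *s v" w] by (simp add: algebra_simps)
    then have eq: "P c x [v, w] = Q c x [v, w]" by simp
    then have "P c x [v, w] = 0" using PQ[of v w] by simp
    with eq RS[of v w] show ?thesis by (simp add: eq_neg_iff_add_eq_0 add.commute)
  qed
  have eqI: "\<beta> = \<gamma>" if "\<beta> \<in> chart_forms A 2" "\<gamma> \<in> chart_forms A 2"
    and eq: "\<And>c x v w. c \<in> A \<Longrightarrow> x \<in> chart_image c \<Longrightarrow> \<beta> c x [v, w] = \<gamma> c x [v, w]" for \<beta> \<gamma>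
  proof (rule dform_eqI[where A = A])
    show "\<beta> c x vs = \<gamma> c x vs" if "c \<in> A" "x \<in> chart_image c" for c x vs
      by (rule alternating_2_eqI)
        (use that \<open>\<beta> \<in> _\<close> \<open>\<gamma> \<in> _\<close> in \<open>auto intro: chart_forms_alternating eq\<close>)
  qed (use that chart_forms_0 in blast)+
  show "typed_d \<i> ?a = 0" "typed_d (- \<i>) ?b = 0" "typed_d (- \<i>) ?a = - typed_d \<i> ?b"
    using * unfolding P_def Q_def R_def S_def
    by (auto intro!: eqI cf2 cfa cfb zero_chart_forms chart_forms_uminus)
qed

text \<open>If \<open>\<alpha> = a + b\<close> with \<open>a\<close> of type (1,0) and \<open>b\<close> of type (0,1), then
  \<open>\<partial> b = \<partial> dbar f\<close> for some \<open>f\<close>, and the forms \<open>b - dbar f\<close> and \<open>a - \<partial> f\<close> are closed.\<close>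

lemma closed_one_form_exact:
  assumes vanish: "\<And>t \<theta>. t = \<i> \<or> t = - \<i> \<Longrightarrow> \<theta> \<in> typed_one_forms t \<Longrightarrow> ext_d A \<theta> = 0 \<Longrightarrow> \<theta> = 0"
    and lemma_dd: "\<forall>v\<in>pq_forms A 1 1. ext_d A v = 0 \<longrightarrow>
        v \<in> del A ` pq_forms A 0 1 \<longrightarrow> v \<in> (\<lambda>f. del A (delbar A f)) ` pq_forms A 0 0"
    and \<alpha>: "\<alpha> \<in> dforms A 1" and closed: "ext_d A \<alpha> = 0"
  shows "\<alpha> \<in> ext_d A ` dforms A 0"
proof -
  define a b where "a = one_form_part \<i> \<alpha>" and "b = one_form_part (- \<i>) \<alpha>"
  have a: "a \<in> typed_one_forms \<i>" and b: "b \<in> typed_one_forms (- \<i>)"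
    using one_form_part_in[OF \<alpha>] by (auto simp: a_def b_def)
  note cfa = typed_one_forms_chart_forms[OF a] and cfb = typed_one_forms_chart_forms[OF b]
  note parts = closed_one_form_parts[OF \<alpha> closed, folded a_def b_def]
  have b': "b \<in> pq_forms A 0 1" using b by (simp only: pq_forms_01)
  have v: "del A b \<in> pq_forms A 1 1" by (rule del_one_form_01[OF b'])
  have typed_d_0: "typed_d t 0 = 0" for t
    using typed_d_square[OF cfa, of t] typed_d_add[OF zero_chart_forms zero_chart_forms, of t] by simp
  \<comment> \<open>Indeed \<partial> \<partial> b = 0, and dbar \<partial> b = - \<partial> dbar b
    = 0 because dbar b is the (0,2)-part of d\<alpha>.\<close>
  have "ext_d A (del A b) = 0"
    unfolding ext_d_typed del_eq typed_d_square[OF cfb]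
    by (subst typed_d_anticommute[OF cfb]) (simp add: parts typed_d_0)
  then obtain f where f: "f \<in> pq_forms A 0 0" "del A b = del A (delbar A f)"
    using lemma_dd v b' by blast
  have f0: "f \<in> dforms A 0" using f(1) by (simp add: pq_forms_def)
  then have cf: "f \<in> chart_forms A 0" by (simp add: dforms_eq)
  have df: "typed_d \<i> f \<in> typed_one_forms \<i>" "typed_d (- \<i>) f \<in> typed_one_forms (- \<i>)"
    by (auto intro: typed_d_function[OF f0])
  note cdf = df[THEN typed_one_forms_chart_forms]
  have f2: "typed_d \<i> b = typed_d \<i> (typed_d (- \<i>) f)" using f(2) by (simp add: del_eq delbar_eq)
  have "b + - typed_d (- \<i>) f = 0"
  proof (rule vanish[of "- \<i>"])
    show "b + - typed_d (- \<i>) f \<in> typed_one_forms (- \<i>)"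
      by (intro typed_one_forms_add typed_one_forms_uminus b df)
    show "ext_d A (b + - typed_d (- \<i>) f) = 0"
      unfolding ext_d_typed typed_d_add[OF cfb chart_forms_uminus[OF cdf(2)]] typed_d_uminus[OF cdf(2)]
      by (simp add: typed_d_square[OF cf] parts f2)
  qed simp
  moreover have "a + - typed_d \<i> f = 0"
  proof (rule vanish[of \<i>])
    show "a + - typed_d \<i> f \<in> typed_one_forms \<i>"
      by (intro typed_one_forms_add typed_one_forms_uminus a df)
    \<comment> \<open>The mixed part cancels as well: dbar a = - \<partial> b = - \<partial> dbar f
      = dbar \<partial> f.\<close>
    have "typed_d (- \<i>) a = - typed_d \<i> (typed_d (- \<i>) f)" by (simp add: parts f2)
    also have "\<dots> = typed_d (- \<i>) (typed_d \<i> f)" by (rule typed_d_anticommute[OF cf, symmetric])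
    finally show "ext_d A (a + - typed_d \<i> f) = 0"
      unfolding ext_d_typed typed_d_add[OF cfa chart_forms_uminus[OF cdf(1)]] typed_d_uminus[OF cdf(1)]
      by (simp add: typed_d_square[OF cf] parts)
  qed simp
  moreover have "\<alpha> = a + b" unfolding a_def b_def by (rule one_form_part_sum)
  ultimately have "\<alpha> = ext_d A f" by (simp add: ext_d_typed)
  with f0 show ?thesis by blast
qed

end

section \<open>Partitions of unity\<close>

text \<open>The regularity of the weights in the partition of unity: their differentials have to be
  continuous, but are not differentiated again.\<close>

abbreviation C1_on :: "('v::real_normed_vector \<Rightarrow> 'w::real_normed_vector) \<Rightarrow> 'v set \<Rightarrow> bool" where
  "C1_on \<equiv> Ck_on (Suc 0)"

lemma C1_onI:
  assumes "\<And>x. x \<in> S \<Longrightarrow> (f has_derivative f' x) (at x)" "\<And>v. continuous_on S (\<lambda>x. f' x v)"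
  shows "C1_on f S"
proof -
  have "continuous_on S (\<lambda>x. frechet_derivative f (at x) v)" for v
    using assms(2)[of v] by (rule continuous_on_eq) (simp add: frechet_derivative_eq[OF assms(1)])
  then show ?thesis using assms(1) by (auto simp: differentiable_def)
qed

lemma C1_onD:
  assumes "C1_on f S"
  shows C1_on_has_derivative: "x \<in> S \<Longrightarrow> (f has_derivative frechet_derivative f (at x)) (at x)"
    and C1_on_frechet_continuous: "continuous_on S (\<lambda>x. frechet_derivative f (at x) v)"
    and C1_on_continuous: "continuous_on S f"
proof -
  show der: "x \<in> S \<Longrightarrow> (f has_derivative frechet_derivative f (at x)) (at x)" for x
    using assms by (simp add: frechet_derivative_works)
  show "continuous_on S (\<lambda>x. frechet_derivative f (at x) v)" using assms by simp
  show "continuous_on S f"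
    using der by (auto intro!: continuous_at_imp_continuous_on has_derivative_continuous)
qed

lemma smooth_on_C1_on: "smooth_on f S \<Longrightarrow> C1_on f S"
  by (auto simp: smooth_on_def simp del: Ck_on.simps)

lemma C1_on_mult:
  fixes f g :: "'v::real_normed_vector \<Rightarrow> 'w::real_normed_algebra"
  assumes f: "C1_on f S" and g: "C1_on g S"
  shows "C1_on (\<lambda>x. f x * g x) S"
proof (rule C1_onI)
  show "((\<lambda>x. f x * g x) has_derivative
      (\<lambda>v. f x * frechet_derivative g (at x) v + frechet_derivative f (at x) v * g x)) (at x)" if "x \<in> S" for x
    by (rule has_derivative_mult[OF C1_on_has_derivative[OF f that] C1_on_has_derivative[OF g that]])
  show "continuous_on S (\<lambda>x. f x * frechet_derivative g (at x) v + frechet_derivative f (at x) v * g x)" for v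
    by (intro continuous_on_add continuous_on_mult C1_on_continuous C1_on_frechet_continuous f g)
qed

lemma C1_on_inverse:
  fixes f :: "'v::real_normed_vector \<Rightarrow> real"
  assumes f: "C1_on f S" and nz: "\<And>x. x \<in> S \<Longrightarrow> f x \<noteq> 0"
  shows "C1_on (\<lambda>x. inverse (f x)) S"
proof (rule C1_onI)
  show "((\<lambda>x. inverse (f x)) has_derivative
      (\<lambda>v. - (inverse (f x) * frechet_derivative f (at x) v * inverse (f x)))) (at x)" if "x \<in> S" for x
    by (rule Deriv.has_derivative_inverse[OF nz[OF that] C1_on_has_derivative[OF f that]])
  show "continuous_on S (\<lambda>x. - (inverse (f x) * frechet_derivative f (at x) v * inverse (f x)))" for v
    by (intro continuous_on_minus continuous_on_mult continuous_on_inverse C1_on_continuous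
        C1_on_frechet_continuous f) (use nz in auto)
qed

lemma C1_on_Un:
  assumes "open S" "open T" "C1_on f S" "C1_on f T"
  shows "C1_on f (S \<union> T)"
  using assms by (auto intro!: continuous_on_open_Un)

lemma C1_on_const: "C1_on (\<lambda>x. c) S"
  by (rule C1_onI[of _ _ "\<lambda>_ _. 0"]) auto

lemma C1_on_sum:
  assumes "open S" "\<And>i. i \<in> I \<Longrightarrow> C1_on (f i) S"
  shows "C1_on (\<lambda>x. \<Sum>i\<in>I. f i x) S"
  using assms(2)
proof (induction I rule: infinite_finite_induct)
  case (insert i I)
  have "C1_on (\<lambda>x. f i x + (\<Sum>i\<in>I. f i x)) S"
    by (rule Ck_on_add[OF assms(1)]) (use insert in auto)
  then show ?case using insert by (simp del: Ck_on.simps)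
qed (use Ck_on_0 in \<open>simp_all del: Ck_on.simps\<close>)

section \<open>Bump functions\<close>

lemma has_real_derivative_max_square:
  "((\<lambda>s::real. (max 0 s)\<^sup>2) has_real_derivative 2 * max 0 s) (at s)"
proof -
  consider "s > 0" | "s < 0" | "s = 0" by linarith
  then show ?thesis
  proof cases
    case 1
    have "((\<lambda>s::real. s\<^sup>2) has_real_derivative 2 * max 0 s) (at s)"
      using 1 by (auto intro!: derivative_eq_intros)
    then show ?thesis
      by (rule has_field_derivative_transform_within_open[where S = "{0<..}"]) (use 1 in auto)
  next
    case 2
    have "((\<lambda>s::real. 0) has_real_derivative 2 * max 0 s) (at s)" using 2 by simp
    then show ?thesis
      by (rule has_field_derivative_transform_within_open[where S = "{..<0}"]) (use 2 in auto)
  next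
    case 3
    have "((\<lambda>h::real. (max 0 h)\<^sup>2 / h) \<longlongrightarrow> 0) (at 0)"
    proof (rule Lim_null_comparison)
      show "\<forall>\<^sub>F h in at 0. norm ((max 0 h)\<^sup>2 / h) \<le> \<bar>h\<bar>"
        by (intro always_eventually allI) (auto simp: max_def power2_eq_square)
      show "((\<lambda>h::real. \<bar>h\<bar>) \<longlongrightarrow> 0) (at 0)" by (rule tendsto_rabs_zero) simp
    qed
    then show ?thesis using 3 by (simp add: DERIV_def)
  qed
qed

text \<open>Squaring the positive part removes the kink at the sphere of radius \<open>r\<close> and
  makes the function continuously differentiable.\<close>

definition bump :: "'v::real_inner \<Rightarrow> real \<Rightarrow> 'v \<Rightarrow> real" where
  "bump a r x = (max 0 (r\<^sup>2 - (x - a) \<bullet> (x - a)))\<^sup>2"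

lemma bump_has_derivative:
  "(bump a r has_derivative (\<lambda>v. 2 * max 0 (r\<^sup>2 - (x - a) \<bullet> (x - a)) * (- 2 * ((x - a) \<bullet> v)))) (at x)"
proof -
  have "((\<lambda>x. r\<^sup>2 - (x - a) \<bullet> (x - a)) has_derivative (\<lambda>v. - 2 * ((x - a) \<bullet> v))) (at x)"
    by (auto intro!: derivative_eq_intros simp: inner_commute)
  from has_derivative_compose[OF this has_real_derivative_max_square[unfolded has_field_derivative_def]]
  show ?thesis by (simp add: bump_def[abs_def])
qed

lemma bump_nonneg: "bump a r x \<ge> 0"
  and bump_pos_iff: "r > 0 \<Longrightarrow> bump a r x > 0 \<longleftrightarrow> x \<in> ball a r"
proof -
  show "bump a r x \<ge> 0" by (simp add: bump_def)
  assume r: "r > 0"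
  have "bump a r x > 0 \<longleftrightarrow> (norm (x - a))\<^sup>2 < r\<^sup>2"
    by (auto simp: bump_def power2_norm_eq_inner max_def)
  also have "\<dots> \<longleftrightarrow> norm (x - a) < r"
    using r by (auto intro: power2_less_imp_less power_strict_mono)
  finally show "bump a r x > 0 \<longleftrightarrow> x \<in> ball a r" by (simp add: dist_norm norm_minus_commute)
qed

context complex_atlas
begin

lemma continuous_on_transition: "c \<in> A \<Longrightarrow> c' \<in> A \<Longrightarrow> continuous_on (overlap c c') (transition c c')"
  by (intro continuous_at_imp_continuous_on ballI has_derivative_continuous[OF transition_has_derivative(1)])

lemma continuous_on_d_transition:
  assumes "c \<in> A" "c' \<in> A"
  shows "continuous_on (overlap c c') (\<lambda>x. d_transition c c' x v)"
proof -
  have "continuous_on (overlap c c') (\<lambda>x. d_transition c c' x v $ j)" for j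
  proof (rule holomorphic_derivative_continuous[where F = "\<lambda>y. transition c c' y $ j", OF open_overlap[OF assms]])
    fix y assume y: "y \<in> overlap c c'"
    show "((\<lambda>y. transition c c' y $ j) has_derivative (\<lambda>w. d_transition c c' y w $ j)) (at y)"
      by (rule bounded_linear.has_derivative[OF bounded_linear_vec_nth transition_has_derivative(1)[OF assms y]])
    show "d_transition c c' y (a *s v) $ j = a * d_transition c c' y v $ j" for a v
      by (simp add: transition_has_derivative(2)[OF assms y])
  qed
  then have "continuous_on (overlap c c') (\<lambda>x. \<chi> j. d_transition c c' x v $ j)"
    by (rule continuous_on_vec_lambda)
  then show ?thesis by simp
qed

definition C1_function :: "('a \<Rightarrow> real) \<Rightarrow> bool" where
  "C1_function \<rho> \<longleftrightarrow> (\<forall>c\<in>A. C1_on (\<lambda>x. \<rho> (chart_inv c x)) (chart_image c))"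

lemma bump_function_exists:
  obtains c K \<psi> where "c \<in> A" "compact K" "K \<subseteq> fst c" "C1_function \<psi>" "\<And>q. \<psi> q \<ge> 0"
    "\<And>q. q \<notin> K \<Longrightarrow> \<psi> q = 0" "open {q. \<psi> q > 0}" "\<psi> p > 0"
proof -
  obtain c where c: "c \<in> A" "p \<in> fst c" using ex_chart by blast
  define a where "a = snd c p"
  have "a \<in> chart_image c" using c by (simp add: a_def chart_in_image)
  then obtain r where r: "r > 0" "cball a r \<subseteq> chart_image c"
    using open_chart_image[OF c(1)] open_contains_cball by metis
  define K where "K = chart_inv c ` cball a r"
  define \<psi> where "\<psi> = (\<lambda>q. if q \<in> fst c then bump a r (snd c q) else 0)"
  have K: "compact K" "K \<subseteq> fst c"
    unfolding K_def using r chart_inv_domain[OF c(1)]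
    by (auto intro!: compact_continuous_image continuous_on_subset[OF continuous_on_chart_inv[OF c(1)]])
  have pos: "\<psi> q > 0 \<longleftrightarrow> q \<in> fst c \<and> snd c q \<in> ball a r" for q
    using r by (simp add: \<psi>_def bump_pos_iff)
  have nonneg: "\<psi> q \<ge> 0" for q by (simp add: \<psi>_def bump_nonneg)
  have supp: "\<psi> q = 0" if "q \<notin> K" for q
  proof -
    have "\<not> \<psi> q > 0"
    proof
      assume "\<psi> q > 0"
      then have "q \<in> fst c" "snd c q \<in> cball a r" using pos by auto
      then have "q \<in> K" unfolding K_def using chart_inv_chart[OF c(1)] by (metis imageI)
      with that show False by simp
    qed
    with nonneg[of q] show ?thesis by simp
  qed
  have C1: "C1_function \<psi>"
    unfolding C1_function_def
  proof
    fix c' assume c': "c' \<in> A"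
    let ?f = "\<lambda>x. \<psi> (chart_inv c' x)"
    \<comment> \<open>\<open>K\<close> is compact in a Hausdorff space, so its complement is open.
      Together with the overlap it covers the chart, and on it the extension by 0 vanishes.\<close>
    let ?U = "chart_image c' \<inter> chart_inv c' -` (- K)"
    have "open ?U"
      using K(1) by (intro continuous_open_preimage[OF continuous_on_chart_inv[OF c'] open_chart_image[OF c']])
        (simp add: compact_imp_closed open_Compl)
    have "C1_on ?f (overlap c' c)"
    proof (rule C1_onI)
      fix x assume x: "x \<in> overlap c' c"
      let ?y = "transition c' c x"
      have "((\<lambda>x. bump a r (transition c' c x)) has_derivative
          (\<lambda>v. 2 * max 0 (r\<^sup>2 - (?y - a) \<bullet> (?y - a)) * (- 2 * ((?y - a) \<bullet> d_transition c' c x v)))) (at x)"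
        by (rule has_derivative_compose[OF transition_has_derivative(1)[OF c' c(1) x] bump_has_derivative])
      then show "(?f has_derivative
          (\<lambda>v. 2 * max 0 (r\<^sup>2 - (?y - a) \<bullet> (?y - a)) * (- 2 * ((?y - a) \<bullet> d_transition c' c x v)))) (at x)"
        by (rule has_derivative_transform_within_open[OF _ open_overlap[OF c' c(1)] x])
          (auto simp: \<psi>_def transition_eq overlap_eq[OF c'])
    next
      show "continuous_on (overlap c' c) (\<lambda>x. 2 * max 0 (r\<^sup>2 - (transition c' c x - a) \<bullet> (transition c' c x - a)) *
          (- 2 * ((transition c' c x - a) \<bullet> d_transition c' c x v)))" for v
        by (intro continuous_intros continuous_on_transition continuous_on_d_transition c c')
    qed
    moreover have "C1_on ?f ?U"
    proof (rule C1_onI[where f' = "\<lambda>_ _. 0"])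
      fix x assume x: "x \<in> ?U"
      have "((\<lambda>x. 0) has_derivative (\<lambda>_. 0)) (at x)" by simp
      then show "(?f has_derivative (\<lambda>_. 0)) (at x)"
        by (rule has_derivative_transform_within_open[OF _ \<open>open ?U\<close> x]) (simp add: supp)
    qed simp
    ultimately have "C1_on ?f (overlap c' c \<union> ?U)"
      by (intro C1_on_Un open_overlap c' c \<open>open ?U\<close>)
    moreover have "overlap c' c \<union> ?U = chart_image c'"
      using K(2) by (auto simp: overlap_eq[OF c'])
    ultimately show "C1_on ?f (chart_image c')" by (simp del: Ck_on.simps)
  qed
  have op: "open {q. \<psi> q > 0}"
  proof -
    have eq: "{q. \<psi> q > 0} = fst c \<inter> snd c -` ball a r"
      unfolding Set.set_eq_iff by (simp only: pos mem_Collect_eq Int_iff vimage_eq simp_thms)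
    show ?thesis
      unfolding eq
      by (rule continuous_open_preimage[OF continuous_on_chart[OF c(1)] open_chart_domain[OF c(1)] open_ball])
  qed
  have "\<psi> p > 0" using c r by (simp add: pos a_def)
  from that[OF c(1) K C1 nonneg supp op this] show ?thesis .
qed

text \<open>By compactness finitely many bump functions have a positive sum everywhere, by which
  they are divided. The index set consists of the points at which they are centred.\<close>

lemma partition_of_unity:
  assumes "compact (UNIV :: 'a set)"
  obtains I :: "'a set" and ch K \<rho> where "finite I" "\<And>i. i \<in> I \<Longrightarrow> ch i \<in> A" "\<And>i. i \<in> I \<Longrightarrow> compact (K i)"
    "\<And>i. i \<in> I \<Longrightarrow> K i \<subseteq> fst (ch i)" "\<And>i. i \<in> I \<Longrightarrow> C1_function (\<rho> i)" "\<And>i q. i \<in> I \<Longrightarrow> \<rho> i q \<ge> 0"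
    "\<And>i q. i \<in> I \<Longrightarrow> q \<notin> K i \<Longrightarrow> \<rho> i q = 0" "\<And>q. (\<Sum>i\<in>I. \<rho> i q) = 1"
proof -
  have "\<forall>p. \<exists>c K \<psi>. c \<in> A \<and> compact K \<and> K \<subseteq> fst c \<and> C1_function \<psi> \<and> (\<forall>q. \<psi> q \<ge> 0)
      \<and> (\<forall>q. q \<notin> K \<longrightarrow> \<psi> q = 0) \<and> open {q. \<psi> q > 0} \<and> \<psi> p > 0"
    by (intro allI, rule bump_function_exists) blast
  then obtain ch K \<psi> where ch: "\<And>p. ch p \<in> A" and K: "\<And>p. compact (K p)" "\<And>p. K p \<subseteq> fst (ch p)"
    and C1: "\<And>p. C1_function (\<psi> p)" and nonneg: "\<And>p q. \<psi> p q \<ge> 0"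
    and supp: "\<And>p q. q \<notin> K p \<Longrightarrow> \<psi> p q = 0"
    and op: "\<And>p. open {q. \<psi> p q > 0}" and pos: "\<And>p. \<psi> p p > 0"
    by metis
  have "UNIV \<subseteq> (\<Union>p\<in>UNIV. {q. \<psi> p q > 0})" using pos by auto
  then obtain I where I: "finite I" "UNIV \<subseteq> (\<Union>p\<in>I. {q. \<psi> p q > 0})"
    using compactE_image[OF assms, of UNIV "\<lambda>p. {q. \<psi> p q > 0}"] op by (metis subset_UNIV)
  define s where "s = (\<lambda>q. \<Sum>p\<in>I. \<psi> p q)"
  have s: "s q > 0" for q
  proof -
    obtain p where "p \<in> I" "\<psi> p q > 0" using I(2) by blast
    then show ?thesis unfolding s_def using I(1) nonneg by (intro sum_pos2)
  qed
  have "C1_function (\<lambda>q. \<psi> p q * inverse (s q))" for p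
    unfolding C1_function_def
  proof
    fix c assume c: "c \<in> A"
    have "C1_on (\<lambda>x. s (chart_inv c x)) (chart_image c)"
      unfolding s_def using C1 c by (intro C1_on_sum open_chart_image) (auto simp: C1_function_def simp del: Ck_on.simps)
    then have "C1_on (\<lambda>x. inverse (s (chart_inv c x))) (chart_image c)"
      by (rule C1_on_inverse) (use s in \<open>simp add: less_imp_neq[symmetric]\<close>)
    then show "C1_on (\<lambda>x. \<psi> p (chart_inv c x) * inverse (s (chart_inv c x))) (chart_image c)"
      using C1 c by (intro C1_on_mult) (auto simp: C1_function_def simp del: Ck_on.simps)
  qed
  moreover have "(\<Sum>p\<in>I. \<psi> p q * inverse (s q)) = 1" for q
  proof -
    have "(\<Sum>p\<in>I. \<psi> p q) = s q" by (simp add: s_def)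
    then show ?thesis using s[of q] by (simp flip: sum_distrib_right)
  qed
  ultimately show ?thesis
    using that[OF I(1), of ch K "\<lambda>p q. \<psi> p q * inverse (s q)"] ch K supp nonneg s
    by (simp add: less_imp_le)
qed

end

section \<open>Integration in charts\<close>

lemma nonneg_continuous_integral_0:
  fixes f :: "'e::euclidean_space \<Rightarrow> real"
  assumes cont: "continuous_on UNIV f" and int: "integrable lborel f" and nonneg: "\<And>x. f x \<ge> 0"
    and 0: "integral\<^sup>L lborel f = 0"
  shows "f x = 0"
proof -
  have HK: "(f has_integral 0) UNIV" using has_integral_integral_lborel[OF int] 0 by simp
  let ?a = "x - One" and ?b = "x + One"
  have cont': "continuous_on (cbox ?a ?b) f" by (rule continuous_on_subset[OF cont]) simp
  have cbox: "(f has_integral integral (cbox ?a ?b) f) (cbox ?a ?b)"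
    by (rule integrable_integral[OF integrable_continuous[OF cont']])
  then have "integral (cbox ?a ?b) f \<le> 0"
    using has_integral_subset_le[OF _ cbox HK] nonneg by simp
  moreover have "integral (cbox ?a ?b) f \<ge> 0"
    using nonneg by (intro integral_nonneg integrable_continuous cont') auto
  ultimately have "(f has_integral 0) (cbox ?a ?b)" using cbox by simp
  moreover have "x \<in> box ?a ?b" by (simp add: mem_box inner_diff_left inner_add_left)
  ultimately show ?thesis
    using has_integral_0_cbox_imp_0[OF cont' nonneg, of x] box_subset_cbox by blast
qed

text \<open>Real coordinates for the Lebesgue integral. The index type \<open>'n bit0\<close> has
  \<open>2 * CARD('n)\<close> elements and is well-ordered, as
  \<open>integral_lborel_change_of_variables\<close> requires.\<close>

locale complex_atlas_coordinates = complex_atlas A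
  for A :: "('a::{t2_space, second_countable_topology}, 'n::finite) chart set" +
  fixes g :: "real^('n bit0) \<Rightarrow> complex^'n" and g' :: "complex^'n \<Rightarrow> real^('n bit0)"
  assumes linear_g: "linear g" and linear_g': "linear g'"
    and g_g': "g (g' v) = v" and g'_g: "g' (g u) = u"
begin

lemma continuous_g: "continuous_on S g" and continuous_g': "continuous_on T g'"
  using linear_g linear_g' by (auto intro: linear_continuous_on simp: linear_conv_bounded_linear)

definition chart_ext :: "('a, 'n) chart \<Rightarrow> (complex^'n \<Rightarrow> real) \<Rightarrow> complex^'n \<Rightarrow> real" where
  "chart_ext c f x = (if x \<in> chart_image c then f x else 0)"

text \<open>The density \<open>f\<close> will be the value of a top form on a fixed frame. The frame
  and the coordinates \<open>g\<close> affect the integral of the form by a constant factor only,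
  the same in all charts.\<close>

definition chart_integral :: "('a, 'n) chart \<Rightarrow> (complex^'n \<Rightarrow> real) \<Rightarrow> real" where
  "chart_integral c f = integral\<^sup>L lborel (\<lambda>u. chart_ext c f (g u))"

text \<open>\<open>K\<close> is a subset of the manifold and not of the chart image, so that one set
  can serve in two charts.\<close>

definition supported :: "('a, 'n) chart \<Rightarrow> 'a set \<Rightarrow> (complex^'n \<Rightarrow> real) \<Rightarrow> bool" where
  "supported c K f \<longleftrightarrow> (\<forall>x\<in>chart_image c. chart_inv c x \<notin> K \<longrightarrow> f x = 0)"

definition integrand :: "('a, 'n) chart \<Rightarrow> (complex^'n \<Rightarrow> real) \<Rightarrow> bool" where
  "integrand c f \<longleftrightarrow> continuous_on (chart_image c) f \<and> (\<exists>K. compact K \<and> K \<subseteq> fst c \<and> supported c K f)"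

lemma chart_compact:
  assumes "c \<in> A" "compact K" "K \<subseteq> fst c"
  shows "compact (snd c ` K)" "snd c ` K \<subseteq> chart_image c"
  using assms by (auto intro!: compact_continuous_image continuous_on_subset[OF continuous_on_chart] chart_in_image)

lemma supported_0:
  assumes "c \<in> A" "supported c K f" "x \<in> chart_image c" "x \<notin> snd c ` K"
  shows "f x = 0"
proof -
  have "chart_inv c x \<notin> K" using assms chart_chart_inv by (metis imageI)
  then show ?thesis using assms by (simp add: supported_def)
qed

lemma integrandD:
  assumes c: "c \<in> A" and f: "integrand c f"
  shows integrand_integrable: "integrable lborel (\<lambda>u. chart_ext c f (g u))"
    and integrand_continuous_g: "continuous_on UNIV (\<lambda>u. chart_ext c f (g u))"
proof -
  obtain K where K: "compact K" "K \<subseteq> fst c" "supported c K f" and cont: "continuous_on (chart_image c) f"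
    using f by (auto simp: integrand_def)
  let ?K = "snd c ` K"
  note KI = chart_compact[OF c K(1,2)]
  have zero: "chart_ext c f x = 0" if "x \<notin> ?K" for x
    using that supported_0[OF c K(3)] by (simp add: chart_ext_def)
  \<comment> \<open>The extension by 0 is continuous on two open sets that cover the space: the
    chart image and the complement of the compact support.\<close>
  have "continuous_on (chart_image c) (chart_ext c f)"
    using cont by (rule continuous_on_eq) (simp add: chart_ext_def)
  moreover have "continuous_on (- ?K) (chart_ext c f)"
    using continuous_on_const[of "- ?K" "0::real"] by (rule continuous_on_eq) (simp add: zero)
  ultimately have "continuous_on (chart_image c \<union> - ?K) (chart_ext c f)"
    using KI by (intro continuous_on_open_Un open_chart_image c) (auto intro: compact_imp_closed)
  moreover have "chart_image c \<union> - ?K = UNIV" using KI by auto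
  ultimately have "continuous_on UNIV (chart_ext c f)" by simp
  then show cont_g: "continuous_on UNIV (\<lambda>u. chart_ext c f (g u))"
    by (rule continuous_on_compose2[OF _ continuous_g]) simp
  show "integrable lborel (\<lambda>u. chart_ext c f (g u))"
  proof (rule integrable_compact_support[OF cont_g])
    show "compact (g' ` ?K)" by (intro compact_continuous_image continuous_g' KI)
    show "chart_ext c f (g u) = 0" if "u \<notin> g' ` ?K" for u
      using that g'_g by (intro zero) (metis imageI)
  qed
qed

lemma chart_integral_sum:
  assumes c: "c \<in> A" and f: "\<And>i. i \<in> I \<Longrightarrow> integrand c (f i)"
  shows "chart_integral c (\<lambda>x. \<Sum>i\<in>I. f i x) = (\<Sum>i\<in>I. chart_integral c (f i))"
proof -
  have "chart_ext c (\<lambda>x. \<Sum>i\<in>I. f i x) y = (\<Sum>i\<in>I. chart_ext c (f i) y)" for y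
    by (simp add: chart_ext_def)
  then show ?thesis
    unfolding chart_integral_def using integrand_integrable[OF c f] by simp
qed

lemma chart_integral_add:
  assumes c: "c \<in> A" and "integrand c f" "integrand c h"
  shows "chart_integral c (\<lambda>x. f x + h x) = chart_integral c f + chart_integral c h"
proof -
  have "chart_ext c (\<lambda>x. f x + h x) y = chart_ext c f y + chart_ext c h y" for y
    by (simp add: chart_ext_def)
  then show ?thesis
    unfolding chart_integral_def using integrand_integrable[OF c] assms by simp
qed

lemma chart_integral_cmult: "chart_integral c (\<lambda>x. a * f x) = a * chart_integral c f"
proof -
  have "chart_ext c (\<lambda>x. a * f x) y = a * chart_ext c f y" for y
    by (simp add: chart_ext_def)
  then show ?thesis unfolding chart_integral_def by simp
qed

lemma chart_integral_cong:
  "(\<And>x. x \<in> chart_image c \<Longrightarrow> f x = h x) \<Longrightarrow> chart_integral c f = chart_integral c h"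
proof -
  assume *: "\<And>x. x \<in> chart_image c \<Longrightarrow> f x = h x"
  have "chart_ext c f = chart_ext c h" using * by (auto simp: chart_ext_def fun_eq_iff)
  then show ?thesis by (simp add: chart_integral_def)
qed

lemma chart_integral_derivative:
  assumes c: "c \<in> A" and C1: "C1_on f (chart_image c)"
    and K: "compact K" "K \<subseteq> fst c" "supported c K f"
  shows "chart_integral c (\<lambda>x. frechet_derivative f (at x) v) = 0"
    and "integrand c (\<lambda>x. frechet_derivative f (at x) v)"
proof -
  let ?K = "snd c ` K"
  note KI = chart_compact[OF c K(1,2)]
  define D where "D = (\<lambda>x v. chart_ext c (\<lambda>x. frechet_derivative f (at x) v) x)"
  have zero: "chart_ext c f x = 0" if "x \<notin> ?K" for x
    using that supported_0[OF c K(3)] by (simp add: chart_ext_def)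
  have op: "open (- ?K)" using KI by (simp add: compact_imp_closed open_Compl)
  have der0: "((chart_ext c f) has_derivative (\<lambda>_. 0)) (at x)" if "x \<notin> ?K" for x
  proof -
    have "((\<lambda>x. 0) has_derivative (\<lambda>_. 0)) (at x)" by simp
    then show ?thesis
      by (rule has_derivative_transform_within_open[OF _ op]) (use that zero in auto)
  qed
  have der1: "((chart_ext c f) has_derivative frechet_derivative f (at x)) (at x)" if "x \<in> chart_image c" for x
    using C1_on_has_derivative[OF C1 that]
    by (rule has_derivative_transform_within_open[OF _ open_chart_image[OF c] that]) (simp add: chart_ext_def)
  have supp: "supported c K (\<lambda>x. frechet_derivative f (at x) v)" for v
    unfolding supported_def
  proof (intro ballI impI)
    fix x assume x: "x \<in> chart_image c" "chart_inv c x \<notin> K"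
    then have "x \<notin> ?K" using K(2) chart_inv_chart[OF c] by auto
    then have "frechet_derivative f (at x) = (\<lambda>_. 0)"
      using has_derivative_unique[OF der0 der1[OF x(1)]] by simp
    then show "frechet_derivative f (at x) v = 0" by simp
  qed
  then show int: "integrand c (\<lambda>x. frechet_derivative f (at x) v)" for v
    unfolding integrand_def using C1_on_frechet_continuous[OF C1] K by blast
  have der: "(chart_ext c f has_derivative D x) (at x)" for x
  proof (cases "x \<in> chart_image c")
    case True
    then show ?thesis using der1 by (simp add: D_def chart_ext_def)
  next
    case False
    then have "x \<notin> ?K" using KI by auto
    with False show ?thesis using der0 by (simp add: D_def chart_ext_def)
  qed
  \<comment> \<open>The derivative in direction \<open>v\<close> is that of the composite with
    \<open>g\<close> in direction \<open>g' v\<close>.\<close>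
  have "integral\<^sup>L lborel (\<lambda>u. D (g u) (g (g' v))) = 0"
  proof (rule integral_directional_derivative_eq_0[where f = "\<lambda>u. chart_ext c f (g u)" and f' = "\<lambda>u w. D (g u) (g w)"])
    have "(g has_derivative g) (at u)" for u
      using linear_g by (simp add: bounded_linear_imp_has_derivative linear_conv_bounded_linear)
    from has_derivative_compose[OF this der]
    show "((\<lambda>u. chart_ext c f (g u)) has_derivative (\<lambda>w. D (g u) (g w))) (at u)" for u .
    show "continuous_on UNIV (\<lambda>u. D (g u) (g (g' v)))"
      unfolding D_def by (rule integrand_continuous_g[OF c int])
    show "compact (g' ` ?K)" by (intro compact_continuous_image continuous_g' KI)
    fix u assume u: "u \<notin> g' ` ?K"
    then have gu: "g u \<notin> ?K" using g'_g by (metis imageI)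
    then show "chart_ext c f (g u) = 0" by (rule zero)
    show "D (g u) (g (g' v)) = 0"
      using supported_0[OF c supp _ gu] by (simp add: D_def chart_ext_def)
  qed
  then show "chart_integral c (\<lambda>x. frechet_derivative f (at x) v) = 0"
    by (simp add: chart_integral_def D_def g_g')
qed

text \<open>A top form changes by the real determinant of the Jacobian and the Lebesgue integral by
  its absolute value; for complex-linear Jacobians the two agree. The constant \<kappa> allows a
  complex value to be rotated before its real part is taken.\<close>

lemma chart_integral_invariant:
  assumes c: "c \<in> A" "c' \<in> A"
    and comp: "\<And>x vs. x \<in> overlap c c' \<Longrightarrow> \<zeta> c x vs = \<zeta> c' (transition c c' x) (map (d_transition c c' x) vs)"
    and alt: "\<And>y. y \<in> chart_image c' \<Longrightarrow> alternating (2 * CARD('n)) (\<zeta> c' y)"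
    and E: "length E = 2 * CARD('n)"
    and cont: "continuous_on (chart_image c) (\<lambda>x. \<zeta> c x E)" "continuous_on (chart_image c') (\<lambda>x. \<zeta> c' x E)"
    and K: "compact K" "K \<subseteq> fst c" "K \<subseteq> fst c'"
    and supp: "\<And>x. x \<in> chart_image c \<Longrightarrow> chart_inv c x \<notin> K \<Longrightarrow> \<zeta> c x E = 0"
      "\<And>x. x \<in> chart_image c' \<Longrightarrow> chart_inv c' x \<notin> K \<Longrightarrow> \<zeta> c' x E = 0"
  shows "chart_integral c (\<lambda>x. Re (\<kappa> * \<zeta> c x E)) = chart_integral c' (\<lambda>x. Re (\<kappa> * \<zeta> c' x E))"
proof -
  let ?F = "\<lambda>c x. Re (\<kappa> * \<zeta> c x E)"
  have int: "integrand c (?F c)" "integrand c' (?F c')"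
    unfolding integrand_def supported_def using cont K supp
    by (auto intro!: exI[of _ K] continuous_on_diff continuous_on_Re continuous_on_Im continuous_on_mult
        continuous_on_const)
  let ?S = "g -` overlap c c'"
  let ?\<phi> = "\<lambda>u. g' (transition c c' (g u))"
  let ?\<phi>' = "\<lambda>u. g' \<circ> d_transition c c' (g u) \<circ> g"
  have image: "?\<phi> ` ?S = g -` overlap c' c"
  proof (intro equalityI subsetI)
    fix y assume "y \<in> ?\<phi> ` ?S"
    then show "y \<in> g -` overlap c' c"
      using transition_overlap[OF c(1), of c'] by (auto simp: g_g')
  next
    fix y assume "y \<in> g -` overlap c' c"
    then obtain x where x: "x \<in> overlap c c'" "g y = transition c c' x"
      using transition_overlap[OF c(1), of c'] by auto
    then have "g' x \<in> ?S" "?\<phi> (g' x) = y" by (simp_all add: g_g' g'_g flip: x(2))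
    then show "y \<in> ?\<phi> ` ?S" by (metis imageI)
  qed
  have zero: "chart_ext c (?F c) x = 0" if "x \<notin> overlap c c'" for x
  proof (cases "x \<in> chart_image c")
    case True
    then have "chart_inv c x \<notin> K" using that K(3) by (auto simp: overlap_eq[OF c(1)])
    from supp(1)[OF True this] show ?thesis by (simp add: chart_ext_def)
  qed (simp add: chart_ext_def)
  have zero': "chart_ext c' (?F c') x = 0" if "x \<notin> overlap c' c" for x
  proof (cases "x \<in> chart_image c'")
    case True
    then have "chart_inv c' x \<notin> K" using that K(2) by (auto simp: overlap_eq[OF c(2)])
    from supp(2)[OF True this] show ?thesis by (simp add: chart_ext_def)
  qed (simp add: chart_ext_def)
  show ?thesis
    unfolding chart_integral_def
  proof (rule integral_lborel_change_of_variables[where S = ?S and \<phi> = ?\<phi> and \<phi>' = ?\<phi>'])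
    show "open ?S"
      using open_overlap[OF c] continuous_g[of UNIV] by (simp add: open_vimage)
    show "(?\<phi> has_derivative ?\<phi>' u) (at u)" if "u \<in> ?S" for u
    proof -
      have dg: "(g has_derivative g) (at u)"
        using linear_g by (simp add: bounded_linear_imp_has_derivative linear_conv_bounded_linear)
      have dT: "(transition c c' has_derivative d_transition c c' (g u)) (at (g u))"
        using transition_has_derivative(1)[OF c] that by simp
      have dg': "(g' has_derivative g') (at v)" for v
        using linear_g' by (simp add: bounded_linear_imp_has_derivative linear_conv_bounded_linear)
      show ?thesis
        using has_derivative_compose[OF has_derivative_compose[OF dg dT] dg'] by (simp add: o_def)
    qed
    show "inj_on ?\<phi> ?S"
    proof (rule inj_onI)
      fix u w assume *: "u \<in> ?S" "w \<in> ?S" "?\<phi> u = ?\<phi> w"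
      then have "transition c c' (g u) = transition c c' (g w)" using g_g' by metis
      then have "g u = g w" using inj_onD[OF inj_on_transition[OF c]] * by simp
      then show "u = w" using g'_g by metis
    qed
    show "chart_ext c' (?F c') (g y) = 0" if "y \<notin> ?\<phi> ` ?S" for y
      using that unfolding image by (intro zero') simp
    show "chart_ext c (?F c) (g u) = 0" if "u \<notin> ?S" for u
      using that by (intro zero) simp
    show "chart_ext c (?F c) (g u) = \<bar>det (matrix (?\<phi>' u))\<bar> * chart_ext c' (?F c') (g (?\<phi> u))" if "u \<in> ?S" for u
    proof -
      have x: "g u \<in> overlap c c'" using that by simp
      have y: "transition c c' (g u) \<in> chart_image c'" by (rule transition_in_image[OF c(1) x])
      have det: "det (matrix (?\<phi>' u)) \<ge> 0"
        by (rule det_complex_linear_nonneg[OF linear_g linear_g' g_g' g'_g linear_d_transition[OF c x]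
              transition_has_derivative(2)[OF c x]])
      have "\<zeta> c (g u) E = of_real (det (matrix (?\<phi>' u))) * \<zeta> c' (transition c c' (g u)) E"
        unfolding comp[OF x]
        by (rule alternating_top_det[OF _ linear_d_transition[OF c x] linear_g linear_g' g_g' g'_g])
          (use alt[OF y] E in simp_all)
      then have "?F c (g u) = det (matrix (?\<phi>' u)) * ?F c' (transition c c' (g u))"
        by (simp add: algebra_simps)
      then show ?thesis
        using det x y overlap_subset[of c c'] by (simp add: chart_ext_def g_g' subset_iff)
    qed
  qed (rule integrand_integrable[OF c(2) int(2)] integrand_integrable[OF c(1) int(1)])+
qed

end

section \<open>Stokes' theorem\<close>

lemma C1_on_covector_wedge:
  assumes "open S" "\<And>v. C1_on (\<lambda>x. \<theta> x v) S" "\<And>l. C1_on (\<lambda>x. \<gamma> x l) S"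
  shows "C1_on (\<lambda>x. covector_wedge (\<theta> x) (\<gamma> x) vs) S"
  unfolding covector_wedge_def asum_def
  by (intro C1_on_sum C1_on_mult C1_on_const assms)

lemma continuous_on_covector_wedge:
  assumes "\<And>v. continuous_on S (\<lambda>x. \<theta> x v)" "\<And>l. continuous_on S (\<lambda>x. \<gamma> x l)"
  shows "continuous_on S (\<lambda>x. covector_wedge (\<theta> x) (\<gamma> x) vs)"
  unfolding covector_wedge_def asum_def
  by (intro continuous_on_sum continuous_on_mult continuous_on_const assms)

lemma covector_wedge_pullback:
  assumes "\<And>v. \<theta> v = \<theta>' (L v)" "\<And>l. \<gamma> l = \<gamma>' (map L l)"
  shows "covector_wedge \<theta> \<gamma> vs = covector_wedge \<theta>' \<gamma>' (map L vs)"
proof -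
  have "\<theta> = \<theta>' \<circ> L" "\<gamma> = \<gamma>' \<circ> map L" using assms by auto
  then show ?thesis by (simp only: covector_wedge_map)
qed

lemma C1_on_differentiable: "C1_on f S \<Longrightarrow> x \<in> S \<Longrightarrow> f differentiable (at x)"
  by simp

lemma linear_fun_d: "f differentiable (at x) \<Longrightarrow> linear (fun_d f x)"
  using linear_gen_d[of f x 1 0] by (simp add: fun_d_gen)

context complex_atlas_coordinates
begin

text \<open>The sum is the integral of dG, with \<kappa> and the frame \<open>E\<close> turning it
  into a real density. As the weights are only C1, the products of their differentials with G are
  merely continuous and are not differentiated any further.\<close>

lemma stokes:
  fixes \<rho> :: "'a \<Rightarrow> 'a \<Rightarrow> real" and G :: "('a, 'n) dform"
  assumes I: "finite I" "\<And>i. i \<in> I \<Longrightarrow> ch i \<in> A" "\<And>i. i \<in> I \<Longrightarrow> compact (K i)"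
    "\<And>i. i \<in> I \<Longrightarrow> K i \<subseteq> fst (ch i)" "\<And>i. i \<in> I \<Longrightarrow> C1_function (\<rho> i)"
    "\<And>i q. i \<in> I \<Longrightarrow> q \<notin> K i \<Longrightarrow> \<rho> i q = 0" "\<And>q. (\<Sum>i\<in>I. \<rho> i q) = 1"
    and G: "\<And>c vs. c \<in> A \<Longrightarrow> C1_on (\<lambda>x. G c x vs) (chart_image c)"
    "\<And>c x. c \<in> A \<Longrightarrow> x \<in> chart_image c \<Longrightarrow> alternating m (G c x)"
    "\<And>c c' x vs. c \<in> A \<Longrightarrow> c' \<in> A \<Longrightarrow> x \<in> overlap c c' \<Longrightarrow>
      G c x vs = G c' (transition c c' x) (map (d_transition c c' x) vs)"
    and E: "length E = 2 * CARD('n)" and m: "Suc m = 2 * CARD('n)"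
  shows "(\<Sum>i\<in>I. chart_integral (ch i) (\<lambda>x. Re (\<kappa> * (of_real (\<rho> i (chart_inv (ch i) x)) *
      asum (\<lambda>v l. fun_d (\<lambda>y. G (ch i) y l) x v) E)))) = 0"
proof -
  define r where "r = (\<lambda>i c x. of_real (\<rho> i (chart_inv c x)) :: complex)"
  define Z where "Z = (\<lambda>i c x. covector_wedge (fun_d (r i c) x) (G c x))"
  have r_C1: "C1_on (r i c) (chart_image c)" if "i \<in> I" "c \<in> A" for i c
    unfolding r_def
    by (rule Ck_on_bounded_linear[OF open_chart_image bounded_linear_of_real])
      (use I(5) that in \<open>auto simp: C1_function_def simp del: Ck_on.simps\<close>)
  note r_diff = C1_on_differentiable[OF r_C1]
  note G_diff = C1_on_differentiable[OF G(1)]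
  have cont_dr: "continuous_on (chart_image c) (\<lambda>x. fun_d (r i c) x v)" if "i \<in> I" "c \<in> A" for i c v
    unfolding fun_d_def by (rule C1_on_frechet_continuous[OF r_C1[OF that]])
  have contZ: "continuous_on (chart_image c) (\<lambda>x. Z i c x vs)" if "i \<in> I" "c \<in> A" for i c vs
    unfolding Z_def by (intro continuous_on_covector_wedge cont_dr C1_on_continuous G that)
  have r_0: "r i c x = 0" if "i \<in> I" "chart_inv c x \<notin> K i" for i c x
    using that I(6) by (simp add: r_def)
  have dr_0: "fun_d (r i c) x v = 0" if i: "i \<in> I" and c: "c \<in> A" and x: "x \<in> chart_image c" "chart_inv c x \<notin> K i" for i c x v
  proof -
    let ?U = "chart_image c \<inter> chart_inv c -` (- K i)"
    have "open ?U"
      using I(3)[OF i] by (intro continuous_open_preimage[OF continuous_on_chart_inv[OF c] open_chart_image[OF c]])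
        (simp add: compact_imp_closed open_Compl)
    then have "gen_d 1 0 (r i c) x v = gen_d 1 0 (\<lambda>y. 0) x v"
      using x r_0[OF i] by (intro gen_d_cong[of ?U]) auto
    then show ?thesis by (simp add: fun_d_gen)
  qed
  have Z_0: "Z i c x vs = 0" if "i \<in> I" "c \<in> A" "x \<in> chart_image c" "chart_inv c x \<notin> K i" for i c x vs
    using dr_0[OF that] by (simp add: Z_def covector_wedge_def)
  have Z_alt: "alternating (2 * CARD('n)) (Z i c x)" if "i \<in> I" "c \<in> A" "x \<in> chart_image c" for i c x
    unfolding Z_def m[symmetric]
    by (intro alternating_covector_wedge linear_fun_d r_diff G that)
  have r_comp: "r i c x = r i c' (transition c c' x)" if "c \<in> A" "c' \<in> A" "x \<in> overlap c c'" for i c c' x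
    using that by (auto simp: r_def overlap_def transition_chart chart_inv_chart)
  have Z_comp: "Z i c x vs = Z i c' (transition c c' x) (map (d_transition c c' x) vs)"
    if i: "i \<in> I" and c: "c \<in> A" "c' \<in> A" "x \<in> overlap c c'" for i c c' x vs
    unfolding Z_def
  proof (rule covector_wedge_pullback)
    fix v
    have "gen_d 1 0 (r i c) x v = gen_d 1 0 (\<lambda>y. r i c' (transition c c' y)) x v"
      by (rule gen_d_cong[OF open_overlap[OF c(1,2)] c(3)]) (rule r_comp[OF c(1,2)])
    also have "\<dots> = gen_d 1 0 (r i c') (transition c c' x) (d_transition c c' x v)"
      by (rule gen_d_transition(1)[OF c r_diff[OF i c(2) transition_in_image[OF c(1,3)]]])
    finally show "fun_d (r i c) x v = fun_d (r i c') (transition c c' x) (d_transition c c' x v)"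
      by (simp only: fun_d_gen)
  qed (rule G(3)[OF c])
  \<comment> \<open>In the chart of \<open>j\<close> the factor \<open>r j\<close> confines the
    support to \<open>K j\<close>; in the chart of \<open>i\<close>, treated next, the factor
    \<open>Z i\<close> confines it to \<open>K i\<close>.\<close>
  have int_rZ: "integrand (ch j) (\<lambda>x. Re (\<kappa> * (r j (ch j) x * Z i (ch j) x E)))" if "i \<in> I" "j \<in> I" for i j
    unfolding integrand_def supported_def using I(2-4)[OF that(2)] r_0[OF that(2)]
    by (intro conjI exI[of _ "K j"] continuous_on_Re continuous_on_mult continuous_on_const contZ that
        C1_on_continuous[OF r_C1]) auto
  have int_rZ': "integrand (ch i) (\<lambda>x. Re (\<kappa> * (r j (ch i) x * Z i (ch i) x E)))" if "i \<in> I" "j \<in> I" for i j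
    unfolding integrand_def supported_def using I(2-4)[OF that(1)] Z_0[OF that(1) I(2)[OF that(1)]]
    by (intro conjI exI[of _ "K i"] continuous_on_Re continuous_on_mult continuous_on_const contZ that
        C1_on_continuous[OF r_C1]) auto
  have sum_r: "(\<Sum>j\<in>I. r j c x) = 1" for c x
    unfolding r_def of_real_sum[symmetric] I(7) by simp
  have inv: "chart_integral (ch i) (\<lambda>x. Re (\<kappa> * (r j (ch i) x * Z i (ch i) x E)))
      = chart_integral (ch j) (\<lambda>x. Re (\<kappa> * (r j (ch j) x * Z i (ch j) x E)))"
    if i: "i \<in> I" and j: "j \<in> I" for i j
  proof (rule chart_integral_invariant[where \<zeta> = "\<lambda>c x vs. r j c x * Z i c x vs" and K = "K i \<inter> K j"])
    note ci = I(2)[OF i] and cj = I(2)[OF j]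
    show "ch i \<in> A" "ch j \<in> A" by (fact ci cj)+
    show "r j (ch i) x * Z i (ch i) x vs = r j (ch j) (transition (ch i) (ch j) x) *
        Z i (ch j) (transition (ch i) (ch j) x) (map (d_transition (ch i) (ch j) x) vs)"
      if "x \<in> overlap (ch i) (ch j)" for x vs
      using r_comp[OF ci cj that] Z_comp[OF i ci cj that] by simp
    show "alternating (2 * CARD('n)) (\<lambda>vs. r j (ch j) y * Z i (ch j) y vs)" if "y \<in> chart_image (ch j)" for y
      using alternating_sum_mult[of "{()}" _ "\<lambda>_. Z i (ch j) y" "\<lambda>_. r j (ch j) y"] Z_alt[OF i cj that] by simp
    show "continuous_on (chart_image (ch i)) (\<lambda>x. r j (ch i) x * Z i (ch i) x E)"
      "continuous_on (chart_image (ch j)) (\<lambda>x. r j (ch j) x * Z i (ch j) x E)"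
      by (intro continuous_on_mult contZ C1_on_continuous[OF r_C1] i j ci cj)+
    show "compact (K i \<inter> K j)" by (intro compact_Int I i j)
    show "K i \<inter> K j \<subseteq> fst (ch i)" "K i \<inter> K j \<subseteq> fst (ch j)" using I(4) i j by auto
    show "r j (ch i) x * Z i (ch i) x E = 0" if "x \<in> chart_image (ch i)" "chart_inv (ch i) x \<notin> K i \<inter> K j" for x
      using that r_0[OF j, of "ch i" x] Z_0[OF i ci] by auto
    show "r j (ch j) x * Z i (ch j) x E = 0" if "x \<in> chart_image (ch j)" "chart_inv (ch j) x \<notin> K i \<inter> K j" for x
      using that r_0[OF j, of "ch j" x] Z_0[OF i cj] by auto
  qed (rule E)
  have sum_Z: "(\<Sum>i\<in>I. Z i c x E) = 0" if "c \<in> A" "x \<in> chart_image c" for c x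
  proof -
    have "(\<Sum>i\<in>I. fun_d (r i c) x v) = 0" for v
    proof -
      have "gen_d 1 0 (\<lambda>y. \<Sum>i\<in>I. r i c y) x v = (\<Sum>i\<in>I. gen_d 1 0 (r i c) x v)"
        by (rule gen_d_sum[OF I(1)]) (rule r_diff[OF _ that])
      moreover have "gen_d 1 0 (\<lambda>y. 1) x v = 0"
        by (subst gen_d_eq[where f' = "\<lambda>_. 0"]) auto
      ultimately show ?thesis by (simp add: sum_r fun_d_gen)
    qed
    then have "asum (\<lambda>v l. (\<Sum>i\<in>I. fun_d (r i c) x v) * G c x l) E = 0" by simp
    moreover have "asum (\<lambda>v l. (\<Sum>i\<in>I. fun_d (r i c) x v) * G c x l) E = (\<Sum>i\<in>I. Z i c x E)"
      unfolding Z_def covector_wedge_def asum_def sum_distrib_left sum_distrib_right by (rule sum.swap)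
    ultimately show ?thesis by simp
  qed
  have by_parts: "chart_integral (ch i) (\<lambda>x. Re (\<kappa> * (r i (ch i) x * asum (\<lambda>v l. fun_d (\<lambda>y. G (ch i) y l) x v) E)))
      = - chart_integral (ch i) (\<lambda>x. Re (\<kappa> * Z i (ch i) x E))" if i: "i \<in> I" for i
  proof -
    define c where "c = ch i"
    have c: "c \<in> A" using I(2)[OF i] by (simp add: c_def)
    define D where "D = (\<lambda>x. asum (\<lambda>v l. fun_d (\<lambda>y. G c y l) x v) E)"
    \<comment> \<open>Up to sign this is the coefficient of \<rho> G that omits the
      \<open>k\<close>-th vector of \<open>E\<close>, multiplied by \<kappa> and made real. Its
      derivative along that vector gives the \<open>k\<close>-th term of d(\<rho> G).\<close>
    define f where "f = (\<lambda>k x. Re (\<kappa> * (r i c x * G c x (remove_nth k E))))"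
    have rG_C1: "C1_on (\<lambda>x. r i c x * G c x l) (chart_image c)" for l
      by (intro C1_on_mult r_C1 G i c)
    have "C1_on (f k) (chart_image c)" for k
      unfolding f_def
      using Ck_on_bounded_linear[OF open_chart_image[OF c] _ rG_C1, of "\<lambda>z. Re (\<kappa> * z)"]
        bounded_linear_compose[OF bounded_linear_Re bounded_linear_mult_right[of \<kappa>]] by (simp del: Ck_on.simps)
    moreover have "supported c (K i) (f k)" for k
      using r_0[OF i] by (simp add: supported_def f_def)
    ultimately have f: "chart_integral c (\<lambda>x. frechet_derivative (f k) (at x) v) = 0"
        "integrand c (\<lambda>x. frechet_derivative (f k) (at x) v)" for k v
      using chart_integral_derivative[OF c _ I(3)[OF i], of "f k" v] I(4)[OF i] by (auto simp: c_def simp del: Ck_on.simps)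
    have df: "frechet_derivative (f k) (at x) v = Re (\<kappa> * fun_d (\<lambda>y. r i c y * G c y (remove_nth k E)) x v)"
      if "x \<in> chart_image c" for k x v
    proof -
      have "(f k has_derivative (\<lambda>v. Re (\<kappa> * fun_d (\<lambda>y. r i c y * G c y (remove_nth k E)) x v))) (at x)"
        unfolding f_def fun_d_frechet
        by (intro has_derivative_Re has_derivative_mult_right C1_on_has_derivative[OF rG_C1 that])
      then show ?thesis by (simp add: frechet_derivative_eq)
    qed
    have "chart_integral c (\<lambda>x. Re (\<kappa> * Z i c x E) + Re (\<kappa> * (r i c x * D x)))
        = chart_integral c (\<lambda>x. \<Sum>k<length E. (- 1) ^ k * frechet_derivative (f k) (at x) (E ! k))"
    proof (rule chart_integral_cong)
      fix x assume x: "x \<in> chart_image c"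
      have "Z i c x E + r i c x * D x = asum (\<lambda>v l. fun_d (\<lambda>y. r i c y * G c y l) x v) E"
        unfolding Z_def D_def by (rule asum_fun_d_scale[OF r_diff[OF i c x] G_diff[OF c x], symmetric])
      also have "\<kappa> * \<dots> = (\<Sum>k<length E. of_real ((- 1) ^ k) * (\<kappa> * fun_d (\<lambda>y. r i c y * G c y (remove_nth k E)) x (E ! k)))"
        by (simp add: asum_def sum_distrib_left mult_ac)
      also have "Re \<dots> = (\<Sum>k<length E. (- 1) ^ k * frechet_derivative (f k) (at x) (E ! k))"
      proof -
        have "Re (of_real a * z) = a * Re z" for a z by simp
        then show ?thesis unfolding Re_sum df[OF x] by (simp only:)
      qed
      finally show "Re (\<kappa> * Z i c x E) + Re (\<kappa> * (r i c x * D x))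
          = (\<Sum>k<length E. (- 1) ^ k * frechet_derivative (f k) (at x) (E ! k))"
        by (simp add: distrib_left)
    qed
    also have "\<dots> = 0"
    proof -
      have "integrand c (\<lambda>x. (- 1) ^ k * frechet_derivative (f k) (at x) v)" for k v
        using f(2)[of k v] unfolding integrand_def supported_def
        by (auto intro!: continuous_on_mult continuous_on_const)
      then show ?thesis
        by (subst chart_integral_sum[OF c]) (simp_all add: chart_integral_cmult f(1))
    qed
    finally have "chart_integral c (\<lambda>x. Re (\<kappa> * Z i c x E) + Re (\<kappa> * (r i c x * D x))) = 0" .
    moreover have "integrand c (\<lambda>x. Re (\<kappa> * Z i c x E))"
      unfolding integrand_def supported_def using I(3,4)[OF i] Z_0[OF i c]
      by (intro conjI exI[of _ "K i"] continuous_on_Re continuous_on_mult continuous_on_const contZ i c) (auto simp: c_def)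
    moreover have "integrand c (\<lambda>x. Re (\<kappa> * (r i c x * D x)))"
      unfolding integrand_def supported_def
    proof (intro conjI exI[of _ "K i"])
      have "continuous_on (chart_image c) D"
        unfolding D_def asum_def fun_d_def
        by (intro continuous_on_sum continuous_on_mult continuous_on_const C1_on_frechet_continuous G c)
      then show "continuous_on (chart_image c) (\<lambda>x. Re (\<kappa> * (r i c x * D x)))"
        by (intro continuous_on_Re continuous_on_mult continuous_on_const C1_on_continuous[OF r_C1] i c)
    qed (use I(3,4)[OF i] r_0[OF i] in \<open>auto simp: c_def\<close>)
    ultimately have "chart_integral c (\<lambda>x. Re (\<kappa> * Z i c x E)) + chart_integral c (\<lambda>x. Re (\<kappa> * (r i c x * D x))) = 0"
      by (simp only: chart_integral_add[OF c])
    then show ?thesis by (simp add: c_def D_def)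
  qed
  have "(\<Sum>i\<in>I. chart_integral (ch i) (\<lambda>x. Re (\<kappa> * Z i (ch i) x E)))
      = (\<Sum>i\<in>I. \<Sum>j\<in>I. chart_integral (ch i) (\<lambda>x. Re (\<kappa> * (r j (ch i) x * Z i (ch i) x E))))"
  proof (rule sum.cong)
    fix i assume i: "i \<in> I"
    have "Re (\<kappa> * Z i (ch i) x E) = (\<Sum>j\<in>I. Re (\<kappa> * (r j (ch i) x * Z i (ch i) x E)))" for x
      unfolding Re_sum[symmetric] sum_distrib_left[symmetric] sum_distrib_right[symmetric] sum_r by simp
    then show "chart_integral (ch i) (\<lambda>x. Re (\<kappa> * Z i (ch i) x E))
        = (\<Sum>j\<in>I. chart_integral (ch i) (\<lambda>x. Re (\<kappa> * (r j (ch i) x * Z i (ch i) x E))))"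
      by (simp only: chart_integral_sum[OF I(2)[OF i] int_rZ'[OF i]])
  qed simp
  also have "\<dots> = (\<Sum>j\<in>I. \<Sum>i\<in>I. chart_integral (ch j) (\<lambda>x. Re (\<kappa> * (r j (ch j) x * Z i (ch j) x E))))"
    by (subst sum.swap) (simp only: inv cong: sum.cong)
  also have "\<dots> = (\<Sum>j\<in>I. chart_integral (ch j) (\<lambda>x. \<Sum>i\<in>I. Re (\<kappa> * (r j (ch j) x * Z i (ch j) x E))))"
    by (rule sum.cong) (simp_all only: chart_integral_sum[OF I(2) int_rZ])
  also have "\<dots> = (\<Sum>j\<in>I. chart_integral (ch j) (\<lambda>x. 0))"
  proof (intro sum.cong refl chart_integral_cong)
    fix j x assume "j \<in> I" "x \<in> chart_image (ch j)"
    then show "(\<Sum>i\<in>I. Re (\<kappa> * (r j (ch j) x * Z i (ch j) x E))) = 0"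
      unfolding Re_sum[symmetric] sum_distrib_left[symmetric] using sum_Z[OF I(2)] by simp
  qed
  also have "\<dots> = 0" by (simp add: chart_integral_def chart_ext_def)
  finally show ?thesis
    using by_parts by (simp add: sum_negf r_def cong: sum.cong)
qed

end

section \<open>Vanishing of closed (1,0)- and (0,1)-forms\<close>

lemma covector_wedge_uminus: "covector_wedge \<theta> (\<lambda>l. - \<gamma> l) vs = - covector_wedge \<theta> \<gamma> vs"
  by (simp add: covector_wedge_def asum_neg)

lemma linear_cnj_compose: "linear f \<Longrightarrow> linear (\<lambda>v. cnj (f v))"
  using linear_compose[of f cnj] by (simp add: o_def bounded_linear.linear[OF bounded_linear_cnj])

lemma hermitian_metric_positive_form:
  assumes "hermitian_metric A \<omega>" "c \<in> A" "x \<in> chart_image c"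
  shows "positive_form (\<omega> c x)"
proof -
  have \<omega>: "\<omega> \<in> pq_forms A 1 1" using assms by (simp add: hermitian_metric_def)
  then have alt: "alternating 2 (\<omega> c x)" and "alt_type 1 1 (\<omega> c x)"
    using assms(2,3) by (auto simp: pq_forms_def dforms_def one_add_one[symmetric] simp del: one_add_one)
  then show ?thesis
    using assms unfolding positive_form_def alt_type_11_iff[OF alt] hermitian_metric_def by blast
qed

context complex_atlas_coordinates
begin

text \<open>An adapted frame is the image of the standard one under a complex-linear map. The
  determinant is nonnegative and its product with the value on the standard frame is positive, so
  this value is positive too.\<close>

lemma wedge_positive_power_frame:
  fixes \<theta> :: "complex^'n \<Rightarrow> complex" and \<omega>
  defines "H \<equiv> covector_wedge \<theta> (covector_wedge (\<lambda>v. cnj (\<theta> v)) (alt_power \<omega> (CARD('n) - 1)))"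
  assumes pos: "positive_form \<omega>" and \<theta>: "linear \<theta>" and \<theta>i: "\<And>v. \<theta> (\<i> *s v) = t * \<theta> v"
    and t: "t = \<i> \<or> t = - \<i>" and alt: "alternating (2 * CARD('n)) H"
  shows "Re (t * H standard_frame) \<ge> 0" and "Re (t * H standard_frame) = 0 \<Longrightarrow> \<theta> v = 0"
proof -
  have *: "Re (t * H standard_frame) > 0" if a: "\<theta> a \<noteq> 0" for a
  proof -
    obtain us where us: "length us = CARD('n)" "Re (t * H (complex_pairs us)) > 0"
      using wedge_positive_power_pos[OF pos \<theta> \<theta>i t a] by (auto simp: H_def)
    obtain L :: "complex^'n \<Rightarrow> complex^'n" where L: "linear L" "\<And>c v. L (c *s v) = c *s L v"
      "map L standard_frame = complex_pairs us"
      by (rule standard_frame_image[OF us(1)]) (rule that)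
    have "H (map L standard_frame) = of_real (det (matrix (g' \<circ> L \<circ> g))) * H standard_frame"
      by (rule alternating_top_det[OF _ L(1) linear_g linear_g' g_g' g'_g]) (use alt in simp_all)
    then have "t * H (complex_pairs us) = of_real (det (matrix (g' \<circ> L \<circ> g))) * (t * H standard_frame)"
      by (simp add: L(3))
    moreover have "Re (of_real d * z) = d * Re z" for d z by simp
    ultimately have "det (matrix (g' \<circ> L \<circ> g)) * Re (t * H standard_frame) > 0"
      using us(2) by (simp only:)
    moreover have "det (matrix (g' \<circ> L \<circ> g)) \<ge> 0"
      by (rule det_complex_linear_nonneg[OF linear_g linear_g' g_g' g'_g L(1,2)])
    ultimately show ?thesis by (simp add: zero_less_mult_iff)
  qed
  show "Re (t * H standard_frame) \<ge> 0"
  proof (cases "\<exists>a. \<theta> a \<noteq> 0")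
    case False
    then have "H standard_frame = 0" by (simp add: H_def covector_wedge_def)
    then show ?thesis by simp
  qed (use * in \<open>auto intro: less_imp_le\<close>)
  show "Re (t * H standard_frame) = 0 \<Longrightarrow> \<theta> v = 0" using *[of v] by auto
qed

lemma closed_typed_one_form_eq_0:
  assumes compact: "compact (UNIV :: 'a set)" and n: "CARD('n) \<ge> 2"
    and balanced: "degenerate_balanced_metric A \<omega>" and t: "t = \<i> \<or> t = - \<i>"
    and \<theta>: "\<theta> \<in> typed_one_forms t" and closed: "ext_d A \<theta> = 0"
  shows "\<theta> = 0"
proof -
  let ?n = "CARD('n)" and ?E = "standard_frame :: (complex^'n) list"
  note cf\<theta> = typed_one_forms_chart_forms[OF \<theta>] and comp\<theta> = typed_one_forms_compatible[OF \<theta>]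
  have herm: "hermitian_metric A \<omega>" using balanced by (simp add: degenerate_balanced_metric_def)
  \<comment> \<open>As \<open>CARD('n) \<ge> 2\<close>, the degree is not 0, which excludes the
    exceptional case of \<open>d_exact_forms\<close>.\<close>
  obtain \<Gamma> where \<Gamma>: "\<Gamma> \<in> dforms A (2 * (?n - 1) - 1)" and \<omega>\<Gamma>: "wedge_power \<omega> (?n - 1) = ext_d A \<Gamma>"
    using balanced n by (auto simp: degenerate_balanced_metric_def d_exact_forms_def split: if_splits)
  have cf\<Gamma>: "\<Gamma> \<in> chart_forms A (2 * (?n - 1) - 1)" and comp\<Gamma>: "compatible A \<Gamma>"
    using \<Gamma> by (auto simp: dforms_eq)
  \<comment> \<open>The degree 2n - 3 of \<Gamma>; the two covectors and d raise it by 3 to the top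
    degree.\<close>
  define m where "m = 2 * (?n - 1) - 1"
  have m: "Suc (Suc (Suc m)) = 2 * ?n" using n by (simp add: m_def)
  have cfd\<Gamma>: "ext_d A \<Gamma> \<in> chart_forms A (Suc m)"
    using ext_op_chart_forms[OF cf\<Gamma>, of 1 0] by (simp add: ext_d_def fun_d_gen m_def)
  define th thb where "th = (\<lambda>c x v. \<theta> c x [v])" and "thb = (\<lambda>c x v. cnj (\<theta> c x [v]))"
  define G H where "G = (\<lambda>c x. covector_wedge (th c x) (covector_wedge (thb c x) (\<Gamma> c x)))"
    and "H = (\<lambda>c x. covector_wedge (th c x) (covector_wedge (thb c x) (ext_d A \<Gamma> c x)))"
  have lin: "linear (th c x)" "linear (thb c x)" if "c \<in> A" "x \<in> chart_image c" for c x
    using alternating_linear[OF chart_forms_alternating[OF cf\<theta> that], of "[]" "[]"]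
    by (auto simp: th_def thb_def intro: linear_cnj_compose)
  have th_C1: "C1_on (\<lambda>x. th c x v) (chart_image c)" "C1_on (\<lambda>x. thb c x v) (chart_image c)"
    if "c \<in> A" for c v
    using smooth_on_C1_on[OF chart_forms_smooth[OF cf\<theta> that, of "[v]"]]
      Ck_on_bounded_linear[OF open_chart_image[OF that] bounded_linear_cnj]
    unfolding th_def thb_def by blast+
  note diff\<theta> = C1_on_differentiable[OF th_C1(1)] C1_on_differentiable[OF th_C1(2)]
  have inner_C1: "C1_on (\<lambda>x. covector_wedge (thb c x) (\<Gamma> c x) vs) (chart_image c)" if "c \<in> A" for c vs
    by (intro C1_on_covector_wedge open_chart_image th_C1 smooth_on_C1_on chart_forms_smooth[OF cf\<Gamma>] that)
  have G_C1: "C1_on (\<lambda>x. G c x vs) (chart_image c)" if "c \<in> A" for c vs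
    unfolding G_def by (intro C1_on_covector_wedge open_chart_image th_C1 inner_C1 that)
  have G_alt: "alternating (Suc (Suc m)) (G c x)" if "c \<in> A" "x \<in> chart_image c" for c x
    unfolding G_def m_def by (intro alternating_covector_wedge lin chart_forms_alternating[OF cf\<Gamma>] that)
  have H_alt: "alternating (2 * ?n) (H c x)" if "c \<in> A" "x \<in> chart_image c" for c x
    unfolding H_def m[symmetric] by (intro alternating_covector_wedge lin chart_forms_alternating[OF cfd\<Gamma>] that)
  have G_comp: "G c x vs = G c' (transition c c' x) (map (d_transition c c' x) vs)"
    if "c \<in> A" "c' \<in> A" "x \<in> overlap c c'" for c c' x vs
    unfolding G_def th_def thb_def
    by (intro covector_wedge_pullback) (simp_all add: compatible_overlap[OF comp\<theta> that] compatible_overlap[OF comp\<Gamma> that])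
  \<comment> \<open>Moving d past \<open>th\<close> and past \<open>thb\<close> gives two minus
    signs, which cancel.\<close>
  have dG: "asum (\<lambda>v l. fun_d (\<lambda>y. G c y l) x v) vs = H c x vs"
    if c: "c \<in> A" and x: "x \<in> chart_image c" for c x vs
  proof -
    have sym: "fun_d (\<lambda>y. th c y w) x v = fun_d (\<lambda>y. th c y v) x w" for v w
      using ext_op_one_form[OF c x, of fun_d \<theta> v w] closed by (simp add: ext_d_def th_def)
    have cnj: "fun_d (\<lambda>y. thb c y w) x v = cnj (fun_d (\<lambda>y. th c y w) x v)" for v w
    proof -
      have "((\<lambda>y. th c y w) has_derivative fun_d (\<lambda>y. th c y w) x) (at x)"
        using C1_on_has_derivative[OF th_C1(1)[OF c] x] by (simp add: fun_d_frechet)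
      then have "((\<lambda>y. thb c y w) has_derivative (\<lambda>v. cnj (fun_d (\<lambda>y. th c y w) x v))) (at x)"
        unfolding th_def thb_def by (rule has_derivative_cnj)
      then show ?thesis by (simp add: fun_d_eq)
    qed
    have d\<Gamma>: "asum (\<lambda>v l. fun_d (\<lambda>y. \<Gamma> c y l) x v) = ext_d A \<Gamma> c x"
      by (simp add: fun_eq_iff ext_d_def ext_op_apply[OF c x])
    have "asum (\<lambda>v l. fun_d (\<lambda>y. covector_wedge (thb c y) (\<Gamma> c y) l) x v)
        = (\<lambda>vs. - covector_wedge (thb c x) (ext_d A \<Gamma> c x) vs)"
      unfolding d\<Gamma>[symmetric]
      by (intro ext asum_fun_d_covector_wedge diff\<theta> chart_forms_differentiable[OF cf\<Gamma>] c x)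
        (simp add: cnj sym)
    moreover have "asum (\<lambda>v l. fun_d (\<lambda>y. G c y l) x v) vs
        = - covector_wedge (th c x) (asum (\<lambda>v l. fun_d (\<lambda>y. covector_wedge (thb c y) (\<Gamma> c y) l) x v)) vs"
      unfolding G_def
      by (intro asum_fun_d_covector_wedge diff\<theta> C1_on_differentiable[OF inner_C1] c x) (rule sym)
    ultimately show ?thesis by (simp add: covector_wedge_uminus H_def)
  qed
  have H_pos: "Re (t * H c x ?E) \<ge> 0" "Re (t * H c x ?E) = 0 \<Longrightarrow> \<theta> c x [v] = 0"
    if c: "c \<in> A" and x: "x \<in> chart_image c" for c x v
  proof -
    have "ext_d A \<Gamma> c x = alt_power (\<omega> c x) (?n - 1)"
      unfolding \<omega>\<Gamma>[symmetric] by (simp add: wedge_power_def)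
    then have H: "H c x = covector_wedge (th c x) (covector_wedge (\<lambda>v. cnj (th c x v)) (alt_power (\<omega> c x) (?n - 1)))"
      by (simp add: H_def th_def thb_def)
    note pos = wedge_positive_power_frame[OF hermitian_metric_positive_form[OF herm c x] lin(1)[OF c x] _ t
        H_alt[OF c x, unfolded H], folded H]
    have i: "th c x (\<i> *s v) = t * th c x v" for v
      unfolding th_def by (rule typed_one_forms_i[OF \<theta> c x])
    show "Re (t * H c x ?E) \<ge> 0" by (rule pos(1)[OF i])
    show "Re (t * H c x ?E) = 0 \<Longrightarrow> \<theta> c x [v] = 0" using pos(2)[OF i, of v] by (simp add: th_def)
  qed
  obtain I :: "'a set" and ch K and \<rho> :: "'a \<Rightarrow> 'a \<Rightarrow> real" where I: "finite I" "\<And>i. i \<in> I \<Longrightarrow> ch i \<in> A" "\<And>i. i \<in> I \<Longrightarrow> compact (K i)"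
    "\<And>i. i \<in> I \<Longrightarrow> K i \<subseteq> fst (ch i)" "\<And>i. i \<in> I \<Longrightarrow> C1_function (\<rho> i)" "\<And>i q. i \<in> I \<Longrightarrow> \<rho> i q \<ge> 0"
    "\<And>i q. i \<in> I \<Longrightarrow> q \<notin> K i \<Longrightarrow> \<rho> i q = 0" "\<And>q. (\<Sum>i\<in>I. \<rho> i q) = 1"
    by (rule partition_of_unity[OF compact]) (rule that)
  \<comment> \<open>The form's own eigenvalue \<open>t\<close> serves as \<kappa>: it makes the
    density nonnegative for either type.\<close>
  define F where "F = (\<lambda>i x. Re (t * (of_real (\<rho> i (chart_inv (ch i) x)) * H (ch i) x ?E)))"
  have F_eq: "F i x = \<rho> i (chart_inv (ch i) x) * Re (t * H (ch i) x ?E)" for i x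
  proof -
    have "t * (of_real (\<rho> i (chart_inv (ch i) x)) * H (ch i) x ?E)
        = of_real (\<rho> i (chart_inv (ch i) x)) * (t * H (ch i) x ?E)" by simp
    then show ?thesis unfolding F_def by (simp only: Re_complex_of_real mult_1_left) simp
  qed
  have F_nonneg: "F i x \<ge> 0" if "i \<in> I" "x \<in> chart_image (ch i)" for i x
    unfolding F_eq using I(6) H_pos(1)[OF I(2)] that by simp
  have F_int: "integrand (ch i) (F i)" if i: "i \<in> I" for i
    unfolding integrand_def
  proof (intro conjI exI[of _ "K i"])
    have "continuous_on (chart_image (ch i)) (\<lambda>x. \<rho> i (chart_inv (ch i) x))"
      using I(2,5)[OF i] by (intro C1_on_continuous) (auto simp: C1_function_def simp del: Ck_on.simps)
    moreover have "continuous_on (chart_image (ch i)) (\<lambda>x. H (ch i) x ?E)"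
      unfolding H_def
      by (intro continuous_on_covector_wedge C1_on_continuous[OF th_C1(1)] C1_on_continuous[OF th_C1(2)]
          smooth_on_continuous[OF chart_forms_smooth[OF cfd\<Gamma>]] I(2)[OF i])
    ultimately show "continuous_on (chart_image (ch i)) (F i)"
      unfolding F_def by (intro continuous_on_Re continuous_on_mult continuous_on_const continuous_on_of_real)
  qed (use I(3,4,7)[OF i] in \<open>auto simp: supported_def F_def\<close>)
  have "(\<Sum>i\<in>I. chart_integral (ch i) (\<lambda>x. Re (t * (of_real (\<rho> i (chart_inv (ch i) x)) *
      asum (\<lambda>v l. fun_d (\<lambda>y. G (ch i) y l) x v) ?E)))) = 0"
    by (rule stokes[OF I(1-5,7,8) G_C1 G_alt G_comp _ m]) simp_all
  moreover have "chart_integral (ch i) (\<lambda>x. Re (t * (of_real (\<rho> i (chart_inv (ch i) x)) *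
      asum (\<lambda>v l. fun_d (\<lambda>y. G (ch i) y l) x v) ?E))) = chart_integral (ch i) (F i)" if "i \<in> I" for i
    unfolding F_def by (rule chart_integral_cong) (simp only: dG[OF I(2)[OF that]])
  ultimately have sum0: "(\<Sum>i\<in>I. chart_integral (ch i) (F i)) = 0" by simp
  have ext_nonneg: "chart_ext (ch i) (F i) x \<ge> 0" if "i \<in> I" for i x
    using F_nonneg[OF that] by (simp add: chart_ext_def)
  then have "chart_integral (ch i) (F i) \<ge> 0" if "i \<in> I" for i
    using that by (simp add: chart_integral_def)
  then have int0: "chart_integral (ch i) (F i) = 0" if "i \<in> I" for i
    using sum0 I(1) that by (simp add: sum_nonneg_eq_0_iff)
  have F0: "F i x = 0" if i: "i \<in> I" and x: "x \<in> chart_image (ch i)" for i x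
  proof -
    have "chart_ext (ch i) (F i) (g (g' x)) = 0"
      using int0[OF i] ext_nonneg[OF i]
      by (intro nonneg_continuous_integral_0[of "\<lambda>u. chart_ext (ch i) (F i) (g u)"]
          integrand_continuous_g integrand_integrable F_int I(2) i) (simp_all add: chart_integral_def)
    then show ?thesis using x by (simp add: g_g' chart_ext_def)
  qed
  show ?thesis
  proof (rule dform_eqI[where A = A])
    fix c x vs assume c: "c \<in> A" and x: "x \<in> chart_image c"
    define p where "p = chart_inv c x"
    have p: "p \<in> fst c" "snd c p = x" using chart_inv_domain[OF c x] chart_chart_inv[OF c x] by (simp_all add: p_def)
    \<comment> \<open>Some weight is nonzero at \<open>p\<close>. In its chart the vanishing of
      \<open>F i\<close> gives \<theta> = 0 at this point, and compatibility carries this over to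
      the chart \<open>c\<close>.\<close>
    obtain i where i: "i \<in> I" "\<rho> i p \<noteq> 0"
      using I(8)[of p] by (metis sum.neutral zero_neq_one)
    then have pi: "p \<in> fst (ch i)" using I(4,7) by blast
    define y where "y = snd (ch i) p"
    have y: "y \<in> chart_image (ch i)" "chart_inv (ch i) y = p"
      using pi chart_inv_chart[OF I(2)[OF i(1)] pi] by (simp_all add: y_def chart_in_image)
    then have "Re (t * H (ch i) y ?E) = 0" using F0[OF i(1) y(1)] i(2) by (simp add: F_eq)
    then have zero: "\<theta> (ch i) y [v] = 0" for v using H_pos(2)[OF I(2)[OF i(1)] y(1)] by blast
    have "\<theta> c x [v] = 0" for v
      using compatibleD[OF comp\<theta> c I(2)[OF i(1)] p(1) pi, of "[v]"] zero by (simp add: p(2) flip: y_def)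
    then show "\<theta> c x vs = 0 c x vs"
      using alternating_1_eqI[OF chart_forms_alternating[OF cf\<theta> c x] chart_forms_alternating[OF zero_chart_forms c x]]
      by simp
  qed (use chart_forms_0[OF cf\<theta>] in auto)
qed

end

section \<open>Cohomology\<close>

lemma trivial_quotient_group:
  fixes Z :: "'f::ab_group_add set"
  assumes "0 \<in> Z" "\<And>a b. a \<in> Z \<Longrightarrow> b \<in> Z \<Longrightarrow> a + b \<in> Z" "\<And>a. a \<in> Z \<Longrightarrow> - a \<in> Z"
  shows "trivial_group (quotient_group Z Z)"
proof -
  let ?G = "\<lparr>carrier = Z, mult = (+), one = 0\<rparr>"
  have "comm_group ?G"
  proof (rule comm_groupI)
    show "\<exists>b\<in>carrier ?G. b \<otimes>\<^bsub>?G\<^esub> a = \<one>\<^bsub>?G\<^esub>" if "a \<in> carrier ?G" for a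
      using assms(3)[of a] that by (auto intro!: bexI[of _ "- a"])
  qed (use assms in \<open>auto simp: add_ac\<close>)
  then interpret comm_group ?G .
  have normal: "Z \<lhd> ?G" using subgroup_self normal_iff_subgroup by simp
  have "rcosets\<^bsub>?G\<^esub> Z = {Z}"
  proof -
    have "Z #>\<^bsub>?G\<^esub> a = Z" if "a \<in> Z" for a
      using coset_join2[of a Z] subgroup_self that by simp
    then show ?thesis using assms(1) by (auto simp: RCOSETS_def)
  qed
  then show ?thesis
    using normal.factorgroup_is_group[OF normal]
    by (simp add: trivial_group_def quotient_group_def FactGroup_def)
qed

theorem proposition1p2:
  fixes A :: "('a::{t2_space, second_countable_topology}, 'n::finite) chart set"
  assumes "complex_manifold A"
    and "compact (UNIV :: 'a set)"
    and "CARD('n) \<ge> 2"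
    and "degenerate_balanced A"
  shows "trivial_group (BC_cohomology A 1 0) \<and> trivial_group (BC_cohomology A 0 1) \<and>
    ((\<forall>v\<in>pq_forms A 1 1. ext_d A v = 0 \<longrightarrow>
        v \<in> del A ` pq_forms A 0 1 \<longrightarrow> v \<in> (\<lambda>f. del A (delbar A f)) ` pq_forms A 0 0)
     \<longrightarrow> trivial_group (deRham_cohomology A 1))"
proof -
  interpret complex_atlas A by unfold_locales (rule assms)
  \<comment> \<open>Both spaces have real dimension \<open>2 * CARD('n)\<close>.\<close>
  obtain g :: "real^('n bit0) \<Rightarrow> complex^'n" and g' where g: "linear g" "linear g'"
    "\<And>u. g' (g u) = u" "\<And>v. g (g' v) = v"
    by (rule isomorphisms_UNIV_UNIV[where 'M = "real^('n bit0)" and 'N = "complex^'n"]) (simp, blast)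
  interpret complex_atlas_coordinates A g g'    by (rule complex_atlas_coordinates.intro[OF complex_atlas_axioms complex_atlas_coordinates_axioms.intro]) (rule g)+
  obtain \<omega> where \<omega>: "degenerate_balanced_metric A \<omega>" using assms(4) by (auto simp: degenerate_balanced_def)
  have vanish: "\<theta> = 0" if "t = \<i> \<or> t = - \<i>" "\<theta> \<in> typed_one_forms t" "ext_d A \<theta> = 0" for t \<theta>
    by (rule closed_typed_one_form_eq_0[OF assms(2,3) \<omega> that])
  have d0: "typed_d s 0 = 0" for s
    using typed_d_add[OF zero_chart_forms zero_chart_forms, of s] by simp
  \<comment> \<open>In the bidegrees (1,0) and (0,1) only 0 is divided out, so the cocycles
    themselves have to vanish.\<close>
  have BC: "{\<alpha> \<in> typed_one_forms t. del A \<alpha> = 0 \<and> delbar A \<alpha> = 0} = {0}" if "t = \<i> \<or> t = - \<i>" for t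
    using vanish[OF that] zero_typed_one_forms by (auto simp: ext_d_eq del_eq delbar_eq d0)
  have "BC_cocycles A 1 0 = {0}" "BC_cocycles A 0 1 = {0}"
    using BC[of \<i>] BC[of "- \<i>"] unfolding BC_cocycles_def pq_forms_10 pq_forms_01 by auto
  then have "trivial_group (BC_cohomology A 1 0)" "trivial_group (BC_cohomology A 0 1)"
    using trivial_quotient_group[of "{0 :: ('a, 'n) dform}"]
    by (simp_all add: BC_cohomology_def del_delbar_image_def)
  moreover have "trivial_group (deRham_cohomology A 1)"
    if dd: "\<forall>v\<in>pq_forms A 1 1. ext_d A v = 0 \<longrightarrow>
        v \<in> del A ` pq_forms A 0 1 \<longrightarrow> v \<in> (\<lambda>f. del A (delbar A f)) ` pq_forms A 0 0"
  proof -
    let ?Z = "deRham_cocycles A 1"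
    have sub: "\<alpha> \<in> d_exact_forms A 1" if "\<alpha> \<in> ?Z" for \<alpha>
      using closed_one_form_exact[OF vanish dd] that by (auto simp: deRham_cocycles_def d_exact_forms_def)
    have exact: "ext_d A f \<in> ?Z" if f: "f \<in> dforms A 0" for f
    proof -
      have cf: "f \<in> chart_forms A 0" using f by (simp add: dforms_eq)
      have "ext_d A f \<in> dforms A 1"
        unfolding ext_d_typed
        by (intro dforms_add typed_one_forms_dforms[OF typed_d_function[OF f]]) auto
      moreover have "ext_d A (ext_d A f) = 0"
        using ext_op_square[OF cf, of 1 0] by (simp add: ext_d_def fun_d_gen)
      ultimately show ?thesis by (simp add: deRham_cocycles_def)
    qed
    have eq: "d_exact_forms A 1 = ?Z"
      using sub exact by (auto simp: d_exact_forms_def)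
    have "trivial_group (quotient_group ?Z ?Z)"
    proof (rule trivial_quotient_group)
      have cf: "\<alpha> \<in> chart_forms A 1" if "\<alpha> \<in> ?Z" for \<alpha> using that by (simp add: deRham_cocycles_def dforms_eq)
      have op: "ext_d A = ext_op (gen_d 1 0) A" by (simp add: ext_d_def fun_d_gen)
      show "0 \<in> ?Z" by (simp add: deRham_cocycles_def zero_dforms ext_d_typed d0)
      show "\<alpha> + \<beta> \<in> ?Z" if "\<alpha> \<in> ?Z" "\<beta> \<in> ?Z" for \<alpha> \<beta>
        using that ext_op_add[OF cf cf, OF that, of 1 0] by (simp add: deRham_cocycles_def dforms_add op)
      show "- \<alpha> \<in> ?Z" if "\<alpha> \<in> ?Z" for \<alpha>
        using that ext_op_uminus[OF cf, OF that, of 1 0] by (simp add: deRham_cocycles_def dforms_uminus op)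
    qed
    then show ?thesis by (simp only: deRham_cohomology_def eq)
  qed
  ultimately show ?thesis by blast
qed

end
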